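(* Fix parameters of the Hidden-Matching game as described in the context (a constant $\delta\in(0,1)$, integers $k,n_1$, a $(2n_1)$-vertex $(r_1,t_1)$-RS graph $G^{RS}_1$ and a $(2n_2)$-vertex $(r_2,t_2)$-RS graph $G^{RS}_2$ with $r_2=(k+\delta)n_1$). Any protocol $\pi$ (deterministic or randomized) for the Hidden-Matching game with communication cost \[ \mathsf{C}(\pi) = \min\{ o(t_2 \cdot r_2^{1-2/k}),\ o(t_1\cdot r_1)\} \] can only have value $\mathrm{val}(\pi) = o(r_1)$.
   Context: RS graphs. A bipartite graph $G=(L,R,E)$ with $|L|=|R|=n$ is called $(2n)$-vertex. A matching is induced if the subgraph induced on its vertices is the matching itself. A bipartite graph is an $(r,t)$-RS graph if its edges are partitioned into $t$ induced matchings $M_1,\dots,M_t$, each of size $r$; we fix an ordering $e_{1,j},\dots,e_{r,j}$ of the edges of each $M_j$. For a matching $M$ and vertex $u$, $M(u)$ is the partner of $u$ in $M$. Encoded-RS graph. For an $(r,t)$-RS graph $G=(L,R,E)$ and $X\in\{0,1\}^{r\times t}$, $H=\mathrm{EncodedRS}(G,X)$ has two vertices $a_v,b_v$ for each vertex $v$ of $G$, and for each $j\in[t]$, $i\in[r]$ with $e_{i,j}=(u,v)$, $u\in L$: if $X_{i,j}=0$ it contains edges $(a_u,a_v),(b_u,b_v)$; if $X_{i,j}=1$ it contains $(a_u,b_v),(b_u,a_v)$. The edges arising from $M_j$ form a matching $\mathrm{rep}(M_j)$ of size $2r$. Augmenting edges/paths. For $j\in[t]$ and a sequence $\vec u=(u_1,\dots,u_k)$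 of $k\ge2$ distinct vertices of $L(M_j)$, let $v_i=M_j(u_i)$. The augmenting edges of $\vec u$ are $(a_{v_i},a_{u_{i+1}})$ and $(b_{v_i},b_{u_{i+1}})$ for $i\in[k-1]$. The augmenting path $AP(\vec u)$ starts at $\mathrm{start}=a_{u_1}$ and alternately follows an edge of $\mathrm{rep}(M_j)$ and an augmenting edge, ending at a vertex $\mathrm{end}(AP(\vec u))\in\{a_{v_k},b_{v_k}\}$. Augmentation graph. For $X$, $j$, and an ordered collection $\mathcal U=(\vec u_1,\dots,\vec u_\ell)$ of $k$-sequences on $L(M_j)$ using pairwise distinct vertices overall, $A=\mathrm{AugGraph}(G,X,j,\mathcal U)$ has the vertices of $H=\mathrm{EncodedRS}(G,X)$ plus new vertex sets $P,Q$, and edge set $E(H)\cup\bar H$, where $\bar H$ consists of all augmenting edges of all $\vec u_i$, a perfect matching between $P$ and the vertices of $H$ not matched by $\mathrm{rep}(M_j)$, and a perfect matching between $Q$ and $\{\mathrm{start}(AP(\vec u_i))\}_{i\in[\ell]}$. Writing $\vec u_i=(u_{i,1},\dots,u_{i,k})$ and $v_{i,k}=M_j(u_{i,k})$: $\mathrm{aug}(A)=\{a_{v_{i,k}}: \mathrm{end}(AP(\vec u_i))=a_{v_{i,k}}\}$ and $\overline{\mathrm{aug}}(A)=\{a_{v_{i,k}}:\mathrm{end}(AP(\vec u_i))\ne a_{v_{i,k}}\}$. Distribution $\mathcal D_{\mathrm{aug}}(G,Y,k)$ for $Y\in\{0,1\}^\ell$ with $k\ell<r$: sample $j\in[t]$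 uniformly; then sample $(X,\mathcal U)$ uniformly among all pairs ($X\in\{0,1\}^{r\times t}$, $\mathcal U$ an ordered collection of $\ell$ vertex-disjoint $k$-sequences on $L(M_j)$) such that for each $i$, $\mathrm{end}(AP(\vec u_i))\in\mathrm{aug}(A)$ if $Y_i=0$ and $\in\overline{\mathrm{aug}}(A)$ if $Y_i=1$; output $A=\mathrm{AugGraph}(G,X,j,\mathcal U)$. Hidden-Matching game. Parameters: a constant $\delta\in(0,1)$, integers $k,n_1\ge1$, a fixed $(2n_1)$-vertex $(r_1,t_1)$-RS graph $G^{RS}_1$ with induced matchings $M^1_1,\dots,M^1_{t_1}$, $L(G^{RS}_1)=\{x_1,\dots,x_{n_1}\}$, $R(G^{RS}_1)=\{y_1,\dots,y_{n_1}\}$, and a fixed $(2n_2)$-vertex $(r_2,t_2)$-RS graph $G^{RS}_2$ with $r_2=(k+\delta)n_1$; these are known to both players, Alice and Bob, who may use public and private randomness. Phase I: Alice receives $G_A$, obtained from $G^{RS}_1$ by deleting each edge independently with probability $\delta$. Sample $j_1\in[t_1]$ uniformly; let $Y_L,Y_R\in\{0,1\}^{n_1}$ be the characteristic vectors of $L(M^1_{j_1})$ and $R(M^1_{j_1})$. Sample independently $A_L\sim\mathcal D_{\mathrm{aug}}(G^{RS}_2,Y_L,k)$ and $A_R\sim\mathcal D_{\mathrm{aug}}(G^{RS}_2,Y_R,k)$ (on disjoint vertex sets), with encoded-RS graphs $H_L,H_R$ and remaining edge sets $\bar H_L,\bar H_R$. Bob receives $G_B=H_L\cup H_R$. Alice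 sends a message to Bob and Bob responds with a message to Alice. Phase II: let $M_L$ match, for each $i\in[n_1]$, the vertex $a_{v_{i,k}}$ of the $i$-th sequence of $A_L$ (the vertices of $\mathrm{aug}(A_L)\cup\overline{\mathrm{aug}}(A_L)$) to $x_i$, and $M_R$ similarly match those of $A_R$ to $y_i$. Both players receive $G_2=M_L\cup M_R\cup\bar H_L\cup\bar H_R$, and Bob additionally receives $j_1$. Alice sends a message to Bob, and Bob outputs a set of edges. The output $\mathrm{out}(\pi,G)$ is the set of output edges belonging to $M^1_{j_1}$, defined as $\emptyset$ if Bob outputs any edge not in $G_A$. The value is $\mathrm{val}(\pi)=\mathbb E|\mathrm{out}(\pi,G)|$ over the input distribution (and randomness), and $\mathsf C(\pi)$ is the worst-case total number of bits communicated.
   Formalization: Asymptotics are for families with r_1→∞ (for bounded r_1 a zero-communication protocol has value ≥1−δ); k≥2, as sequences need it; in D_aug, for Y_i=1 the condition is a_{v_{i,k}}∈\overline{aug}(A), since the path's end can never lie in that set. *)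

theory Defs
  imports "HOL-Probability.Probability" "HOL-Library.Landau_Symbols" "HOL-Library.Extended_Nat"
begin

section \<open>Ruzsa--Szemeredi graphs\<close>

text \<open>
  Both sides of a bipartite graph on \<open>2n\<close> vertices are labelled \<open>0, \<dots>, n - 1\<close>; an edge is
  a pair (left label, right label). All indices start at \<open>0\<close>. The field \<open>rs_edge\<close> is the fixed
  ordering: \<open>rs_edge G i j\<close> is the \<open>i\<close>-th edge of the \<open>j\<close>-th matching.
\<close>

record rs_graph =
  rs_n :: nat
  rs_r :: nat
  rs_t :: nat
  rs_edge :: "nat \<Rightarrow> nat \<Rightarrow> nat \<times> nat"

definition rs_matching :: "rs_graph \<Rightarrow> nat \<Rightarrow> (nat \<times> nat) set" where
  "rs_matching G j = (\<lambda>i. rs_edge G i j) ` {..<rs_r G}"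

definition rs_edges :: "rs_graph \<Rightarrow> (nat \<times> nat) set" where
  "rs_edges G = (\<Union>j<rs_t G. rs_matching G j)"

definition bip_matching :: "(nat \<times> nat) set \<Rightarrow> bool" where
  "bip_matching M \<longleftrightarrow> inj_on fst M \<and> inj_on snd M"

definition induced_matching :: "(nat \<times> nat) set \<Rightarrow> (nat \<times> nat) set \<Rightarrow> bool" where
  "induced_matching E M \<longleftrightarrow> M \<subseteq> E \<and> bip_matching M \<and> E \<inter> (fst ` M \<times> snd ` M) = M"

definition is_rs_graph :: "rs_graph \<Rightarrow> bool" where
  "is_rs_graph G \<longleftrightarrow>
     rs_edges G \<subseteq> {..<rs_n G} \<times> {..<rs_n G} \<and>
     (\<forall>j<rs_t G. inj_on (\<lambda>i. rs_edge G i j) {..<rs_r G} \<and>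
        induced_matching (rs_edges G) (rs_matching G j)) \<and>
     (\<forall>j<rs_t G. \<forall>j'<rs_t G. j \<noteq> j' \<longrightarrow> rs_matching G j \<inter> rs_matching G j' = {})"

definition mate :: "(nat \<times> nat) set \<Rightarrow> nat \<Rightarrow> nat" where
  "mate M u = (THE v. (u, v) \<in> M)"


section \<open>Encoded RS graphs\<close>

text \<open>Edges of the graphs below are two-element sets of vertices.\<close>

datatype rs_vertex = LV nat | RV nat

datatype enc_vertex = AV rs_vertex | BV rs_vertex

definition enc_vertices :: "rs_graph \<Rightarrow> enc_vertex set" where
  "enc_vertices G = (let V = LV ` {..<rs_n G} \<union> RV ` {..<rs_n G} in AV ` V \<union> BV ` V)"

definition enc_edge :: "bool \<Rightarrow> nat \<times> nat \<Rightarrow> enc_vertex set set" where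
  "enc_edge b e =
     (if b then {{AV (LV (fst e)), BV (RV (snd e))}, {BV (LV (fst e)), AV (RV (snd e))}}
      else {{AV (LV (fst e)), AV (RV (snd e))}, {BV (LV (fst e)), BV (RV (snd e))}})"

definition rep :: "rs_graph \<Rightarrow> (nat \<times> nat \<Rightarrow> bool) \<Rightarrow> nat \<Rightarrow> enc_vertex set set" where
  "rep G X j = (\<Union>i<rs_r G. enc_edge (X (i, j)) (rs_edge G i j))"

definition encoded_rs :: "rs_graph \<Rightarrow> (nat \<times> nat \<Rightarrow> bool) \<Rightarrow> enc_vertex set set" where
  "encoded_rs G X = (\<Union>j<rs_t G. rep G X j)"


section \<open>Augmenting paths and augmentation graphs\<close>

definition augmenting_edges :: "rs_graph \<Rightarrow> nat \<Rightarrow> nat list \<Rightarrow> enc_vertex set set" where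
  "augmenting_edges G j us =
     (\<Union>i<length us - 1.
        let v = RV (mate (rs_matching G j) (us ! i)); u = LV (us ! Suc i)
        in {{AV v, AV u}, {BV v, BV u}})"

definition follow :: "'v set set \<Rightarrow> 'v \<Rightarrow> 'v" where
  "follow M w = (THE w'. {w, w'} \<in> M)"

primrec alternating_walk :: "nat \<Rightarrow> 'v set set \<Rightarrow> 'v set set \<Rightarrow> 'v \<Rightarrow> 'v list" where
  "alternating_walk 0 M N w = [w]"
| "alternating_walk (Suc m) M N w = w # alternating_walk m N M (follow M w)"

definition aug_start :: "nat list \<Rightarrow> enc_vertex" where
  "aug_start us = AV (LV (hd us))"

text \<open>For a \<open>k\<close>-sequence the path has \<open>k\<close> matching edges and \<open>k - 1\<close> augmenting edges.\<close>

definition aug_path ::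
  "rs_graph \<Rightarrow> (nat \<times> nat \<Rightarrow> bool) \<Rightarrow> nat \<Rightarrow> nat list \<Rightarrow> enc_vertex list" where
  "aug_path G X j us =
     alternating_walk (2 * length us - 1) (rep G X j) (augmenting_edges G j us) (aug_start us)"

definition aug_end :: "rs_graph \<Rightarrow> (nat \<times> nat \<Rightarrow> bool) \<Rightarrow> nat \<Rightarrow> nat list \<Rightarrow> enc_vertex" where
  "aug_end G X j us = last (aug_path G X j us)"

text \<open>The vertex \<open>a\<^bsub>v\<^esub>\<close> for \<open>v\<close> the partner of the last vertex of the sequence.\<close>

definition aug_target :: "rs_graph \<Rightarrow> nat \<Rightarrow> nat list \<Rightarrow> enc_vertex" where
  "aug_target G j us = AV (RV (mate (rs_matching G j) (last us)))"

definition aug_set ::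
  "rs_graph \<Rightarrow> (nat \<times> nat \<Rightarrow> bool) \<Rightarrow> nat \<Rightarrow> nat list list \<Rightarrow> enc_vertex set" where
  "aug_set G X j U = {aug_target G j us | us. us \<in> set U \<and> aug_end G X j us = aug_target G j us}"

definition aug_bar_set ::
  "rs_graph \<Rightarrow> (nat \<times> nat \<Rightarrow> bool) \<Rightarrow> nat \<Rightarrow> nat list list \<Rightarrow> enc_vertex set" where
  "aug_bar_set G X j U = {aug_target G j us | us. us \<in> set U \<and> aug_end G X j us \<noteq> aug_target G j us}"

text \<open>
  \<open>PV w\<close> is the new vertex matched to the vertex \<open>w\<close> missed by \<open>rep\<close>, and \<open>QV i\<close> the new
  vertex matched to the start of the \<open>i\<close>-th path.
\<close>

datatype aug_vertex = HV enc_vertex | PV enc_vertex | QV nat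

text \<open>
  An augmentation graph is kept together with its decomposition into the encoded part \<open>ag_enc\<close>
  and the remaining edges \<open>ag_rest\<close>, and with the list \<open>ag_targets\<close> of the vertices
  \<open>aug_target\<close> in the order of the sequences. Every vertex has an incident edge, so the edges
  determine the vertex set.
\<close>

record aug_graph =
  ag_enc :: "aug_vertex set set"
  ag_rest :: "aug_vertex set set"
  ag_targets :: "aug_vertex list"

definition aug_graph_of ::
  "rs_graph \<Rightarrow> (nat \<times> nat \<Rightarrow> bool) \<Rightarrow> nat \<Rightarrow> nat list list \<Rightarrow> aug_graph" where
  "aug_graph_of G X j U =
     \<lparr> ag_enc = (`) HV ` encoded_rs G X,
       ag_rest = (`) HV ` (\<Union>us\<in>set U. augmenting_edges G j us)
         \<union> {{PV w, HV w} | w. w \<in> enc_vertices G - \<Union>(rep G X j)}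
         \<union> {{QV i, HV (aug_start (U ! i))} | i. i < length U},
       ag_targets = map (\<lambda>us. HV (aug_target G j us)) U \<rparr>"

definition valid_seqs :: "rs_graph \<Rightarrow> nat \<Rightarrow> nat \<Rightarrow> nat \<Rightarrow> nat list list \<Rightarrow> bool" where
  "valid_seqs G j l k U \<longleftrightarrow>
     length U = l \<and> (\<forall>us\<in>set U. length us = k) \<and>
     distinct (concat U) \<and> set (concat U) \<subseteq> fst ` rs_matching G j"

text \<open>
  \<open>Y\<close> stands for its first \<open>l\<close> entries. The target of the \<open>i\<close>-th sequence is required to lie
  in \<open>aug_set\<close> or \<open>aug_bar_set\<close> (and not the end of the path, which never is an element of
  \<open>aug_bar_set\<close>).
\<close>

definition aug_instances ::
  "rs_graph \<Rightarrow> (nat \<Rightarrow> bool) \<Rightarrow> nat \<Rightarrow> nat \<Rightarrow> nat \<Rightarrow> ((nat \<times> nat \<Rightarrow> bool) \<times> nat list list) set" where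
  "aug_instances G Y l k j =
     {(X, U). X \<in> ({..<rs_r G} \<times> {..<rs_t G}) \<rightarrow>\<^sub>E UNIV \<and> valid_seqs G j l k U \<and>
        (\<forall>i<l. aug_target G j (U ! i) \<in> (if Y i then aug_bar_set G X j U else aug_set G X j U))}"

definition D_aug :: "rs_graph \<Rightarrow> (nat \<Rightarrow> bool) \<Rightarrow> nat \<Rightarrow> nat \<Rightarrow> aug_graph pmf" where
  "D_aug G Y l k =
     do {
       j \<leftarrow> pmf_of_set {..<rs_t G};
       (X, U) \<leftarrow> pmf_of_set (aug_instances G Y l k j);
       return_pmf (aug_graph_of G X j U)
     }"


section \<open>The Hidden-Matching game\<close>

text \<open>
  \<open>XV i\<close> and \<open>YV i\<close> are the left and right vertex \<open>i\<close> of the first RS graph; \<open>GL\<close> and \<open>GR\<close>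
  make the vertex sets of the two augmentation graphs disjoint.
\<close>

datatype game_vertex = XV nat | YV nat | GL aug_vertex | GR aug_vertex

text \<open>Sequences of \<open>k\<close> vertices are used only for \<open>k \<ge> 2\<close>; uniform indices need \<open>t \<ge> 1\<close>.\<close>

definition hm_params :: "real \<Rightarrow> nat \<Rightarrow> rs_graph \<Rightarrow> rs_graph \<Rightarrow> bool" where
  "hm_params \<delta> k G1 G2 \<longleftrightarrow>
     0 < \<delta> \<and> \<delta> < 1 \<and> k \<ge> 2 \<and> rs_n G1 \<ge> 1 \<and>
     is_rs_graph G1 \<and> rs_t G1 \<ge> 1 \<and> is_rs_graph G2 \<and> rs_t G2 \<ge> 1 \<and>
     real (rs_r G2) = (real k + \<delta>) * real (rs_n G1)"

record hm_input =
  in_A :: "(nat \<times> nat) set"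
  in_j :: nat
  in_L :: aug_graph
  in_R :: aug_graph

definition subsampled_graph :: "real \<Rightarrow> rs_graph \<Rightarrow> (nat \<times> nat) set pmf" where
  "subsampled_graph \<delta> G =
     map_pmf (\<lambda>keep. {e \<in> rs_edges G. keep e})
       (Pi_pmf (rs_edges G) False (\<lambda>_. bernoulli_pmf (1 - \<delta>)))"

definition hm_dist :: "real \<Rightarrow> nat \<Rightarrow> rs_graph \<Rightarrow> rs_graph \<Rightarrow> hm_input pmf" where
  "hm_dist \<delta> k G1 G2 =
     do {
       GA \<leftarrow> subsampled_graph \<delta> G1;
       j \<leftarrow> pmf_of_set {..<rs_t G1};
       AL \<leftarrow> D_aug G2 (\<lambda>i. i \<in> fst ` rs_matching G1 j) (rs_n G1) k;
       AR \<leftarrow> D_aug G2 (\<lambda>i. i \<in> snd ` rs_matching G1 j) (rs_n G1) k;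
       return_pmf \<lparr> in_A = GA, in_j = j, in_L = AL, in_R = AR \<rparr>
     }"

definition graph_B :: "hm_input \<Rightarrow> game_vertex set set" where
  "graph_B I = (`) GL ` ag_enc (in_L I) \<union> (`) GR ` ag_enc (in_R I)"

definition graph_2 :: "hm_input \<Rightarrow> game_vertex set set" where
  "graph_2 I =
     {{GL (ag_targets (in_L I) ! i), XV i} | i. i < length (ag_targets (in_L I))}
     \<union> {{GR (ag_targets (in_R I) ! i), YV i} | i. i < length (ag_targets (in_R I))}
     \<union> (`) GL ` ag_rest (in_L I) \<union> (`) GR ` ag_rest (in_R I)"

text \<open>
  A protocol draws independent seeds: a public one, one private to Alice and one private to Bob.
  Deterministic protocols are those with constant seeds. \<open>p_alice1\<close>, \<open>p_bob1\<close> and \<open>p_alice2\<close> are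
  the three messages as bit strings, \<open>p_bob2\<close> is the output; edges of the first RS graph are
  given as pairs of labels. A player's own earlier messages can be recomputed from the arguments.
\<close>

record ('p, 'a, 'b) protocol =
  p_pub :: "'p pmf"
  p_privA :: "'a pmf"
  p_privB :: "'b pmf"
  p_alice1 :: "'p \<Rightarrow> 'a \<Rightarrow> (nat \<times> nat) set \<Rightarrow> bool list"
  p_bob1 :: "'p \<Rightarrow> 'b \<Rightarrow> game_vertex set set \<Rightarrow> bool list \<Rightarrow> bool list"
  p_alice2 :: "'p \<Rightarrow> 'a \<Rightarrow> (nat \<times> nat) set \<Rightarrow> bool list \<Rightarrow> game_vertex set set \<Rightarrow> bool list"
  p_bob2 :: "'p \<Rightarrow> 'b \<Rightarrow> game_vertex set set \<Rightarrow> bool list \<Rightarrow> bool list \<Rightarrow>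
    game_vertex set set \<Rightarrow> nat \<Rightarrow> (nat \<times> nat) set"

definition seeds :: "('p, 'a, 'b) protocol \<Rightarrow> ('p \<times> 'a \<times> 'b) pmf" where
  "seeds \<pi> = pair_pmf (p_pub \<pi>) (pair_pmf (p_privA \<pi>) (p_privB \<pi>))"

definition transcript ::
  "('p, 'a, 'b) protocol \<Rightarrow> 'p \<times> 'a \<times> 'b \<Rightarrow> hm_input \<Rightarrow> bool list \<times> bool list \<times> bool list" where
  "transcript \<pi> s I =
     (case s of (p, a, b) \<Rightarrow>
        let m1 = p_alice1 \<pi> p a (in_A I);
            m2 = p_bob1 \<pi> p b (graph_B I) m1;
            m3 = p_alice2 \<pi> p a (in_A I) m2 (graph_2 I)
        in (m1, m2, m3))"

definition bits :: "bool list \<times> bool list \<times> bool list \<Rightarrow> nat" where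
  "bits T = (case T of (m1, m2, m3) \<Rightarrow> length m1 + length m2 + length m3)"

definition bob_output ::
  "('p, 'a, 'b) protocol \<Rightarrow> 'p \<times> 'a \<times> 'b \<Rightarrow> hm_input \<Rightarrow> (nat \<times> nat) set" where
  "bob_output \<pi> s I =
     (case s of (p, a, b) \<Rightarrow> case transcript \<pi> s I of (m1, m2, m3) \<Rightarrow>
        p_bob2 \<pi> p b (graph_B I) m1 m3 (graph_2 I) (in_j I))"

definition hm_out ::
  "rs_graph \<Rightarrow> ('p, 'a, 'b) protocol \<Rightarrow> 'p \<times> 'a \<times> 'b \<Rightarrow> hm_input \<Rightarrow> (nat \<times> nat) set" where
  "hm_out G1 \<pi> s I =
     (if bob_output \<pi> s I \<subseteq> in_A I then bob_output \<pi> s I \<inter> rs_matching G1 (in_j I) else {})"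

definition hm_val ::
  "real \<Rightarrow> nat \<Rightarrow> rs_graph \<Rightarrow> rs_graph \<Rightarrow> ('p, 'a, 'b) protocol \<Rightarrow> real" where
  "hm_val \<delta> k G1 G2 \<pi> =
     measure_pmf.expectation (pair_pmf (seeds \<pi>) (hm_dist \<delta> k G1 G2))
       (\<lambda>(s, I). real (card (hm_out G1 \<pi> s I)))"

text \<open>The supremum is taken in the extended naturals: infinitely many seeds may be possible.\<close>

definition comm_cost ::
  "real \<Rightarrow> nat \<Rightarrow> rs_graph \<Rightarrow> rs_graph \<Rightarrow> ('p, 'a, 'b) protocol \<Rightarrow> enat" where
  "comm_cost \<delta> k G1 G2 \<pi> =
     (SUP (s, I) \<in> set_pmf (seeds \<pi>) \<times> set_pmf (hm_dist \<delta> k G1 G2).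
        enat (bits (transcript \<pi> s I)))"

end

theory Submission
  imports Defs
begin

text \<open>
  The end of an augmenting path is the parity of the code bits along it. Bob's message is one of at
  most \<open>4\<^sup>C\<close> strings, and for each fixed string the advantage of a test for \<open>Y\<close> averages, over the
  independent columns \<open>j\<close> of the code, quantities \<open>\<Phi>\<^sub>j \<le> 1\<close> of mean \<open>0\<close>. A union bound over the strings
  therefore only needs an exponential moment of \<open>\<Phi>\<^sub>j\<close>. Expanding \<open>\<Phi>\<^sub>j\<close> in characters, the level-\<open>km\<close>
  part has squared norm at most \<open>(l choose m)\<^sup>2 / (r choose km)\<close>, since the union of \<open>m\<close> random blocks is a
  uniform \<open>km\<close>-set. For \<open>k = 2\<close> these weights have a bounded sum, which suffices as then \<open>C = o(t)\<close>;
  for \<open>k \<ge> 3\<close> hypercontractivity, with a moment depending on the level, gives tails of order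
  \<open>exp (- 2 \<theta>)\<close> for \<open>\<theta>\<close> proportional to \<open>r powr (1 - 2 / k)\<close>.

  Hence the messages and the second-phase graph are nearly independent of the index \<open>j\<^sub>1\<close>. The set
  most likely to survive given the messages then serves for all \<open>t\<^sub>1\<close> matchings at once, and a second
  union bound shows that \<open>o(t\<^sub>1 r\<^sub>1)\<close> bits cannot certify a constant fraction of most matchings.
\<close>

section \<open>Hypercontractivity for even moments on the discrete cube\<close>

text \<open>The exponent 1 - 2/k comes from balancing two effects at degree d. A moment of order s
  about \<theta>/d costs a factor of order (\<theta>/d)^d, while the level weight is at most
  r^(2d/k) * (d/r)^d. The powers of d cancel and the product is (\<theta> * r^(2/k) / r)^d up to a
  constant to the power d, which is small when \<theta> is a small multiple of r^(1 - 2/k).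

  Two obstacles shape the rest. The likelihood ratio behind the bias can reach 2^l, so the bias can
  be as low as -(2^l - 1); only its upper side is bounded, and all exponential estimates are
  one-sided. Moreover, nothing can be hidden from a test that reads the encoded graphs themselves: a
  test may use them only through a short message, whereas Bob's output reads his whole graph.
  Replacing that output by a set computed from the messages, the index and the second-phase graph
  turns success into an admissible test. The comparison law draws code and sequences independently
  and so ignores the index.\<close>

lemma choose_even_le: "real (2 * s choose (2 * i)) \<le> real (s choose i) * real (2 * s - 1) ^ i"
proof (induction i)
  case 0
  show ?case by simp
next
  case (Suc i)
  show ?case
  proof (cases "Suc i \<le> s")
    case False
    then have "2 * s choose (2 * Suc i) = 0" by (intro binomial_eq_0) simp
    then show ?thesis by (metis of_nat_0 of_nat_0_le_iff of_nat_mult of_nat_power)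
  next
    case True
    have step: "real (n choose Suc k) * real (Suc k) = real (n choose k) * real (n - k)" for n k :: nat
    proof -
      have "(n choose Suc k) * Suc k = (n choose k) * (n - k)"
        by (metis binomial_absorb_comp binomial_absorption mult.commute)
      then show ?thesis by (metis of_nat_mult)
    qed
    define A where "A = real (2 * s choose (2 * i))"
    define B where "B = real (s choose i)"
    \<comment> \<open>Passing from \<open>i\<close> to \<open>i + 1\<close> multiplies the left side
      by (2s-2i)(2s-2i-1) / ((2i+2)(2i+1)) and the binomial on the right by (s-i)/(i+1). The
      quotient of these factors is (2s-2i-1)/(2i+1), which is at most 2s-1.\<close>
    have e1: "real (2 * s choose (2 * Suc i)) * (2 * real i + 2) * (2 * real i + 1)
        = A * (2 * real s - 2 * real i) * (2 * real s - 2 * real i - 1)"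
    proof -
      define P where "P = real (2 * s choose Suc (2 * i))"
      define Q where "Q = real (2 * s choose (2 * Suc i))"
      have "P * (2 * real i + 1) = A * (2 * real s - 2 * real i)"
        using step[of "2 * s" "2 * i"] True by (simp add: P_def A_def of_nat_diff add.commute)
      moreover have "Q * (2 * real i + 2) = P * (2 * real s - 2 * real i - 1)"
        using step[of "2 * s" "Suc (2 * i)"] True
        by (simp add: P_def Q_def of_nat_diff add.commute)
      ultimately show ?thesis unfolding Q_def[symmetric] by algebra
    qed
    have e2: "real (s choose Suc i) * (real i + 1) = B * (real s - real i)"
      using step[of s i] True unfolding B_def by (simp add: of_nat_diff algebra_simps)
    have A0: "0 \<le> A" and B0: "0 \<le> B" unfolding A_def B_def by simp_all
    have si: "real s - real i \<ge> 1" using True by linarith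
    have IH: "A \<le> B * real (2 * s - 1) ^ i" using Suc.IH unfolding A_def B_def .
    have "real (2 * s choose (2 * Suc i)) * (2 * real i + 1) * (2 * (real i + 1))
        = A * (2 * real s - 2 * real i - 1) * (2 * (real s - real i))"
      using e1 by (simp add: algebra_simps)
    also have "\<dots> \<le> (B * real (2 * s - 1) ^ i) * (2 * real s - 1) * (2 * (real s - real i))"
      by (intro mult_mono IH mult_nonneg_nonneg B0) (use si A0 in auto)
    also have "\<dots> = (real (s choose Suc i) * real (2 * s - 1) ^ Suc i) * (2 * (real i + 1))"
    proof -
      have "real (2 * s - 1) = 2 * real s - 1" using True by (simp add: of_nat_diff)
      then show ?thesis using e2 by simp algebra
    qed
    finally have "real (2 * s choose (2 * Suc i)) * (2 * real i + 1) \<le>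
        real (s choose Suc i) * real (2 * s - 1) ^ Suc i"
      by (rule mult_right_le_imp_le) simp
    moreover have "real (2 * s choose (2 * Suc i)) * 1 \<le> real (2 * s choose (2 * Suc i)) * (2 * real i + 1)"
      by (intro mult_left_mono) auto
    ultimately show ?thesis by linarith
  qed
qed

lemma even_part_binomial:
  fixes g h :: real
  shows "(g + h) ^ (2 * s) + (g - h) ^ (2 * s)
    = 2 * (\<Sum>i\<le>s. real (2 * s choose (2 * i)) * (h\<^sup>2) ^ i * (g\<^sup>2) ^ (s - i))"
proof -
  have "(g + h) ^ (2 * s) + (g - h) ^ (2 * s)
      = (\<Sum>i\<le>2 * s. real (2 * s choose i) * g ^ (2 * s - i) * (h ^ i + (- h) ^ i))"
    using binomial_ring[of h g "2 * s"] binomial_ring[of "- h" g "2 * s"]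
    by (simp add: sum.distrib[symmetric] algebra_simps)
  also have "\<dots> = (\<Sum>i\<in>{i. i \<le> 2 * s \<and> even i}. real (2 * s choose i) * g ^ (2 * s - i) * (h ^ i + (- h) ^ i))"
    by (intro sum.mono_neutral_right) (auto simp: power_minus_odd)
  also have "\<dots> = (\<Sum>i\<le>s. real (2 * s choose (2 * i)) * g ^ (2 * s - 2 * i) * (h ^ (2 * i) + (- h) ^ (2 * i)))"
    by (rule sum.reindex_bij_witness[of _ "\<lambda>i. 2 * i" "\<lambda>i. i div 2"]) auto
  also have "\<dots> = 2 * (\<Sum>i\<le>s. real (2 * s choose (2 * i)) * (h\<^sup>2) ^ i * (g\<^sup>2) ^ (s - i))"
    unfolding sum_distrib_left
    by (intro sum.cong refl) (simp add: power_mult[symmetric] diff_mult_distrib2)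
  finally show ?thesis .
qed

text \<open>Bonami's two-point inequality for the exponent \<open>2 * s\<close>. Odd powers of
  \<open>h\<close> cancel, and the even ones are compared term by term with the expansion of the
  right side through \<open>choose_even_le\<close>. The factor 2s - 1 is the usual hypercontractive
  ratio (2s-1)/(2-1).\<close>

lemma two_point_inequality:
  fixes g h :: real
  shows "(g + h) ^ (2 * s) + (g - h) ^ (2 * s) \<le> 2 * (g\<^sup>2 + real (2 * s - 1) * h\<^sup>2) ^ s"
proof -
  have "(\<Sum>i\<le>s. real (2 * s choose (2 * i)) * (h\<^sup>2) ^ i * (g\<^sup>2) ^ (s - i))
      \<le> (\<Sum>i\<le>s. (real (s choose i) * real (2 * s - 1) ^ i) * (h\<^sup>2) ^ i * (g\<^sup>2) ^ (s - i))"
    by (intro sum_mono mult_right_mono choose_even_le) auto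
  also have "\<dots> = (real (2 * s - 1) * h\<^sup>2 + g\<^sup>2) ^ s"
    unfolding binomial_ring by (intro sum.cong refl) (simp only: power_mult_distrib ac_simps)
  finally show ?thesis unfolding even_part_binomial by (simp only: add.commute mult_le_cancel_left_pos)
qed

lemma convex_on_power_nonneg: "convex_on {0::real..} (\<lambda>x. x ^ n)"
  by (cases "even n") (auto intro: convex_power_odd convex_on_subset[OF convex_power_even])

text \<open>The triangle inequality in L^s, written without roots. Convexity of the s-th power is
  applied to G/a and H/b with the weights a/(a+b) and b/(a+b).\<close>

lemma minkowski_power:
  fixes G H :: "'a \<Rightarrow> real"
  assumes G: "\<And>x. x \<in> A \<Longrightarrow> 0 \<le> G x" and H: "\<And>x. x \<in> A \<Longrightarrow> 0 \<le> H x"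
    and a: "0 < a" and b: "0 < b"
    and Ga: "(\<Sum>x\<in>A. G x ^ s) \<le> N * a ^ s" and Hb: "(\<Sum>x\<in>A. H x ^ s) \<le> N * b ^ s"
  shows "(\<Sum>x\<in>A. (G x + H x) ^ s) \<le> N * (a + b) ^ s"
proof -
  define w where "w = a / (a + b)"
  have w: "0 \<le> w" "w \<le> 1" "1 - w = b / (a + b)" using a b by (auto simp: w_def field_simps)
  have pt: "(G x + H x) ^ s \<le> (a + b) ^ s * (w * (G x / a) ^ s + (1 - w) * (H x / b) ^ s)"
    if "x \<in> A" for x
  proof -
    have "(w * (G x / a) + (1 - w) * (H x / b)) ^ s \<le> w * (G x / a) ^ s + (1 - w) * (H x / b) ^ s"
      using convex_onD[OF convex_on_power_nonneg[of s] w(1,2), of "H x / b" "G x / a"]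
        a b G[OF that] H[OF that] by (simp add: add.commute)
    moreover have "G x + H x = (a + b) * (w * (G x / a) + (1 - w) * (H x / b))"
    proof -
      have "w * (G x / a) = G x / (a + b)" "(1 - w) * (H x / b) = H x / (a + b)"
        unfolding w(3) using a b by (simp_all add: w_def)
      then show ?thesis using a b by (simp add: add_divide_distrib[symmetric])
    qed
    ultimately show ?thesis
      using a b by (metis add_nonneg_nonneg less_imp_le mult_left_mono power_mult_distrib zero_le_power)
  qed
  have "(\<Sum>x\<in>A. (G x + H x) ^ s)
      \<le> (a + b) ^ s * (w * ((\<Sum>x\<in>A. G x ^ s) / a ^ s) + (1 - w) * ((\<Sum>x\<in>A. H x ^ s) / b ^ s))"
    using sum_mono[OF pt]
    by (simp add: sum_distrib_left sum.distrib sum_divide_distrib power_divide distrib_left)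
  also have "\<dots> \<le> (a + b) ^ s * (w * N + (1 - w) * N)"
    using w a b Ga Hb by (intro mult_left_mono add_mono) (auto simp: field_simps)
  finally show ?thesis by (simp add: algebra_simps)
qed

text \<open>A point of the cube is encoded as the set of its 1-coordinates, a subset of
  \<open>I\<close>; \<open>chi S\<close> is then the Walsh character of \<open>S\<close>.\<close>

definition chi :: "'a set \<Rightarrow> 'a set \<Rightarrow> real" where
  "chi S x = (- 1) ^ card (S \<inter> x)"

definition cube_avg :: "'a set \<Rightarrow> ('a set \<Rightarrow> real) \<Rightarrow> real" where
  "cube_avg I f = (\<Sum>x\<in>Pow I. f x) / 2 ^ card I"

lemma sum_Pow_insert:
  assumes "finite I" "a \<notin> I"
  shows "(\<Sum>x\<in>Pow (insert a I). f x) = (\<Sum>x\<in>Pow I. f x) + (\<Sum>x\<in>Pow I. f (insert a x))"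
proof -
  have "(\<Sum>x\<in>Pow (insert a I). f x) = (\<Sum>x\<in>Pow I. f x) + (\<Sum>x\<in>insert a ` Pow I. f x)"
    unfolding Pow_insert using assms by (intro sum.union_disjoint) auto
  also have "(\<Sum>x\<in>insert a ` Pow I. f x) = (\<Sum>x\<in>Pow I. f (insert a x))"
    by (subst sum.reindex) (use assms in \<open>auto intro!: inj_onI simp: insert_ident\<close>)
  finally show ?thesis .
qed

text \<open>Induction on the coordinates. Along a new coordinate the function takes the two values g
  + h and g - h; the two-point inequality bounds the pair through g^2 + K * h^2, and the triangle
  inequality in L^s then lets the induction hypothesis act on g and h separately.\<close>

lemma hypercontractive_sum:
  fixes c :: "'a set \<Rightarrow> real"
  assumes "finite I"
  shows "(\<Sum>x\<in>Pow I. (\<Sum>S\<in>Pow I. c S * chi S x) ^ (2 * s))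
    \<le> 2 ^ card I * (\<Sum>S\<in>Pow I. real (2 * s - 1) ^ card S * (c S)\<^sup>2) ^ s"
  using assms
proof (induction I arbitrary: c rule: finite_induct)
  case empty
  show ?case by (simp add: chi_def power_mult)
next
  case (insert a I)
  show ?case
  proof (cases "s = 0")
    \<comment> \<open>Here \<open>2 * s - 1\<close> truncates to 0, so that \<open>K \<ge> 1\<close>
      would fail below; both sides count the points of the cube.\<close>
    case True
    then show ?thesis using insert.hyps by (simp add: card_Pow)
  next
    case False
    define g where "g x = (\<Sum>S\<in>Pow I. c S * chi S x)" for x
    define h where "h x = (\<Sum>S\<in>Pow I. c (insert a S) * chi S x)" for x
    define K where "K = real (2 * s - 1)"
    have K: "K \<ge> 1" using False by (simp add: K_def)
    define A where "A = (\<Sum>S\<in>Pow I. K ^ card S * (c S)\<^sup>2)"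
    define B where "B = (\<Sum>S\<in>Pow I. K ^ card S * (c (insert a S))\<^sup>2)"
    have fin: "finite S" if "S \<in> Pow I" for S using that insert.hyps(1) finite_subset by auto
    have ch: "chi (insert a S) x = chi S x" "chi S (insert a x) = chi S x"
      "chi (insert a S) (insert a x) = - chi S x" if "S \<in> Pow I" "x \<in> Pow I" for S x
    proof -
      have "a \<notin> S" "a \<notin> x" using that insert.hyps by auto
      moreover have "finite (S \<inter> x)" using fin that by auto
      ultimately show "chi (insert a S) x = chi S x" "chi S (insert a x) = chi S x"
        "chi (insert a S) (insert a x) = - chi S x"
        by (simp_all add: chi_def)
    qed
    have f1: "(\<Sum>S\<in>Pow (insert a I). c S * chi S x) = g x + h x"
      and f2: "(\<Sum>S\<in>Pow (insert a I). c S * chi S (insert a x)) = g x - h x" if "x \<in> Pow I" for x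
    proof -
      have *: "c (insert a S) * chi (insert a S) x = c (insert a S) * chi S x"
        "c S * chi S (insert a x) = c S * chi S x"
        "c (insert a S) * chi (insert a S) (insert a x) = - (c (insert a S) * chi S x)"
        if "S \<in> Pow I" for S using ch[OF that \<open>x \<in> Pow I\<close>] by simp_all
      show "(\<Sum>S\<in>Pow (insert a I). c S * chi S x) = g x + h x"
        unfolding sum_Pow_insert[OF insert.hyps] g_def h_def
        by (intro arg_cong2[of _ _ _ _ "(+)"] sum.cong refl *)
      show "(\<Sum>S\<in>Pow (insert a I). c S * chi S (insert a x)) = g x - h x"
        unfolding sum_Pow_insert[OF insert.hyps] g_def h_def diff_conv_add_uminus sum_negf[symmetric]
        by (intro arg_cong2[of _ _ _ _ "(+)"] sum.cong refl *)
    qed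
    have "(\<Sum>x\<in>Pow (insert a I). (\<Sum>S\<in>Pow (insert a I). c S * chi S x) ^ (2 * s))
        = (\<Sum>x\<in>Pow I. (g x + h x) ^ (2 * s) + (g x - h x) ^ (2 * s))"
      by (subst sum_Pow_insert[OF insert.hyps])
        (use f1 f2 in \<open>simp only: sum.distrib[symmetric] cong: sum.cong\<close>)
    also have "\<dots> \<le> (\<Sum>x\<in>Pow I. 2 * ((g x)\<^sup>2 + K * (h x)\<^sup>2) ^ s)"
      unfolding K_def by (intro sum_mono two_point_inequality)
    also have "\<dots> = 2 * (\<Sum>x\<in>Pow I. ((g x)\<^sup>2 + K * (h x)\<^sup>2) ^ s)"
      by (simp add: sum_distrib_left)
    also have "\<dots> \<le> 2 * (2 ^ card I * (A + K * B) ^ s)"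
    proof (intro mult_left_mono)
      have IHg: "(\<Sum>x\<in>Pow I. ((g x)\<^sup>2) ^ s) \<le> 2 ^ card I * A ^ s"
        using insert.IH[of c] unfolding g_def A_def K_def power_mult .
      have IHh: "(\<Sum>x\<in>Pow I. ((h x)\<^sup>2) ^ s) \<le> 2 ^ card I * B ^ s"
        using insert.IH[of "\<lambda>S. c (insert a S)"] unfolding h_def B_def K_def power_mult .
      have nn: "0 \<le> A" "0 \<le> B" using K by (auto simp: A_def B_def intro!: sum_nonneg)
      show "(\<Sum>x\<in>Pow I. ((g x)\<^sup>2 + K * (h x)\<^sup>2) ^ s) \<le> 2 ^ card I * (A + K * B) ^ s"
      \<comment> \<open>\<open>minkowski_power\<close> divides by both bounds. If one of them
        vanishes, all coefficients of the corresponding part vanish and the other part remains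
        alone.\<close>
      proof (cases "A = 0 \<or> B = 0")
        case True
        then show ?thesis
        proof
          assume "A = 0"
          then have "c S = 0" if "S \<in> Pow I" for S
            using that K insert.hyps by (auto simp: A_def sum_nonneg_eq_0_iff)
          then have "g x = 0" for x unfolding g_def by (intro sum.neutral) simp
          then show ?thesis using IHh \<open>A = 0\<close> K
            by (simp add: power_mult_distrib sum_distrib_left[symmetric] mult.left_commute)
        next
          assume "B = 0"
          then have "c (insert a S) = 0" if "S \<in> Pow I" for S
            using that K insert.hyps by (auto simp: B_def sum_nonneg_eq_0_iff)
          then have "h x = 0" for x unfolding h_def by (intro sum.neutral) simp
          then show ?thesis using IHg \<open>B = 0\<close> by simp
        qed
      next
        case False
        have "(\<Sum>x\<in>Pow I. (K * (h x)\<^sup>2) ^ s) \<le> 2 ^ card I * (K * B) ^ s"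
          using IHh K by (simp add: power_mult_distrib sum_distrib_left[symmetric] mult.left_commute)
        with IHg show ?thesis
          using False nn K by (intro minkowski_power) auto
      qed
    qed simp
    also have "A + K * B = (\<Sum>S\<in>Pow (insert a I). K ^ card S * (c S)\<^sup>2)"
    proof -
      have "K * B = (\<Sum>S\<in>Pow I. K ^ card (insert a S) * (c (insert a S))\<^sup>2)"
        unfolding B_def sum_distrib_left
      proof (intro sum.cong refl)
        fix S assume S: "S \<in> Pow I"
        then have "card (insert a S) = Suc (card S)"
          using fin[OF S] insert.hyps by (intro card_insert_disjoint) auto
        then show "K * (K ^ card S * (c (insert a S))\<^sup>2) = K ^ card (insert a S) * (c (insert a S))\<^sup>2"
          by simp
      qed
      then show ?thesis using insert.hyps by (subst sum_Pow_insert) (simp_all add: A_def)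
    qed
    finally show ?thesis unfolding K_def card_insert_disjoint[OF insert.hyps] power_Suc mult.assoc .
  qed
qed

lemma hypercontractive:
  fixes c :: "'a set \<Rightarrow> real"
  assumes "finite I"
  shows "cube_avg I (\<lambda>x. (\<Sum>S\<in>Pow I. c S * chi S x) ^ (2 * s))
    \<le> (\<Sum>S\<in>Pow I. real (2 * s - 1) ^ card S * (c S)\<^sup>2) ^ s"
  using hypercontractive_sum[OF assms, of c s]
  by (simp add: cube_avg_def pos_divide_le_eq mult.commute)

lemma chi_mult: "finite S \<Longrightarrow> finite T \<Longrightarrow> chi S x * chi T x = chi (S - T \<union> (T - S)) x"
proof -
  assume fin: "finite S" "finite T"
  let ?a = "card ((S - T) \<inter> x)" and ?b = "card ((T - S) \<inter> x)" and ?c = "card (S \<inter> T \<inter> x)"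
  have "card (S \<inter> x) = ?a + ?c" "card (T \<inter> x) = ?b + ?c"
    "card ((S - T \<union> (T - S)) \<inter> x) = ?a + ?b"
  proof -
    have "S \<inter> x = (S - T) \<inter> x \<union> S \<inter> T \<inter> x" "T \<inter> x = (T - S) \<inter> x \<union> S \<inter> T \<inter> x"
      "(S - T \<union> (T - S)) \<inter> x = (S - T) \<inter> x \<union> (T - S) \<inter> x" by blast+
    moreover have "card ((S - T) \<inter> x \<union> S \<inter> T \<inter> x) = ?a + ?c"
      "card ((T - S) \<inter> x \<union> S \<inter> T \<inter> x) = ?b + ?c" "card ((S - T) \<inter> x \<union> (T - S) \<inter> x) = ?a + ?b"
      by (rule card_Un_disjoint; use fin in blast)+
    ultimately show "card (S \<inter> x) = ?a + ?c" "card (T \<inter> x) = ?b + ?c"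
      "card ((S - T \<union> (T - S)) \<inter> x) = ?a + ?b" by metis+
  qed
  then have "chi S x * chi T x = ((- 1) ^ ?c * (- 1) ^ ?c) * ((- 1) ^ ?a * (- 1) ^ ?b)"
    "chi (S - T \<union> (T - S)) x = (- 1) ^ ?a * (- 1) ^ ?b"
    unfolding chi_def by (simp_all add: power_add)
  moreover have "(- 1 :: real) ^ ?c * (- 1) ^ ?c = 1"
    by (simp add: power_mult_distrib[symmetric])
  ultimately show ?thesis by simp
qed

text \<open>Multiplying by the character of all of \<open>I\<close> sends \<open>chi S\<close> to
  \<open>chi (I - S)\<close>, hence degree d to \<open>card I - d\<close>, and an even power does
  not see this sign. So the smaller of the two degrees counts, which matters for the top levels,
  whose degree exceeds half of \<open>card I\<close>.\<close>

lemma hypercontractive_homogeneous: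
  fixes c :: "'a set \<Rightarrow> real"
  assumes I: "finite I" and hom: "\<And>S. S \<subseteq> I \<Longrightarrow> card S \<noteq> d \<Longrightarrow> c S = 0"
    and s: "1 \<le> s"
  shows "cube_avg I (\<lambda>x. (\<Sum>S\<in>Pow I. c S * chi S x) ^ (2 * s))
    \<le> (real (2 * s - 1) ^ min d (card I - d) * (\<Sum>S\<in>Pow I. (c S)\<^sup>2)) ^ s"
proof -
  define K where "K = real (2 * s - 1)"
  have fin: "finite S" if "S \<subseteq> I" for S using that I finite_subset by auto
  have low: "cube_avg I (\<lambda>x. (\<Sum>S\<in>Pow I. c S * chi S x) ^ (2 * s))
      \<le> (K ^ d * (\<Sum>S\<in>Pow I. (c S)\<^sup>2)) ^ s"
  proof -
    have "(\<Sum>S\<in>Pow I. K ^ card S * (c S)\<^sup>2) = K ^ d * (\<Sum>S\<in>Pow I. (c S)\<^sup>2)"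
      unfolding sum_distrib_left
    proof (intro sum.cong refl)
      fix S assume "S \<in> Pow I"
      then show "K ^ card S * (c S)\<^sup>2 = K ^ d * (c S)\<^sup>2"
        using hom[of S] by (cases "card S = d") simp_all
    qed
    then show ?thesis using hypercontractive[OF I, of c s] unfolding K_def by simp
  qed
  have high: "cube_avg I (\<lambda>x. (\<Sum>S\<in>Pow I. c S * chi S x) ^ (2 * s))
      \<le> (K ^ (card I - d) * (\<Sum>S\<in>Pow I. (c S)\<^sup>2)) ^ s"
  proof -
    let ?c = "\<lambda>S. c (I - S)"
    have bij: "bij_betw (\<lambda>S. I - S) (Pow I) (Pow I)"
      by (rule bij_betw_byWitness[where f' = "\<lambda>S. I - S"]) auto
    have pw: "(\<Sum>S\<in>Pow I. c S * chi S x) ^ (2 * s) = (\<Sum>S\<in>Pow I. ?c S * chi S x) ^ (2 * s)" for x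
    proof -
      have "(\<Sum>S\<in>Pow I. ?c S * chi S x) = (\<Sum>S\<in>Pow I. c S * chi (I - S) x)"
        by (rule sum.reindex_bij_witness[of _ "\<lambda>S. I - S" "\<lambda>S. I - S"]) (auto simp: double_diff)
      also have "\<dots> = (\<Sum>S\<in>Pow I. chi I x * (c S * chi S x))"
      proof (intro sum.cong refl)
        fix S assume "S \<in> Pow I"
        then have "I - S = I - S \<union> (S - I)" "finite S" using fin by auto
        then show "c S * chi (I - S) x = chi I x * (c S * chi S x)"
          using chi_mult[OF I \<open>finite S\<close>, of x] by simp
      qed
      finally have *: "(\<Sum>S\<in>Pow I. ?c S * chi S x) = chi I x * (\<Sum>S\<in>Pow I. c S * chi S x)"
        by (simp add: sum_distrib_left)
      have "(chi I x)\<^sup>2 = 1" by (simp add: chi_def power_mult[symmetric] mult.commute)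
      then show ?thesis unfolding * power_mult_distrib power_mult by simp
    qed
    have "(\<Sum>S\<in>Pow I. K ^ card S * (?c S)\<^sup>2) = (\<Sum>S\<in>Pow I. K ^ (card I - d) * (?c S)\<^sup>2)"
    proof (intro sum.cong refl)
      fix S assume S: "S \<in> Pow I"
      show "K ^ card S * (?c S)\<^sup>2 = K ^ (card I - d) * (?c S)\<^sup>2"
      proof (cases "card (I - S) = d")
        case True
        then have "card S = card I - d"
          using S card_mono[OF I, of S] card_Diff_subset[OF fin, of S I] by auto
        then show ?thesis by simp
      qed (use hom[of "I - S"] in simp)
    qed
    also have "\<dots> = K ^ (card I - d) * (\<Sum>S\<in>Pow I. (c S)\<^sup>2)"
      unfolding sum_distrib_left[symmetric]
      using sum.reindex_bij_betw[OF bij, of "\<lambda>S. (c S)\<^sup>2"] by simp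
    finally show ?thesis
      using hypercontractive[OF I, of ?c s] unfolding K_def pw by simp
  qed
  show ?thesis using low high unfolding K_def min_def by (cases "d \<le> card I - d") simp_all
qed

section \<open>Fourier coefficients of parities over random disjoint blocks\<close>

lemma chi_empty [simp]: "chi {} x = 1"
  by (simp add: chi_def)

lemma chi_Un_disjoint:
  assumes "finite S" "finite T" "S \<inter> T = {}"
  shows "chi (S \<union> T) x = chi S x * chi T x"
proof -
  have "S - T \<union> (T - S) = S \<union> T" using assms by blast
  then show ?thesis using chi_mult[OF assms(1,2), of x] by simp
qed

lemma sum_chi_eq_0:
  assumes "finite I" "S \<subseteq> I" "S \<noteq> {}"
  shows "(\<Sum>x\<in>Pow I. chi S x) = 0"
proof -
  obtain a where a: "a \<in> S" using assms by blast
  define J where "J = I - {a}"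
  have I: "I = insert a J" "finite J" "a \<notin> J" using assms a by (auto simp: J_def)
  have S: "finite S" using assms finite_subset by blast
  have "chi S (insert a x) = - chi S x" if "x \<in> Pow J" for x
  proof -
    have "S \<inter> insert a x = insert a (S \<inter> x)" "a \<notin> S \<inter> x" using that a by (auto simp: J_def)
    then show ?thesis using S by (simp add: chi_def)
  qed
  then show ?thesis unfolding I(1) sum_Pow_insert[OF I(2,3)] by (simp add: sum_negf)
qed

lemma sum_rotate3:
  "(\<Sum>a\<in>A. \<Sum>b\<in>B. \<Sum>c\<in>C. f a b c) = (\<Sum>c\<in>C. \<Sum>a\<in>A. \<Sum>b\<in>B. f a b c)"
  by (subst sum.swap[of _ C B]) (rule sum.swap)

section \<open>Families of disjoint sequences and unions of their blocks\<close>

definition seqs :: "'a set \<Rightarrow> nat \<Rightarrow> nat \<Rightarrow> 'a list list set" where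
  "seqs I l k = {U. length U = l \<and> (\<forall>us\<in>set U. length us = k) \<and> distinct (concat U) \<and> set (concat U) \<subseteq> I}"

definition block :: "'a list list \<Rightarrow> nat set \<Rightarrow> 'a set" where
  "block U T = (\<Union>i\<in>T. set (U ! i))"

lemma finite_seqs:
  assumes "finite I"
  shows "finite (seqs I l k)"
proof (rule finite_subset)
  show "seqs I l k \<subseteq> {U. set U \<subseteq> {us. set us \<subseteq> I \<and> length us = k} \<and> length U = l}"
    by (auto simp: seqs_def)
  show "finite {U. set U \<subseteq> {us. set us \<subseteq> I \<and> length us = k} \<and> length U = l}"
    using assms by (intro finite_lists_length_eq)
qed

lemma seqs_nonempty:
  assumes "finite I" "k * l \<le> card I"
  shows "seqs I l k \<noteq> {}"
  using assms
proof (induction l arbitrary: I)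
  case 0
  then show ?case by (auto simp: seqs_def)
next
  case (Suc l)
  then obtain A where A: "A \<subseteq> I" "card A = k"
    using obtain_subset_with_card_n[of k I] by (metis le_add1 le_trans mult_Suc_right)
  then have finA: "finite A" using Suc.prems finite_subset by blast
  obtain us where us: "set us = A" "distinct us" using finite_distinct_list[OF finA] by blast
  then have len: "length us = k" using A distinct_card by metis
  have "k * l \<le> card (I - A)"
    using Suc.prems A finA by (simp add: card_Diff_subset)
  then obtain U where "U \<in> seqs (I - A) l k" using Suc by blast
  then have "us # U \<in> seqs I (Suc l) k" using us len A by (auto simp: seqs_def)
  then show ?case by blast
qed

lemma seqs_disjoint:
  assumes U: "U \<in> seqs I l k" and ij: "i < l" "j < l" "i \<noteq> j"
  shows "set (U ! i) \<inter> set (U ! j) = {}"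
  using assms
proof (induction U arbitrary: i j l)
  case Nil
  then show ?case by (simp add: seqs_def)
next
  case (Cons us U)
  then obtain l' where l: "l = Suc l'" "length U = l'" by (auto simp: seqs_def)
  have U: "U \<in> seqs I l' k" using Cons.prems l by (auto simp: seqs_def)
  have d: "set us \<inter> set (concat U) = {}" using Cons.prems by (auto simp: seqs_def)
  have sub: "set (U ! n) \<subseteq> set (concat U)" if "n < l'" for n
    using that l nth_mem[of n U] by (auto simp del: nth_mem)
  show ?case
  proof (cases i)
    case 0
    then obtain j' where "j = Suc j'" "j' < l'" using Cons.prems l by (cases j) auto
    then show ?thesis using 0 d sub[of j'] by auto
  next
    case (Suc i')
    then have i': "i' < l'" using Cons.prems l by auto
    show ?thesis
    proof (cases j)
      case 0
      then show ?thesis using Suc i' d sub[of i'] by auto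
    next
      case (Suc j')
      then show ?thesis
        using Cons.IH[OF U, of i' j'] Cons.prems i' l \<open>i = Suc i'\<close> by auto
    qed
  qed
qed

lemma seqs_nth:
  assumes U: "U \<in> seqs I l k" and i: "i < l"
  shows "card (set (U ! i)) = k" "set (U ! i) \<subseteq> I" "length (U ! i) = k" "distinct (U ! i)"
proof -
  have m: "U ! i \<in> set U" using U i by (auto simp: seqs_def)
  then show "distinct (U ! i)" "length (U ! i) = k" "set (U ! i) \<subseteq> I"
    using U by (auto simp: seqs_def distinct_concat_iff)
  then show "card (set (U ! i)) = k" by (simp add: distinct_card)
qed

lemma card_block:
  assumes U: "U \<in> seqs I l k" and T: "T \<subseteq> {..<l}"
  shows "card (block U T) = k * card T"
proof -
  have "card (block U T) = (\<Sum>i\<in>T. card (set (U ! i)))"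
    unfolding block_def using T seqs_disjoint[OF U] finite_subset[OF T]
    by (intro card_UN_disjoint) (auto simp: subset_eq)
  also have "\<dots> = (\<Sum>i\<in>T. k)" using T seqs_nth(1)[OF U] by (intro sum.cong) auto
  finally show ?thesis by simp
qed

lemma block_subset:
  assumes "U \<in> seqs I l k" "T \<subseteq> {..<l}"
  shows "block U T \<subseteq> I"
  using assms seqs_nth(2)[OF assms(1)] by (auto simp: block_def)

lemma chi_block:
  assumes U: "U \<in> seqs I l k" and T: "T \<subseteq> {..<l}"
  shows "chi (block U T) x = (\<Prod>i\<in>T. chi (set (U ! i)) x)"
proof -
  have "finite T" using T finite_subset by blast
  then show ?thesis using T
  proof (induction T rule: finite_induct)
    case empty
    then show ?case by (simp add: block_def)
  next
    case (insert i T)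
    have "set (U ! i) \<inter> block U T = {}"
      using seqs_disjoint[OF U] insert.prems insert.hyps by (fastforce simp: block_def)
    then have "chi (set (U ! i) \<union> block U T) x = chi (set (U ! i)) x * chi (block U T) x"
      using insert.hyps by (intro chi_Un_disjoint) (auto simp: block_def)
    moreover have "block U (insert i T) = set (U ! i) \<union> block U T" by (auto simp: block_def)
    ultimately show ?case using insert by simp
  qed
qed

text \<open>By symmetry: a permutation of \<open>I\<close> carrying \<open>S\<close> onto
  \<open>S'\<close>, applied to every entry of the sequences, maps the first fibre injectively into
  the second.\<close>

lemma card_block_eq_le:
  assumes I: "finite I" and T: "T \<subseteq> {..<l}" and S: "S \<subseteq> I" "S' \<subseteq> I" "card S = card S'"
  shows "card {U \<in> seqs I l k. block U T = S} \<le> card {U \<in> seqs I l k. block U T = S'}"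
proof -
  have fin: "finite S" "finite S'" using S I finite_subset by blast+
  obtain f where f: "bij_betw f S S'" using fin S(3) finite_same_card_bij by blast
  have "card (I - S) = card (I - S')" using S fin I by (simp add: card_Diff_subset)
  then obtain g where g: "bij_betw g (I - S) (I - S')" 
    using finite_same_card_bij[of "I - S" "I - S'"] I by auto
  define p where "p u = (if u \<in> S then f u else g u)" for u
  have "p ` S = f ` S" "p ` (I - S) = g ` (I - S)" by (auto simp: p_def)
  then have p1: "p ` S = S'" and p2: "p ` (I - S) = I - S'"
    using f g by (simp_all add: bij_betw_def)
  have pI: "p ` I = I"
  proof -
    have "I = S \<union> (I - S)" using S by blast
    then have "p ` I = p ` S \<union> p ` (I - S)" by (metis image_Un)
    also have "\<dots> = I" unfolding p1 p2 using S by blast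
    finally show ?thesis .
  qed
  have inj: "inj_on p I" using pI I by (simp add: eq_card_imp_inj_on)
  have inI: "set us \<subseteq> I" if "U \<in> seqs I l k" "us \<in> set U" for U us
    using that by (auto simp: seqs_def)
  show ?thesis
  proof (rule card_inj_on_le[where f = "map (map p)"])
    show "inj_on (map (map p)) {U \<in> seqs I l k. block U T = S}"
    proof (rule inj_onI)
      fix U V assume U: "U \<in> {U \<in> seqs I l k. block U T = S}" and V: "V \<in> {U \<in> seqs I l k. block U T = S}"
        and eq: "map (map p) U = map (map p) V"
      have "set us \<subseteq> I" if "us \<in> set U \<union> set V" for us using that U V inI by auto
      then have "inj_on (map p) (set U \<union> set V)"
        by (intro inj_onI) (rule map_inj_on[of p], assumption, blast intro: inj_on_subset[OF inj])
      then show "U = V" using map_inj_on[OF eq] by blast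
    qed
    show "map (map p) ` {U \<in> seqs I l k. block U T = S} \<subseteq> {U \<in> seqs I l k. block U T = S'}"
    proof
      fix V assume "V \<in> map (map p) ` {U \<in> seqs I l k. block U T = S}"
      then obtain U where U: "U \<in> seqs I l k" "block U T = S" and V: "V = map (map p) U" by blast
      have len: "length U = l" using U by (simp add: seqs_def)
      have c: "concat V = map p (concat U)" by (simp add: V map_concat)
      have "distinct (concat V)" unfolding c
        using U by (simp add: distinct_map seqs_def inj_on_subset[OF inj])
      moreover have "set (concat V) \<subseteq> I"
      proof -
        have "set (concat U) \<subseteq> I" using U by (simp add: seqs_def)
        then show ?thesis unfolding c set_map using pI by blast
      qed
      moreover have "length V = l" "\<forall>us\<in>set V. length us = k" using U(1) by (simp_all add: seqs_def V)
      ultimately have "V \<in> seqs I l k" unfolding seqs_def by blast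
      moreover have "block V T = p ` block U T"
      proof -
        have "set (V ! i) = p ` set (U ! i)" if "i \<in> T" for i
          using that T len by (simp add: V lessThan_def subset_eq)
        then show ?thesis by (simp add: block_def image_UN)
      qed
      ultimately show "V \<in> {U \<in> seqs I l k. block U T = S'}" using U p1 by simp
    qed
    show "finite {U \<in> seqs I l k. block U T = S'}" using finite_seqs[OF I] by simp
  qed
qed

text \<open>The fibres over the sets of size \<open>k * card T\<close> are disjoint and by symmetry
  equally large, so a random \<open>block U T\<close> equals a given set with probability at most
  one over the number of these sets.\<close>

lemma card_block_eq_times_choose_le:
  assumes I: "finite I" and T: "T \<subseteq> {..<l}" and S: "S \<subseteq> I"
  shows "card {U \<in> seqs I l k. block U T = S} * (card I choose (k * card T)) \<le> card (seqs I l k)"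
proof (cases "card S = k * card T")
  case False
  then have "{U \<in> seqs I l k. block U T = S} = {}" using card_block[OF _ T] by blast
  then show ?thesis by (simp only: card.empty mult_0 zero_le)
next
  case True
  let ?D = "{S'. S' \<subseteq> I \<and> card S' = k * card T}"
  have "card {U \<in> seqs I l k. block U T = S} * (card I choose (k * card T))
      = (\<Sum>S'\<in>?D. card {U \<in> seqs I l k. block U T = S})"
    by (simp add: n_subsets[OF I])
  also have "\<dots> \<le> (\<Sum>S'\<in>?D. card {U \<in> seqs I l k. block U T = S'})"
    using True S by (intro sum_mono card_block_eq_le[OF I T]) auto
  also have "\<dots> = card (\<Union>S'\<in>?D. {U \<in> seqs I l k. block U T = S'})"
    using I finite_seqs[OF I] by (intro card_UN_disjoint[symmetric]) auto
  also have "\<dots> \<le> card (seqs I l k)" by (intro card_mono finite_seqs I) auto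
  finally show ?thesis .
qed

text \<open>The deviation of a likelihood ratio from 1: if \<open>y i\<close> is the sign of the bit
  \<open>Y i\<close>, then \<open>1 + phi l y U\<close> is the density, relative to a uniform
  column, of the column conditioned on having parity \<open>Y i\<close> on the i-th block for all
  \<open>i\<close>.\<close>

definition phi :: "nat \<Rightarrow> (nat \<Rightarrow> real) \<Rightarrow> 'a list list \<Rightarrow> 'a set \<Rightarrow> real" where
  "phi l y U x = (\<Prod>i<l. 1 + y i * chi (set (U ! i)) x) - 1"

lemma phi_expand:
  assumes U: "U \<in> seqs I l k"
  shows "phi l y U x = (\<Sum>T\<in>Pow {..<l} - {{}}. (\<Prod>i\<in>T. y i) * chi (block U T) x)"
proof -
  have "(\<Prod>i<l. y i * chi (set (U ! i)) x + 1) = (\<Sum>T\<in>Pow {..<l}. \<Prod>i\<in>T. y i * chi (set (U ! i)) x)"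
    by (subst prod_add) simp_all
  also have "\<dots> = (\<Sum>T\<in>Pow {..<l}. (\<Prod>i\<in>T. y i) * chi (block U T) x)"
    by (intro sum.cong refl) (simp add: prod.distrib chi_block[OF U])
  also have "\<dots> = 1 + (\<Sum>T\<in>Pow {..<l} - {{}}. (\<Prod>i\<in>T. y i) * chi (block U T) x)"
    by (subst sum.remove[of _ "{}"]) (simp_all add: block_def)
  finally show ?thesis by (simp add: phi_def add.commute)
qed

text \<open>One column of the code with the message held fixed. \<open>y\<close> holds the signs of
  the prescribed parities, and \<open>w\<close> is a test that sees the sequences but not the column
  itself; its advantage at the column \<open>x\<close> is \<open>bias x\<close>.\<close>

locale random_blocks =
  fixes I :: "'a set" and l k :: nat and y :: "nat \<Rightarrow> real" and w :: "'a list list \<Rightarrow> real"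
  assumes finite_I: "finite I" and k_pos: "1 \<le> k" and blocks_fit: "k * l \<le> card I"
    and abs_y: "\<bar>y i\<bar> = 1" and abs_w: "\<bar>w U\<bar> \<le> 1"
begin

definition bias :: "'a set \<Rightarrow> real" where
  "bias x = (\<Sum>U\<in>seqs I l k. w U * phi l y U x) / card (seqs I l k)"

definition coef :: "'a set \<Rightarrow> real" where
  "coef S = (\<Sum>U\<in>seqs I l k. \<Sum>T\<in>Pow {..<l} - {{}}. w U * (\<Prod>i\<in>T. y i) * of_bool (block U T = S))
     / card (seqs I l k)"

definition level :: "nat \<Rightarrow> 'a set \<Rightarrow> real" where
  "level m x = (\<Sum>S\<in>Pow I. (if card S = k * m then coef S else 0) * chi S x)"

definition level_weight :: "nat \<Rightarrow> real" where
  "level_weight m = (real (l choose m))\<^sup>2 / real (card I choose (k * m))"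

lemma card_seqs_pos: "0 < card (seqs I l k)"
  using seqs_nonempty[OF finite_I blocks_fit] finite_seqs[OF finite_I] by (simp add: card_gt_0_iff)

lemma bias_eq_sum_coef: "bias x = (\<Sum>S\<in>Pow I. coef S * chi S x)"
proof -
  let ?P = "Pow {..<l} - {{}}"
  have "(\<Sum>U\<in>seqs I l k. w U * phi l y U x)
      = (\<Sum>U\<in>seqs I l k. \<Sum>T\<in>?P. w U * (\<Prod>i\<in>T. y i) * chi (block U T) x)"
    by (intro sum.cong refl) (simp add: phi_expand sum_distrib_left mult.assoc)
  also have "\<dots> = (\<Sum>U\<in>seqs I l k. \<Sum>T\<in>?P. \<Sum>S\<in>Pow I.
      w U * (\<Prod>i\<in>T. y i) * of_bool (block U T = S) * chi S x)"
  proof (intro sum.cong refl)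
    fix U T assume "U \<in> seqs I l k" "T \<in> ?P"
    then have "block U T \<in> Pow I" using block_subset[of U I l k T] by auto
    then show "w U * (\<Prod>i\<in>T. y i) * chi (block U T) x
        = (\<Sum>S\<in>Pow I. w U * (\<Prod>i\<in>T. y i) * of_bool (block U T = S) * chi S x)"
      using finite_I by (simp add: of_bool_def if_distrib[of "\<lambda>t. _ * t"] if_distrib[of "\<lambda>t. t * _"] cong: if_cong)
  qed
  also have "\<dots> = (\<Sum>S\<in>Pow I. (\<Sum>U\<in>seqs I l k. \<Sum>T\<in>?P.
      w U * (\<Prod>i\<in>T. y i) * of_bool (block U T = S)) * chi S x)"
    unfolding sum_distrib_right by (rule sum_rotate3)
  finally show ?thesis
    unfolding bias_def coef_def times_divide_eq_left sum_divide_distrib[symmetric] by simp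
qed

lemma coef_eq_0:
  assumes "\<And>m. 1 \<le> m \<Longrightarrow> m \<le> l \<Longrightarrow> card S \<noteq> k * m"
  shows "coef S = 0"
proof -
  have "block U T \<noteq> S" if "U \<in> seqs I l k" "T \<in> Pow {..<l} - {{}}" for U T
  proof -
    have "finite T" using that finite_subset[of T "{..<l}"] by auto
    then have "1 \<le> card T" "card T \<le> l"
      using that card_mono[of "{..<l}" T] by (auto simp: Suc_le_eq card_gt_0_iff)
    then show ?thesis using assms[of "card T"] card_block[OF that(1), of T] that by auto
  qed
  then show ?thesis by (simp add: coef_def)
qed

lemma abs_coef_le:
  assumes m: "card S = k * m"
  shows "\<bar>coef S\<bar> \<le> (\<Sum>U\<in>seqs I l k. \<Sum>T | T \<subseteq> {..<l} \<and> card T = m. of_bool (block U T = S))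
     / card (seqs I l k)"
proof -
  have "\<bar>\<Sum>U\<in>seqs I l k. \<Sum>T\<in>Pow {..<l} - {{}}. w U * (\<Prod>i\<in>T. y i) * of_bool (block U T = S)\<bar>
      \<le> (\<Sum>U\<in>seqs I l k. \<Sum>T\<in>Pow {..<l} - {{}}. of_bool (block U T = S))"
  proof (intro order_trans[OF sum_abs] sum_mono)
    fix U T
    have "\<bar>\<Prod>i\<in>T. y i\<bar> = 1" by (simp add: abs_prod abs_y)
    then show "\<bar>w U * (\<Prod>i\<in>T. y i) * of_bool (block U T = S)\<bar> \<le> of_bool (block U T = S)"
      using abs_w[of U] by (simp add: abs_mult)
  qed
  also have "\<dots> \<le> (\<Sum>U\<in>seqs I l k. \<Sum>T | T \<subseteq> {..<l} \<and> card T = m. of_bool (block U T = S))"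
  proof (intro sum_mono)
    fix U assume U: "U \<in> seqs I l k"
    have "(\<Sum>T\<in>Pow {..<l} - {{}}. of_bool (block U T = S) :: real)
        = (\<Sum>T\<in>{T \<in> Pow {..<l} - {{}}. card T = m}. of_bool (block U T = S))"
      using card_block[OF U] m k_pos by (intro sum.mono_neutral_right) auto
    also have "\<dots> \<le> (\<Sum>T | T \<subseteq> {..<l} \<and> card T = m. of_bool (block U T = S))"
      by (intro sum_mono2) auto
    finally show "(\<Sum>T\<in>Pow {..<l} - {{}}. of_bool (block U T = S) :: real)
        \<le> (\<Sum>T | T \<subseteq> {..<l} \<and> card T = m. of_bool (block U T = S))" .
  qed
  finally show ?thesis by (simp add: coef_def divide_right_mono)
qed

text \<open>Each of the (l choose m) index sets \<open>T\<close> contributes at most the probability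
  that the random set \<open>block U T\<close> equals \<open>S\<close>.\<close>

lemma abs_coef_le_max:
  assumes S: "S \<subseteq> I" and m: "card S = k * m"
  shows "\<bar>coef S\<bar> \<le> real (l choose m) / real (card I choose (k * m))"
proof -
  let ?L = "{T. T \<subseteq> {..<l} \<and> card T = m}" and ?N = "real (card (seqs I l k))"
    and ?b = "real (card I choose (k * m))"
  have b: "0 < ?b" using m card_mono[OF finite_I S] by simp
  have "(\<Sum>U\<in>seqs I l k. \<Sum>T\<in>?L. of_bool (block U T = S))
      = (\<Sum>T\<in>?L. real (card {U \<in> seqs I l k. block U T = S}))"
    using finite_seqs[OF finite_I]
    by (subst sum.swap) (simp only: sum_of_bool_eq Int_def mem_Collect_eq)
  also have "\<dots> \<le> (\<Sum>T\<in>?L. ?N / ?b)"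
  proof (intro sum_mono)
    fix T assume T: "T \<in> ?L"
    have "card {U \<in> seqs I l k. block U T = S} * (card I choose (k * m)) \<le> card (seqs I l k)"
      using card_block_eq_times_choose_le[OF finite_I _ S, of T l k] T by simp
    then have "real (card {U \<in> seqs I l k. block U T = S}) * ?b \<le> ?N"
      unfolding of_nat_mult[symmetric] of_nat_le_iff .
    then show "real (card {U \<in> seqs I l k. block U T = S}) \<le> ?N / ?b"
      using b by (simp add: pos_le_divide_eq)
  qed
  also have "\<dots> = real (l choose m) * (?N / ?b)"
    by (simp add: n_subsets)
  finally have "(\<Sum>U\<in>seqs I l k. \<Sum>T\<in>?L. of_bool (block U T = S)) / ?N \<le> real (l choose m) / ?b"
    using card_seqs_pos by (simp add: pos_divide_le_eq mult.commute)
  then show ?thesis using abs_coef_le[OF m] by simp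
qed

text \<open>For a fixed \<open>U\<close>, each index set \<open>T\<close> of size \<open>m\<close>
  is charged to at most one \<open>S\<close>, namely \<open>block U T\<close>.\<close>

lemma sum_abs_coef_le: "(\<Sum>S | S \<subseteq> I \<and> card S = k * m. \<bar>coef S\<bar>) \<le> real (l choose m)"
proof -
  let ?L = "{T. T \<subseteq> {..<l} \<and> card T = m}" and ?N = "real (card (seqs I l k))"
    and ?D = "{S. S \<subseteq> I \<and> card S = k * m}"
  have fin: "finite ?D" using finite_I by simp
  have "(\<Sum>S\<in>?D. \<bar>coef S\<bar>) \<le> (\<Sum>S\<in>?D. (\<Sum>U\<in>seqs I l k. \<Sum>T\<in>?L. of_bool (block U T = S)) / ?N)"
    by (intro sum_mono abs_coef_le) auto
  also have "\<dots> = (\<Sum>U\<in>seqs I l k. \<Sum>T\<in>?L. \<Sum>S\<in>?D. of_bool (block U T = S)) / ?N"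
    unfolding sum_divide_distrib[symmetric] by (subst sum_rotate3) (rule refl)
  also have "\<dots> \<le> (\<Sum>U\<in>seqs I l k. \<Sum>T\<in>?L. 1) / ?N"
  proof (intro divide_right_mono sum_mono)
    fix U T
    have "(\<Sum>S\<in>?D. of_bool (block U T = S) :: real) = (if block U T \<in> ?D then 1 else 0)"
      using fin by (simp add: of_bool_def)
    then show "(\<Sum>S\<in>?D. of_bool (block U T = S) :: real) \<le> 1" by simp
  qed simp
  also have "\<dots> = real (l choose m)" using card_seqs_pos by (simp add: n_subsets)
  finally show ?thesis .
qed

text \<open>The l2 norm is bounded by the product of the maximum and the l1 norm; the two preceding
  bounds multiply to \<open>level_weight m\<close>.\<close>

lemma sum_coef_square_le: "(\<Sum>S | S \<subseteq> I \<and> card S = k * m. (coef S)\<^sup>2) \<le> level_weight m"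
proof -
  let ?D = "{S. S \<subseteq> I \<and> card S = k * m}"
  have "(\<Sum>S\<in>?D. (coef S)\<^sup>2) = (\<Sum>S\<in>?D. \<bar>coef S\<bar> * \<bar>coef S\<bar>)"
    by (simp add: power2_eq_square)
  also have "\<dots> \<le> (\<Sum>S\<in>?D. real (l choose m) / real (card I choose (k * m)) * \<bar>coef S\<bar>)"
    by (intro sum_mono mult_right_mono abs_coef_le_max) auto
  also have "\<dots> = real (l choose m) / real (card I choose (k * m)) * (\<Sum>S\<in>?D. \<bar>coef S\<bar>)"
    by (simp add: sum_distrib_left)
  also have "\<dots> \<le> real (l choose m) / real (card I choose (k * m)) * real (l choose m)"
    by (intro mult_left_mono sum_abs_coef_le) auto
  finally show ?thesis by (simp add: level_weight_def power2_eq_square)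
qed

lemma bias_eq_sum_level: "bias x = (\<Sum>m = 1..l. level m x)"
proof -
  have "(\<Sum>m = 1..l. level m x) = (\<Sum>S\<in>Pow I. (\<Sum>m = 1..l. if card S = k * m then coef S else 0) * chi S x)"
    unfolding level_def sum_distrib_right by (rule sum.swap)
  also have "\<dots> = (\<Sum>S\<in>Pow I. coef S * chi S x)"
  proof (intro sum.cong refl)
    fix S
    show "(\<Sum>m = 1..l. if card S = k * m then coef S else 0) * chi S x = coef S * chi S x"
    proof (cases "\<exists>m\<in>{1..l}. card S = k * m")
      case True
      then obtain m where m: "m \<in> {1..l}" "card S = k * m" by blast
      have "(\<Sum>i = 1..l. if card S = k * i then coef S else 0) = (\<Sum>i = 1..l. if i = m then coef S else 0)"
        using m k_pos by (intro sum.cong refl) auto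
      then show ?thesis using m by simp
    next
      case False
      then show ?thesis using coef_eq_0[of S] by simp
    qed
  qed
  finally show ?thesis by (simp add: bias_eq_sum_coef)
qed

lemma moment_level:
  assumes "1 \<le> s"
  shows "cube_avg I (\<lambda>x. level m x ^ (2 * s))
    \<le> (real (2 * s - 1) ^ min (k * m) (card I - k * m) * level_weight m) ^ s"
proof -
  let ?c = "\<lambda>S. if card S = k * m then coef S else 0"
  have "(\<Sum>S\<in>Pow I. (?c S)\<^sup>2) = (\<Sum>S | S \<subseteq> I \<and> card S = k * m. (coef S)\<^sup>2)"
    using finite_I by (intro sum.mono_neutral_cong_right) auto
  then have *: "(\<Sum>S\<in>Pow I. (?c S)\<^sup>2) \<le> level_weight m"
    using sum_coef_square_le by simp
  have "cube_avg I (\<lambda>x. level m x ^ (2 * s))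
      \<le> (real (2 * s - 1) ^ min (k * m) (card I - k * m) * (\<Sum>S\<in>Pow I. (?c S)\<^sup>2)) ^ s"
    unfolding level_def using assms
    by (intro hypercontractive_homogeneous finite_I) auto
  also have "\<dots> \<le> (real (2 * s - 1) ^ min (k * m) (card I - k * m) * level_weight m) ^ s"
    using * by (intro power_mono mult_left_mono mult_nonneg_nonneg sum_nonneg) auto
  finally show ?thesis .
qed

lemma second_moment_bias: "cube_avg I (\<lambda>x. (bias x)\<^sup>2) \<le> (\<Sum>m = 1..l. level_weight m)"
proof -
  \<comment> \<open>For s = 1 the factor 2s - 1 is 1, and hypercontractivity becomes one half of
    Parseval's identity.\<close>
  have "cube_avg I (\<lambda>x. (bias x)\<^sup>2) \<le> (\<Sum>S\<in>Pow I. (coef S)\<^sup>2)"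
    using hypercontractive[OF finite_I, of coef 1] by (simp add: bias_eq_sum_coef)
  also have "\<dots> = (\<Sum>S\<in>(\<Union>m\<in>{1..l}. {S. S \<subseteq> I \<and> card S = k * m}). (coef S)\<^sup>2)"
    using finite_I coef_eq_0 by (intro sum.mono_neutral_right) auto
  also have "\<dots> = (\<Sum>m = 1..l. \<Sum>S | S \<subseteq> I \<and> card S = k * m. (coef S)\<^sup>2)"
    using finite_I k_pos by (intro sum.UNION_disjoint) auto
  also have "\<dots> \<le> (\<Sum>m = 1..l. level_weight m)"
    by (intro sum_mono sum_coef_square_le)
  finally show ?thesis .
qed

lemma cube_avg_bias: "cube_avg I bias = 0"
proof -
  have "(\<Sum>x\<in>Pow I. bias x) = (\<Sum>S\<in>Pow I. coef S * (\<Sum>x\<in>Pow I. chi S x))"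
    unfolding bias_eq_sum_coef sum_distrib_left by (rule sum.swap)
  also have "\<dots> = 0"
  proof (intro sum.neutral ballI)
    fix S assume S: "S \<in> Pow I"
    show "coef S * (\<Sum>x\<in>Pow I. chi S x) = 0"
    proof (cases "S = {}")
      case True
      then show ?thesis using coef_eq_0[of S] k_pos by simp
    next
      case False
      then show ?thesis using sum_chi_eq_0[OF finite_I, of S] S by simp
    qed
  qed
  finally show ?thesis by (simp add: cube_avg_def)
qed

end

section \<open>Exponential moments of the bias\<close>

lemma cube_avg_mono:
  assumes "\<And>x. x \<in> Pow I \<Longrightarrow> f x \<le> g x"
  shows "cube_avg I f \<le> cube_avg I g"
  unfolding cube_avg_def using assms by (intro divide_right_mono sum_mono) auto

lemma cube_avg_add: "cube_avg I (\<lambda>x. f x + g x) = cube_avg I f + cube_avg I g"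
  by (simp add: cube_avg_def sum.distrib add_divide_distrib)

lemma cube_avg_cmult: "cube_avg I (\<lambda>x. c * f x) = c * cube_avg I f"
  by (simp add: cube_avg_def sum_distrib_left)

lemma cube_avg_divide: "cube_avg I (\<lambda>x. f x / c) = cube_avg I f / c"
  by (simp add: cube_avg_def sum_divide_distrib[symmetric])

lemma cube_avg_sum: "cube_avg I (\<lambda>x. \<Sum>i\<in>A. f i x) = (\<Sum>i\<in>A. cube_avg I (f i))"
  unfolding cube_avg_def sum_divide_distrib[symmetric] by (subst sum.swap) (rule refl)

lemma cube_avg_const: "finite I \<Longrightarrow> cube_avg I (\<lambda>x. c) = c"
  by (simp add: cube_avg_def card_Pow)

text \<open>Only an upper bound on \<open>x\<close> is assumed, since the bias may be very negative.
  For x < 0 the quadratic Taylor bound for exp (-x) is inverted.\<close>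

lemma exp_le_quadratic:
  fixes x :: real
  assumes "x \<le> 1"
  shows "exp x \<le> 1 + x + x\<^sup>2"
proof (cases "0 \<le> x")
  case True
  then show ?thesis using exp_bound[of x] assms by simp
next
  case False
  define u where "u = - x"
  have u: "u > 0" using False by (simp add: u_def)
  have "1 + u + u\<^sup>2 / 2 \<le> exp u" using exp_lower_Taylor_quadratic[of u] u by simp
  moreover have pos: "0 < 1 + u + u\<^sup>2 / 2" using u by (simp add: add_pos_nonneg)
  ultimately have "exp (- u) \<le> 1 / (1 + u + u\<^sup>2 / 2)"
    by (simp add: exp_minus inverse_eq_divide frac_le)
  also have "\<dots> \<le> 1 - u + u\<^sup>2"
  proof -
    have "(1 - u + u\<^sup>2) * (1 + u + u\<^sup>2 / 2) = 1 + (u\<^sup>2 / 2 + u ^ 3 / 2 + u ^ 4 / 2)"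
      by (simp add: field_simps power2_eq_square power3_eq_cube power4_eq_xxxx)
    moreover have "0 \<le> u\<^sup>2 / 2 + u ^ 3 / 2 + u ^ 4 / 2" using u by simp
    ultimately show ?thesis using pos by (simp add: pos_divide_le_eq)
  qed
  finally show ?thesis by (simp add: u_def)
qed

section \<open>Inequalities for binomial coefficients\<close>

lemma choose_mult_choose_le: "(a choose i) * (b choose j) \<le> (a + b) choose (i + j)"
proof -
  have "(a choose i) * (b choose (i + j - i)) \<le> (\<Sum>k\<le>i + j. (a choose k) * (b choose (i + j - k)))"
    by (rule member_le_sum) auto
  then show ?thesis by (simp add: vandermonde)
qed

text \<open>Choosing \<open>m\<close> elements in each of \<open>k\<close> disjoint groups of size
  \<open>l\<close> is one way to choose \<open>k * m\<close> elements from their union. This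
  compares the numerator of a level weight with its denominator.\<close>

lemma choose_power_le: "(l choose m) ^ k \<le> k * l choose (k * m)"
proof (induction k)
  case 0
  show ?case by simp
next
  case (Suc k)
  have "(l choose m) * (l choose m) ^ k \<le> (l choose m) * (k * l choose (k * m))"
    using Suc by simp
  also have "\<dots> \<le> (l + k * l) choose (m + k * m)" by (rule choose_mult_choose_le)
  finally show ?case by simp
qed

lemma choose_mono_upper: "a \<le> b \<Longrightarrow> a choose d \<le> b choose d"
proof (induction b rule: dec_induct)
  case (step b)
  have "b choose d \<le> Suc b choose d" by (cases d) auto
  then show ?case using step by simp
qed simp

text \<open>The quotient of the two binomials is a product of factors (a-i)/(b-i), each at most a/b;
  the cross-multiplied form avoids dividing by zero.\<close>

lemma choose_ratio_le:
  assumes "a \<le> b"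
  shows "real (a choose d) * real b ^ d \<le> real (b choose d) * real a ^ d"
proof (induction d)
  case 0
  show ?case by simp
next
  case (Suc d)
  have st: "real (n choose Suc d) * real (Suc d) = real (n choose d) * real (n - d)" for n
  proof -
    have "(n choose Suc d) * Suc d = (n choose d) * (n - d)"
      by (metis binomial_absorb_comp binomial_absorption mult.commute)
    then show ?thesis by (metis of_nat_mult)
  qed
  have "(a - d) * b \<le> (b - d) * a"
    using mult_le_mono2[OF assms, of d] by (simp add: diff_mult_distrib mult.commute[of a b] diff_le_mono2)
  then have c: "real (a - d) * real b \<le> real (b - d) * real a"
    unfolding of_nat_mult[symmetric] of_nat_le_iff .
  have "real (Suc d) * (real (a choose Suc d) * real b ^ Suc d)
      = (real (a choose d) * real b ^ d) * (real (a - d) * real b)"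
  proof -
    have "real (Suc d) * (real (a choose Suc d) * real b ^ Suc d)
        = (real (a choose Suc d) * real (Suc d)) * (real b ^ d * real b)" by (simp only: power_Suc ac_simps)
    also have "\<dots> = (real (a choose d) * real b ^ d) * (real (a - d) * real b)" unfolding st by (simp only: ac_simps)
    finally show ?thesis .
  qed
  also have "\<dots> \<le> (real (b choose d) * real a ^ d) * (real (b - d) * real a)"
    by (intro mult_mono Suc.IH c) auto
  also have "\<dots> = real (Suc d) * (real (b choose Suc d) * real a ^ Suc d)"
  proof -
    have "real (Suc d) * (real (b choose Suc d) * real a ^ Suc d)
        = (real (b choose Suc d) * real (Suc d)) * (real a ^ d * real a)" by (simp only: power_Suc ac_simps)
    also have "\<dots> = (real (b choose d) * real a ^ d) * (real (b - d) * real a)" unfolding st by (simp only: ac_simps)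
    finally show ?thesis by (rule sym)
  qed
  finally show ?case by (simp only: mult_le_cancel_left_pos of_nat_0_less_iff zero_less_Suc)
qed

lemma sum_geometric_le:
  fixes q :: real
  assumes "0 \<le> q" "q < 1"
  shows "(\<Sum>m = 1..l. q ^ m) \<le> q / (1 - q)"
proof -
  have "(\<Sum>m = 1..l. q ^ m) = (\<Sum>m<l. q * q ^ m)"
    by (rule sum.reindex_bij_witness[of _ Suc "\<lambda>m. m - 1"]) (auto simp flip: power_Suc)
  also have "\<dots> = q * ((1 - q ^ l) / (1 - q))"
    using assms by (simp add: sum_distrib_left[symmetric] sum_gp_strict)
  also have "\<dots> \<le> q * (1 / (1 - q))"
    using assms by (intro mult_left_mono divide_right_mono) auto
  finally show ?thesis by simp
qed

section \<open>Exponential moments for fixed parameters\<close>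

context random_blocks
begin

text \<open>The linear term has mean 0, so the exponent is quadratic in \<theta>. With a bounded
  second moment, a small constant \<theta> then beats any prescribed linear term; this is the case k
  = 2.\<close>

lemma exp_moment_bias_quadratic:
  assumes lam: "0 \<le> \<theta>" "\<theta> \<le> 1" and le1: "\<And>x. x \<in> Pow I \<Longrightarrow> bias x \<le> 1"
  shows "cube_avg I (\<lambda>x. exp (\<theta> * bias x)) \<le> exp (\<theta>\<^sup>2 * (\<Sum>m = 1..l. level_weight m))"
proof -
  have "cube_avg I (\<lambda>x. exp (\<theta> * bias x)) \<le> cube_avg I (\<lambda>x. 1 + \<theta> * bias x + \<theta>\<^sup>2 * (bias x)\<^sup>2)"
  proof (intro cube_avg_mono)
    fix x assume "x \<in> Pow I"
    then have "\<theta> * bias x \<le> \<theta> * 1" using le1 lam by (intro mult_left_mono) auto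
    then have "\<theta> * bias x \<le> 1" using lam by linarith
    then show "exp (\<theta> * bias x) \<le> 1 + \<theta> * bias x + \<theta>\<^sup>2 * (bias x)\<^sup>2"
      using exp_le_quadratic[of "\<theta> * bias x"] by (simp add: power_mult_distrib)
  qed
  also have "\<dots> = 1 + \<theta>\<^sup>2 * cube_avg I (\<lambda>x. (bias x)\<^sup>2)"
    using cube_avg_bias by (simp add: cube_avg_add cube_avg_cmult cube_avg_const[OF finite_I])
  also have "\<dots> \<le> 1 + \<theta>\<^sup>2 * (\<Sum>m = 1..l. level_weight m)"
    by (intro add_left_mono mult_left_mono second_moment_bias) auto
  also have "\<dots> \<le> exp (\<theta>\<^sup>2 * (\<Sum>m = 1..l. level_weight m))"
    by (rule exp_ge_add_one_self)
  finally show ?thesis .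
qed

text \<open>The square of (l choose m) is at most (2l choose 2m), and passing from 2l to r = (2 +
  \<delta>) l elements gains the factor q = 2/(2+\<delta>) per chosen element. The slack \<delta>
  keeps the geometric sum bounded independently of \<open>l\<close>.\<close>

lemma sum_level_weight_2:
  assumes k2: "k = 2" and \<delta>: "0 < \<delta>" and r: "real (card I) = (2 + \<delta>) * real l"
  shows "(\<Sum>m = 1..l. level_weight m) \<le> (2 / (2 + \<delta>)) / (1 - 2 / (2 + \<delta>))"
proof (cases "l = 0")
  case True
  then show ?thesis using \<delta> by simp
next
  case False
  define q where "q = 2 / (2 + \<delta>)"
  have q: "0 < q" "q < 1" using \<delta> by (auto simp: q_def)
  have rpos: "0 < card I" using False blocks_fit k2 by auto
  have q2: "real (2 * l) / real (card I) = q" using False \<delta> unfolding r q_def by simp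
  have "level_weight m \<le> q ^ m" if m: "m \<in> {1..l}" for m
  proof -
    have b: "0 < real (card I choose (2 * m))" using m blocks_fit k2 by simp
    have "real ((l choose m)\<^sup>2) \<le> real (2 * l choose (2 * m))"
      using choose_power_le[of l m 2] by (simp only: of_nat_le_iff)
    then have "level_weight m \<le> real (2 * l choose (2 * m)) / real (card I choose (2 * m))"
      unfolding level_weight_def unfolding k2 by (simp add: divide_right_mono)
    also have "\<dots> \<le> real (2 * l) ^ (2 * m) / real (card I) ^ (2 * m)"
    proof -
      have "real (2 * l choose (2 * m)) * real (card I) ^ (2 * m)
          \<le> real (card I choose (2 * m)) * real (2 * l) ^ (2 * m)"
        using blocks_fit k2 by (intro choose_ratio_le) simp
      then show ?thesis
        using b rpos by (simp add: divide_le_eq le_divide_eq mult.commute)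
    qed
    also have "\<dots> = q ^ (2 * m)" by (simp only: power_divide[symmetric] q2)
    also have "\<dots> \<le> q ^ m" using q by (intro power_decreasing) auto
    finally show ?thesis .
  qed
  then have "(\<Sum>m = 1..l. level_weight m) \<le> (\<Sum>m = 1..l. q ^ m)" by (intro sum_mono)
  also have "\<dots> \<le> q / (1 - q)" using q by (intro sum_geometric_le) auto
  finally show ?thesis by (simp add: q_def)
qed


text \<open>By Markov's inequality the conclusion says that the level exceeds \<eta> in absolute
  value with probability at most exp (-2\<theta>). Let d be the smaller of km and r - km. For d at
  most 2\<theta> a moment with s about 2\<theta>/d is used. For larger d the second moment suffices,
  because (r choose d) is then at least exp (9\<theta>) and, as k is at least 3, the weight is at
  most its power -1/3.\<close>

lemma level_moment_small:
  assumes k3: "3 \<le> k" and fit: "k * l < card I" and m: "1 \<le> m" "m \<le> l"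
    and \<beta>: "0 < \<beta>" "3 * \<beta> \<le> exp (- 9 / 2)"
    and \<theta>: "\<theta> = \<beta> * real (card I) powr (1 - 2 / real k)" "1 \<le> \<theta>"
    and \<kappa>: "\<kappa> = sqrt (6 * exp 1 * \<beta>)"
    and \<eta>: "\<eta> = \<kappa> ^ min (k * m) (card I - k * m) + exp (- \<theta> / 2)"
  shows "\<exists>s\<ge>1. cube_avg I (\<lambda>x. level m x ^ (2 * s)) \<le> \<eta> ^ (2 * s) * exp (- 2 * \<theta>)"
proof -
  define r where "r = card I"
  define d where "d = min (k * m) (r - k * m)"
  define V where "V = level_weight m"
  have km: "k * m \<le> k * l" using m by simp
  have d1: "1 \<le> d" using m k_pos le_less_trans[OF km fit] by (auto simp: d_def r_def Suc_le_eq)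
  have dr: "2 * d \<le> r" "d \<le> r" by (auto simp: d_def)
  have ch: "r choose (k * m) = r choose d"
    using binomial_symmetric[of "k * m" r] km fit by (simp add: d_def r_def min_def)
  have V: "V = (real (l choose m))\<^sup>2 / real (r choose d)"
    using ch by (simp add: V_def level_weight_def r_def)
  have V0: "0 \<le> V" by (simp add: V)
  have bpos: "0 < real (r choose d)" using dr by simp
  have r1: "1 \<le> real r" using d1 dr by linarith
  have \<theta>r: "\<theta> / real r = \<beta> * real r powr (- 2 / real k)"
  proof -
    have "real r powr (1 - 2 / real k) = real r * real r powr (- 2 / real k)"
      using r1 powr_add[of "real r" 1 "- 2 / real k"] by simp
    then show ?thesis using r1 by (simp add: \<theta>(1) r_def[symmetric])
  qed
  have \<kappa>2: "\<kappa>\<^sup>2 = 6 * exp 1 * \<beta>" "0 < \<kappa>" using \<beta> by (simp_all add: \<kappa>)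
  have \<eta>d: "\<kappa> ^ d \<le> \<eta>" "exp (- \<theta> / 2) \<le> \<eta>" "0 < \<eta>"
    using \<kappa>2 by (auto simp: \<eta> d_def r_def add_pos_pos)
  show ?thesis
  proof (cases "real d \<le> 2 * \<theta>")
    case True
    \<comment> \<open>Rounding up makes ds at least 2\<theta>, so a gain of exp (-1) per unit of ds
      produces the factor exp (-2\<theta>). Since 2\<theta>/d is at least 1, rounding costs little:
      2s - 1 is at most 6\<theta>/d.\<close>
    define s where "s = nat \<lceil>2 * \<theta> / real d\<rceil>"
    have dpos: "0 < real d" using d1 by simp
    have x1: "1 \<le> 2 * \<theta> / real d" using True dpos by (simp add: le_divide_eq)
    have s_lo: "2 * \<theta> / real d \<le> real s" unfolding s_def by linarith
    have s_hi: "real s \<le> 2 * \<theta> / real d + 1" unfolding s_def using x1 by linarith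
    have s1: "1 \<le> s" using s_lo x1 by linarith
    have s_d: "2 * \<theta> \<le> real (d * s)" using s_lo dpos by (simp add: divide_le_eq mult.commute)
    have "real (2 * s - 1) = 2 * real s - 1" using s1 by (simp add: of_nat_diff)
    then have s2: "real (2 * s - 1) \<le> 6 * \<theta> / real d" using s_hi x1 by simp
    have Cl: "(real (l choose m))\<^sup>2 \<le> (real r powr (2 / real k)) ^ d"
    proof -
      \<comment> \<open>If d is the complementary degree r - km, the symmetric binomial with l - m
        in place of m is used, since k(l - m) is at most r - km.\<close>
      define \<mu> where "\<mu> = (if d = k * m then m else l - m)"
      have \<mu>: "k * \<mu> \<le> d"
      proof (cases "d = k * m")
        case False
        then have "d = r - k * m" by (auto simp: d_def min_def)
        then show ?thesis using fit False by (simp add: \<mu>_def r_def diff_mult_distrib2)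
      qed (simp add: \<mu>_def)
      have "l choose m \<le> l ^ \<mu>"
        using binomial_le_pow[of m l] binomial_le_pow[of "l - m" l] binomial_symmetric[of m l] m
        by (auto simp: \<mu>_def)
      also have "\<dots> \<le> r ^ \<mu>"
      proof (rule power_mono)
        have "1 * l \<le> k * l" using k_pos by (intro mult_le_mono1)
        then show "l \<le> r" unfolding r_def using fit by linarith
      qed simp
      finally have "real (l choose m) \<le> real r ^ \<mu>" unfolding of_nat_power[symmetric] of_nat_le_iff .
      then have "(real (l choose m))\<^sup>2 \<le> (real r ^ \<mu>)\<^sup>2" by (intro power_mono) auto
      also have "\<dots> = real r powr (2 / real k * real (k * \<mu>))"
      proof -
        have "2 / real k * real (k * \<mu>) = real (2 * \<mu>)" using k_pos by simp
        moreover have "(real r ^ \<mu>)\<^sup>2 = real r ^ (2 * \<mu>)" by (metis mult.commute power_mult)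
        ultimately show ?thesis using r1 powr_realpow[of "real r" "2 * \<mu>"] by (simp only:)
      qed
      also have "\<dots> \<le> real r powr (2 / real k * real d)"
        using r1 \<mu> by (intro powr_mono mult_left_mono) (simp_all add: of_nat_mono del: of_nat_mult)
      also have "\<dots> = (real r powr (2 / real k)) ^ d"
        using r1 powr_powr[of "real r" "2 / real k" "real d"] powr_realpow[of "real r powr (2 / real k)" d]
        by simp
      finally show ?thesis .
    qed
    \<comment> \<open>The d in the denominator of the moment factor cancels against (r choose d)
      \<ge> (r/d)^d. What remains is (6\<beta>)^d, independent of r, and 6\<beta> is \<kappa>^2 / e
      by the choice of \<kappa>.\<close>
    have "real (2 * s - 1) ^ d * V \<le> (6 * \<theta> / real d) ^ d * ((real r powr (2 / real k)) ^ d / (real r / real d) ^ d)"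
    proof (intro mult_mono power_mono s2)
      have "(real r / real d) ^ d \<le> real (r choose d)" by (rule binomial_ge_n_over_k_pow_k[OF dr(2)])
      then show "V \<le> (real r powr (2 / real k)) ^ d / (real r / real d) ^ d"
        unfolding V using Cl r1 dpos by (intro frac_le) auto
    qed (use V0 \<theta>(2) in auto)
    also have "\<dots> = (6 * (\<theta> / real r) * real r powr (2 / real k)) ^ d"
    proof -
      have "6 * \<theta> / real d * (real r powr (2 / real k) / (real r / real d))
          = 6 * (\<theta> / real r) * real r powr (2 / real k)" using dpos by simp
      then show ?thesis unfolding power_divide[symmetric] power_mult_distrib[symmetric] by (rule arg_cong)
    qed
    also have "\<dots> = (6 * \<beta>) ^ d"
    proof -
      have "real r powr (- 2 / real k) * real r powr (2 / real k) = 1"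
        using r1 by (simp add: powr_add[symmetric])
      then show ?thesis unfolding \<theta>r by (simp add: mult.assoc)
    qed
    finally have base: "real (2 * s - 1) ^ d * V \<le> (6 * \<beta>) ^ d" .
    have "cube_avg I (\<lambda>x. level m x ^ (2 * s)) \<le> (real (2 * s - 1) ^ d * V) ^ s"
      using moment_level[OF s1, of m] by (simp add: V_def d_def r_def)
    also have "\<dots> \<le> ((6 * \<beta>) ^ d) ^ s"
      using base V0 by (intro power_mono) auto
    also have "(6 * \<beta>) = \<kappa>\<^sup>2 * exp (- 1)"
      by (simp add: \<kappa>2 exp_minus)
    also have "((\<kappa>\<^sup>2 * exp (- 1)) ^ d) ^ s = (\<kappa> ^ d) ^ (2 * s) * exp (- real (d * s))"
      by (simp add: power_mult_distrib power_mult[symmetric] exp_of_nat_mult[symmetric] ac_simps)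
    also have "\<dots> \<le> \<eta> ^ (2 * s) * exp (- 2 * \<theta>)"
      using \<eta>d \<kappa>2 s_d by (intro mult_mono power_mono) auto
    finally show ?thesis using s1 by blast
  next
    case False
    \<comment> \<open>Binomials increase up to r/2, so (r choose d) is at least (r choose n), hence
      at least (r/n)^n. The assumption on \<beta> makes r/n at least exp (9/2), and n is at least
      2\<theta>.\<close>
    define n where "n = nat \<lceil>2 * \<theta>\<rceil>"
    have n: "2 * \<theta> \<le> real n" "real n \<le> 3 * \<theta>" "0 < real n"
      using \<theta>(2) unfolding n_def by linarith+
    have nd: "n \<le> d" using False unfolding n_def by linarith
    have "exp (9 / 2) \<le> real r / real n"
    proof -
      have "real r powr (- 2 / real k) \<le> real r powr 0" using r1 by (intro powr_mono) auto
      then have "\<theta> / real r \<le> \<beta> * 1" unfolding \<theta>r using \<beta> r1 by (intro mult_left_mono) auto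
      moreover have "real n / real r \<le> 3 * (\<theta> / real r)"
        using divide_right_mono[OF n(2), of "real r"] by simp
      ultimately have "real n / real r \<le> exp (- 9 / 2)" using \<beta>(2) by linarith
      then have "real n \<le> exp (- 9 / 2) * real r" using r1 by (simp add: pos_divide_le_eq)
      then have "exp (9 / 2) * real n \<le> exp (9 / 2) * (exp (- 9 / 2) * real r)"
        by (intro mult_left_mono) auto
      also have "\<dots> = real r" by (simp add: mult.assoc[symmetric] exp_add[symmetric])
      finally show ?thesis using n by (simp add: pos_le_divide_eq)
    qed
    then have "exp (9 / 2) ^ n \<le> (real r / real n) ^ n" by (intro power_mono) auto
    also have "\<dots> \<le> real (r choose n)" using nd dr by (intro binomial_ge_n_over_k_pow_k) simp
    also have "\<dots> \<le> real (r choose d)" using nd dr by (intro of_nat_mono binomial_mono) auto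
    finally have "exp (9 / 2 * real n) \<le> real (r choose d)"
      by (simp add: exp_of_nat_mult[symmetric] mult.commute)
    moreover have "exp (9 * \<theta>) \<le> exp (9 / 2 * real n)" using n by simp
    ultimately have big: "exp (9 * \<theta>) \<le> real (r choose d)" by linarith
    \<comment> \<open>Here k at least 3 enters: the squared numerator of \<open>V\<close> is at most
      the power 2/3 of its denominator. This gives V at most exp (-9\<theta>/3) = exp
      (-\<theta>/2)^2 * exp (-2\<theta>).\<close>
    have "(l choose m) ^ 3 \<le> (l choose m) ^ k" using k3 m by (intro power_increasing) (auto simp: Suc_le_eq)
    also have "\<dots> \<le> k * l choose (k * m)" by (rule choose_power_le)
    also have "\<dots> \<le> r choose (k * m)" using fit by (intro choose_mono_upper) (simp add: r_def)
    finally have "real ((l choose m) ^ 3) \<le> real (r choose d)" unfolding ch of_nat_le_iff .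
    then have "(real (l choose m) ^ 3)\<^sup>2 \<le> (real (r choose d))\<^sup>2" by (intro power_mono) auto
    then have "V ^ 3 \<le> (real (r choose d))\<^sup>2 / real (r choose d) ^ 3"
      unfolding V power_divide by (intro divide_right_mono) (simp_all add: power_mult[symmetric] mult.commute)
    also have "\<dots> = 1 / real (r choose d)" using bpos by (simp add: power2_eq_square power3_eq_cube)
    also have "\<dots> \<le> 1 / exp (9 * \<theta>)" using big bpos by (intro frac_le) auto
    also have "\<dots> = exp (- 3 * \<theta>) ^ 3"
      using exp_of_nat_mult[of 3 "- 3 * \<theta>"] by (simp add: exp_minus inverse_eq_divide)
    finally have V3: "V \<le> exp (- 3 * \<theta>)"
      using power_mono_iff[of V "exp (- 3 * \<theta>)" 3] V0 by simp
    have "cube_avg I (\<lambda>x. level m x ^ (2 * 1)) \<le> V"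
      using moment_level[of 1 m] by (simp add: V_def)
    also have "\<dots> \<le> exp (- \<theta> / 2) ^ (2 * 1) * exp (- 2 * \<theta>)"
      using V3 by (simp add: exp_of_nat_mult[symmetric] exp_add[symmetric])
    also have "\<dots> \<le> \<eta> ^ (2 * 1) * exp (- 2 * \<theta>)"
      using \<eta>d by (intro mult_right_mono power_mono) auto
    finally show ?thesis by blast
  qed
qed

text \<open>Where every level stays below its threshold, the bias is at most the sum of the
  thresholds. Elsewhere the bias is still at most 1, and the factor exp \<theta> is outweighed by
  the probability l * exp (-2\<theta>) of the exceptional set.\<close>

lemma exp_moment_bias_small:
  assumes k3: "3 \<le> k" and fit: "k * l < card I"
    and \<beta>: "0 < \<beta>" "3 * \<beta> \<le> exp (- 9 / 2)"
    and \<theta>: "\<theta> = \<beta> * real (card I) powr (1 - 2 / real k)" "1 \<le> \<theta>"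
    and \<kappa>: "\<kappa> = sqrt (6 * exp 1 * \<beta>)" "\<kappa> \<le> 1 / 2"
    and le1: "\<And>x. x \<in> Pow I \<Longrightarrow> bias x \<le> 1"
  shows "cube_avg I (\<lambda>x. exp (\<theta> * bias x)) \<le> exp (\<theta> * (4 * \<kappa> + 2 * real l * exp (- \<theta> / 2)))"
proof -
  define \<eta> where "\<eta> m = \<kappa> ^ min (k * m) (card I - k * m) + exp (- \<theta> / 2)" for m
  have \<kappa>0: "0 < \<kappa>" "\<kappa> < 1" using \<beta>(1) \<kappa>(1) by simp (use \<kappa>(2) in linarith)
  have \<eta>0: "0 < \<eta> m" for m using \<kappa>0 by (simp add: \<eta>_def add_pos_pos)
  have "\<forall>m\<in>{1..l}. \<exists>s\<ge>1. cube_avg I (\<lambda>x. level m x ^ (2 * s)) \<le> \<eta> m ^ (2 * s) * exp (- 2 * \<theta>)"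
    using level_moment_small[OF k3 fit _ _ \<beta> \<theta> \<kappa>(1) \<eta>_def] by simp
  then obtain s where s: "\<And>m. m \<in> {1..l} \<Longrightarrow> 1 \<le> s m"
    "\<And>m. m \<in> {1..l} \<Longrightarrow> cube_avg I (\<lambda>x. level m x ^ (2 * s m)) \<le> \<eta> m ^ (2 * s m) * exp (- 2 * \<theta>)"
    by metis
  define H where "H = 4 * \<kappa> + real l * exp (- \<theta> / 2)"
  have H0: "0 \<le> H" using \<kappa>0 by (simp add: H_def)
  have sum_\<eta>: "(\<Sum>m = 1..l. \<eta> m) \<le> H"
  proof -
    \<comment> \<open>The exponent is small at both ends of the range of m, so two geometric series
      are needed. The strict inequality between kl and the size of the column provides the + 1 that
      makes the second series start at \<kappa> as well.\<close>
    have "\<kappa> ^ min (k * m) (card I - k * m) \<le> \<kappa> ^ m + \<kappa> ^ (l + 1 - m)" if m: "m \<in> {1..l}" for m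
    proof -
      have "1 * m \<le> k * m" using k_pos by (intro mult_le_mono1)
      then have 1: "\<kappa> ^ (k * m) \<le> \<kappa> ^ m" using \<kappa>0 by (intro power_decreasing) auto
      have "1 * (l - m) \<le> k * (l - m)" using k_pos by (intro mult_le_mono1)
      then have "l - m \<le> k * l - k * m" by (simp add: diff_mult_distrib2)
      moreover have "k * m \<le> k * l" using m by simp
      ultimately have "l + 1 - m \<le> card I - k * m" using fit m unfolding atLeastAtMost_iff by linarith
      then have 2: "\<kappa> ^ (card I - k * m) \<le> \<kappa> ^ (l + 1 - m)" using \<kappa>0 by (intro power_decreasing) auto
      show ?thesis using 1 2 \<kappa>0 by (auto simp: min_def add_increasing add_increasing2)
    qed
    then have "(\<Sum>m = 1..l. \<eta> m) \<le> (\<Sum>m = 1..l. \<kappa> ^ m + \<kappa> ^ (l + 1 - m) + exp (- \<theta> / 2))"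
      unfolding \<eta>_def by (intro sum_mono add_right_mono)
    also have "\<dots> = (\<Sum>m = 1..l. \<kappa> ^ m) + (\<Sum>m = 1..l. \<kappa> ^ (l + 1 - m)) + real l * exp (- \<theta> / 2)"
      by (simp add: sum.distrib)
    also have "(\<Sum>m = 1..l. \<kappa> ^ (l + 1 - m)) = (\<Sum>m = 1..l. \<kappa> ^ m)"
      by (rule sum.reindex_bij_witness[of _ "\<lambda>m. l + 1 - m" "\<lambda>m. l + 1 - m"]) auto
    also have "(\<Sum>m = 1..l. \<kappa> ^ m) \<le> 2 * \<kappa>"
    proof -
      have "(\<Sum>m = 1..l. \<kappa> ^ m) \<le> \<kappa> / (1 - \<kappa>)" using \<kappa>0 by (intro sum_geometric_le) auto
      also have "\<dots> \<le> \<kappa> / (1 / 2)" using \<kappa>(2) \<kappa>0 by (intro divide_left_mono) auto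
      finally show ?thesis by simp
    qed
    finally show ?thesis by (simp add: H_def)
  qed
  \<comment> \<open>The sum of normalised even powers is at least 1 wherever some level exceeds its
    threshold; it plays the role of the indicator in Markov's inequality.\<close>
  have pt: "exp (\<theta> * bias x) \<le> exp (\<theta> * H) + exp \<theta> * (\<Sum>m = 1..l. level m x ^ (2 * s m) / \<eta> m ^ (2 * s m))"
    if x: "x \<in> Pow I" for x
  proof (cases "\<forall>m\<in>{1..l}. \<bar>level m x\<bar> \<le> \<eta> m")
    case True
    have "bias x \<le> (\<Sum>m = 1..l. \<eta> m)"
      unfolding bias_eq_sum_level using True by (intro sum_mono) (simp add: abs_le_iff)
    then have "exp (\<theta> * bias x) \<le> exp (\<theta> * H)" using sum_\<eta> \<theta>(2) by simp
    moreover have "0 \<le> exp \<theta> * (\<Sum>m = 1..l. level m x ^ (2 * s m) / \<eta> m ^ (2 * s m))"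
      using \<eta>0 by (intro mult_nonneg_nonneg sum_nonneg divide_nonneg_nonneg) (simp_all add: power_mult)
    ultimately show ?thesis by linarith
  next
    case False
    then obtain m where m: "m \<in> {1..l}" "\<eta> m < \<bar>level m x\<bar>" by force
    have "\<eta> m ^ (2 * s m) \<le> \<bar>level m x\<bar> ^ (2 * s m)" using m \<eta>0[of m] by (intro power_mono) auto
    then have "1 \<le> level m x ^ (2 * s m) / \<eta> m ^ (2 * s m)"
      using \<eta>0[of m] by (simp add: power_even_abs le_divide_eq)
    also have "\<dots> \<le> (\<Sum>m = 1..l. level m x ^ (2 * s m) / \<eta> m ^ (2 * s m))"
      using m(1) \<eta>0 by (intro member_le_sum[of m]) (auto simp: power_mult)
    finally have "exp \<theta> * 1 \<le> exp \<theta> * (\<Sum>m = 1..l. level m x ^ (2 * s m) / \<eta> m ^ (2 * s m))"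
      by (intro mult_left_mono) auto
    moreover have "exp (\<theta> * bias x) \<le> exp \<theta>" using le1[OF x] \<theta>(2) by simp
    moreover have "0 < exp (\<theta> * H)" by simp
    ultimately show ?thesis by linarith
  qed
  have "cube_avg I (\<lambda>x. exp (\<theta> * bias x))
      \<le> cube_avg I (\<lambda>x. exp (\<theta> * H) + exp \<theta> * (\<Sum>m = 1..l. level m x ^ (2 * s m) / \<eta> m ^ (2 * s m)))"
    by (intro cube_avg_mono pt)
  also have "\<dots> = exp (\<theta> * H) + exp \<theta> * (\<Sum>m = 1..l. cube_avg I (\<lambda>x. level m x ^ (2 * s m)) / \<eta> m ^ (2 * s m))"
    by (simp only: cube_avg_add cube_avg_cmult cube_avg_const[OF finite_I] cube_avg_sum cube_avg_divide)
  also have "\<dots> \<le> exp (\<theta> * H) + exp \<theta> * (\<Sum>m = 1..l. exp (- 2 * \<theta>))"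
  proof (intro add_left_mono mult_left_mono sum_mono)
    fix m assume m: "m \<in> {1..l}"
    show "cube_avg I (\<lambda>x. level m x ^ (2 * s m)) / \<eta> m ^ (2 * s m) \<le> exp (- 2 * \<theta>)"
      using s(2)[OF m] \<eta>0[of m] by (simp add: pos_divide_le_eq mult.commute)
  qed simp
  also have "\<dots> = exp (\<theta> * H) + real l * exp (- \<theta>)"
  proof -
    have "exp \<theta> * exp (- 2 * \<theta>) = exp (- \<theta>)" unfolding exp_add[symmetric] by simp
    then show ?thesis by simp
  qed
  \<comment> \<open>The remainder is enlarged to a multiple of \<theta> * exp (\<theta> * H) so that
    1 + x \<le> exp x moves it into the exponent with the factor \<theta> in front.\<close>
  also have "\<dots> \<le> exp (\<theta> * H) + exp (\<theta> * H) * (\<theta> * real l * exp (- \<theta> / 2))"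
  proof -
    have "1 * (real l * exp (- \<theta>)) \<le> exp (\<theta> * H) * (\<theta> * real l * exp (- \<theta> / 2))"
    proof (rule mult_mono)
      have "1 * real l * exp (- \<theta>) \<le> \<theta> * real l * exp (- \<theta> / 2)"
        using \<theta>(2) by (intro mult_mono) auto
      then show "real l * exp (- \<theta>) \<le> \<theta> * real l * exp (- \<theta> / 2)" by simp
    qed (use H0 \<theta>(2) in auto)
    then show ?thesis by simp
  qed
  also have "\<dots> = exp (\<theta> * H) * (1 + \<theta> * real l * exp (- \<theta> / 2))" by (simp add: algebra_simps)
  also have "\<dots> \<le> exp (\<theta> * H) * exp (\<theta> * real l * exp (- \<theta> / 2))"
    by (intro mult_left_mono exp_ge_add_one_self) auto
  also have "\<dots> = exp (\<theta> * (4 * \<kappa> + 2 * real l * exp (- \<theta> / 2)))"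
    unfolding exp_add[symmetric] H_def by (simp add: algebra_simps)
  finally show ?thesis .
qed

end

text \<open>\<open>a\<close> and \<open>R\<close> depend on \<delta> and \<epsilon> only, since k
  may change along a sequence of games. For k = 2 the power of r is 1 and a constant \<theta>
  serves. For k at least 3 the exponent is at least 1/3, so \<theta> grows at a rate uniform in k
  and l * exp (-\<theta>/2) vanishes.\<close>

lemma exp_moment_bias_uniform:
  fixes \<delta> \<epsilon> :: real
  assumes \<delta>: "0 < \<delta>" and \<epsilon>: "0 < \<epsilon>"
  obtains a :: real and R :: nat where "0 < a"
    and "\<And>k l r. 2 \<le> k \<Longrightarrow> real r = (real k + \<delta>) * real l \<Longrightarrow> R \<le> r \<Longrightarrow>
      \<exists>\<theta>>0. a * real r powr (1 - 2 / real k) \<le> \<theta> \<and>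
        (\<forall>(I :: 'a set) y w. random_blocks I l k y w \<longrightarrow> card I = r \<longrightarrow>
          (\<forall>x\<in>Pow I. random_blocks.bias I l k y w x \<le> 1) \<longrightarrow>
          cube_avg I (\<lambda>x. exp (\<theta> * random_blocks.bias I l k y w x)) \<le> exp (\<theta> * \<epsilon>))"
proof -
  define B where "B = (2 / (2 + \<delta>)) / (1 - 2 / (2 + \<delta>))"
  have B: "0 \<le> B" using \<delta> by (simp add: B_def)
  \<comment> \<open>For k = 2 the exponent is at most b^2 * B, and this choice makes it at most b *
    \<epsilon>.\<close>
  define b where "b = min 1 (\<epsilon> / (B + 1))"
  have b: "0 < b" "b \<le> 1" "b * (B + 1) \<le> \<epsilon>"
    using \<epsilon> B mult_right_mono[of b "\<epsilon> / (B + 1)" "B + 1"] by (auto simp: b_def)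
  define \<kappa> where "\<kappa> = min (1 / 2) (\<epsilon> / 8)"
  \<comment> \<open>The first bound makes (r choose d) large at degrees above 2\<theta>; the second
    keeps sqrt (6 * e * \<beta>) below \<kappa>, so that 4\<kappa> uses only half of
    \<epsilon>.\<close>
  define \<beta> where "\<beta> = min (exp (- 9 / 2) / 3) (\<kappa>\<^sup>2 / (6 * exp 1))"
  have \<kappa>: "0 < \<kappa>" "\<kappa> \<le> 1 / 2" "8 * \<kappa> \<le> \<epsilon>" using \<epsilon> by (auto simp: \<kappa>_def)
  have \<beta>: "0 < \<beta>" "3 * \<beta> \<le> exp (- 9 / 2)" using \<kappa> by (auto simp: \<beta>_def)
  have "6 * exp 1 * \<beta> \<le> 6 * exp 1 * (\<kappa>\<^sup>2 / (6 * exp 1))"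
    by (intro mult_left_mono) (auto simp: \<beta>_def)
  then have \<kappa>\<beta>: "sqrt (6 * exp 1 * \<beta>) \<le> \<kappa>" using \<kappa> by (intro real_le_lsqrt) auto
  \<comment> \<open>A lower bound for \<theta>/2 valid for every k at least 3, since 1/3 is the
    least value of 1 - 2/k.\<close>
  define u where "u x = \<beta> / 2 * x powr (1 / 3)" for x :: real
  have u_top: "filterlim u at_top at_top"
  proof -
    have "filterlim (\<lambda>x :: real. x powr (1 / 3)) at_top at_top"
    proof (subst filterlim_cong[OF refl refl])
      show "\<forall>\<^sub>F x :: real in at_top. x powr (1 / 3) = exp (1 / 3 * ln x)"
        using eventually_gt_at_top[of 0] by eventually_elim (simp add: powr_def)
      show "filterlim (\<lambda>x :: real. exp (1 / 3 * ln x)) at_top at_top"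
        by (intro filterlim_compose[OF exp_at_top] filterlim_tendsto_pos_mult_at_top[OF tendsto_const] ln_at_top) simp
    qed
    then show ?thesis unfolding u_def using \<beta> by (intro filterlim_tendsto_pos_mult_at_top[OF tendsto_const]) auto
  qed
  \<comment> \<open>Since u^3 = \<beta>^3 * x / 8, this expression is 2x / exp u, a bound for the
    error term 2 * l * exp (-\<theta>/2).\<close>
  have "((\<lambda>x. 16 / \<beta> ^ 3 * (u x ^ 3 / exp (u x))) \<longlongrightarrow> 16 / \<beta> ^ 3 * 0) at_top"
    by (intro tendsto_mult tendsto_const filterlim_compose[OF tendsto_power_div_exp_0 u_top])
  then have "eventually (\<lambda>x. 16 / \<beta> ^ 3 * (u x ^ 3 / exp (u x)) < \<epsilon> / 2) at_top"
    using \<epsilon> by (intro order_tendstoD(2)) auto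
  moreover have "eventually (\<lambda>x. 1 \<le> u x) at_top" using u_top by (simp add: filterlim_at_top)
  moreover have "eventually (\<lambda>x :: real. 1 \<le> x) at_top" by (rule eventually_ge_at_top)
  ultimately have "eventually (\<lambda>x. 2 * x * exp (- u x) \<le> \<epsilon> / 2 \<and> 1 \<le> u x \<and> 1 \<le> x) at_top"
  proof eventually_elim
    case (elim x)
    have "u x ^ 3 = (\<beta> / 2) ^ 3 * (x powr (1 / 3)) ^ 3" unfolding u_def by (rule power_mult_distrib)
    also have "(x powr (1 / 3)) ^ 3 = x"
      using elim powr_powr[of x "1 / 3" 3] powr_realpow[of "x powr (1 / 3)" 3] by simp
    finally have u3: "u x ^ 3 = \<beta> ^ 3 / 8 * x" by (simp add: power_divide)
    have "16 / \<beta> ^ 3 * (u x ^ 3 / exp (u x)) = 2 * x / exp (u x)" unfolding u3 using \<beta>(1) by simp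
    moreover have "2 * x * exp (- u x) = 2 * x / exp (u x)" by (simp add: exp_minus inverse_eq_divide)
    ultimately show ?case using elim by linarith
  qed
  then obtain R0 where R0: "\<And>x. R0 \<le> x \<Longrightarrow> 2 * x * exp (- u x) \<le> \<epsilon> / 2 \<and> 1 \<le> u x \<and> 1 \<le> x"
    unfolding eventually_at_top_linorder by blast
  define R where "R = nat \<lceil>R0\<rceil>"
  show thesis
  proof (rule that[of "min b \<beta>" R])
    show "0 < min b \<beta>" using b \<beta> by simp
    fix k l r :: nat
    assume k: "2 \<le> k" and r: "real r = (real k + \<delta>) * real l" and Rr: "R \<le> r"
    have Rr': "R0 \<le> real r" using Rr unfolding R_def by linarith
    have r1: "1 \<le> real r" using R0[OF Rr'] by simp
    then have l: "0 < real l" using r by (cases "l = 0") auto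
    have "real (k * l) < real r" unfolding r using \<delta> l by (simp add: algebra_simps)
    then have fit: "k * l < r" by linarith
    have lr: "real l \<le> real r"
    proof -
      have "1 * l \<le> k * l" using k by (intro mult_le_mono1) simp
      then show ?thesis using fit by linarith
    qed
    show "\<exists>\<theta>>0. min b \<beta> * real r powr (1 - 2 / real k) \<le> \<theta> \<and>
        (\<forall>(I :: 'a set) y w. random_blocks I l k y w \<longrightarrow> card I = r \<longrightarrow>
          (\<forall>x\<in>Pow I. random_blocks.bias I l k y w x \<le> 1) \<longrightarrow>
          cube_avg I (\<lambda>x. exp (\<theta> * random_blocks.bias I l k y w x)) \<le> exp (\<theta> * \<epsilon>))"
    proof (cases "k = 2")
      case True
      show ?thesis
      proof (intro exI[of _ b] conjI allI impI)
        show "0 < b" by (rule b)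
        show "min b \<beta> * real r powr (1 - 2 / real k) \<le> b" using True r1 by simp
        fix I :: "'a set" and y w
        assume rb: "random_blocks I l k y w" and I: "card I = r"
          and le1: "\<forall>x\<in>Pow I. random_blocks.bias I l k y w x \<le> 1"
        interpret random_blocks I l k y w by (rule rb)
        have "(\<Sum>m = 1..l. level_weight m) \<le> B"
          unfolding B_def using sum_level_weight_2[OF True \<delta>] r I True by simp
        then have "b\<^sup>2 * (\<Sum>m = 1..l. level_weight m) \<le> b * (b * (B + 1))"
          using b unfolding power2_eq_square mult.assoc by (intro mult_left_mono) auto
        also have "\<dots> \<le> b * \<epsilon>" using b by (intro mult_left_mono) auto
        finally have "exp (b\<^sup>2 * (\<Sum>m = 1..l. level_weight m)) \<le> exp (b * \<epsilon>)" by simp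
        moreover have "cube_avg I (\<lambda>x. exp (b * bias x)) \<le> exp (b\<^sup>2 * (\<Sum>m = 1..l. level_weight m))"
          using b le1 by (intro exp_moment_bias_quadratic) auto
        ultimately show "cube_avg I (\<lambda>x. exp (b * bias x)) \<le> exp (b * \<epsilon>)"
          by (rule order_trans[rotated])
      qed
    next
      case False
      then have k3: "3 \<le> k" using k by simp
      define \<theta> where "\<theta> = \<beta> * real r powr (1 - 2 / real k)"
      have "real r powr (1 / 3) \<le> real r powr (1 - 2 / real k)"
        using r1 k3 by (intro powr_mono) (auto simp: field_simps)
      then have u\<theta>: "u (real r) \<le> \<theta> / 2" using \<beta>(1) by (simp add: u_def \<theta>_def)
      have u1: "1 \<le> u (real r)" and u2: "2 * real r * exp (- u (real r)) \<le> \<epsilon> / 2"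
        using R0[OF Rr'] by auto
      have \<theta>1: "1 \<le> \<theta>" using u1 u\<theta> by linarith
      show ?thesis
      proof (intro exI[of _ \<theta>] conjI allI impI)
        show "0 < \<theta>" using \<theta>1 by simp
        show "min b \<beta> * real r powr (1 - 2 / real k) \<le> \<theta>"
          unfolding \<theta>_def by (intro mult_right_mono) auto
        fix I :: "'a set" and y w
        assume rb: "random_blocks I l k y w" and I: "card I = r"
          and le1: "\<forall>x\<in>Pow I. random_blocks.bias I l k y w x \<le> 1"
        interpret random_blocks I l k y w by (rule rb)
        have "cube_avg I (\<lambda>x. exp (\<theta> * bias x))
            \<le> exp (\<theta> * (4 * sqrt (6 * exp 1 * \<beta>) + 2 * real l * exp (- \<theta> / 2)))"
          using le1 \<kappa>(2) \<kappa>\<beta> fit \<theta>1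
          by (intro exp_moment_bias_small[OF k3 _ \<beta>]) (auto simp: I \<theta>_def)
        also have "\<dots> \<le> exp (\<theta> * \<epsilon>)"
        proof -
          have "2 * real l * exp (- \<theta> / 2) \<le> 2 * real r * exp (- u (real r))"
            using lr u\<theta> by (intro mult_mono) auto
          then have "4 * sqrt (6 * exp 1 * \<beta>) + 2 * real l * exp (- \<theta> / 2) \<le> \<epsilon>"
            using u2 \<kappa>\<beta> \<kappa>(3) by linarith
          then show ?thesis using \<theta>1 by simp
        qed
        finally show "cube_avg I (\<lambda>x. exp (\<theta> * bias x)) \<le> exp (\<theta> * \<epsilon>)" .
      qed
    qed
  qed
qed

section \<open>Messages reveal little about parities over random blocks\<close>

text \<open>A union bound in exponential form: the value of \<open>f\<close> may depend on
  \<open>x\<close>, but the exponential at \<open>f x\<close> is at most the sum over all of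
  \<open>M\<close>, whose terms have a fixed index. Passing to logarithms costs ln (card M).\<close>

lemma expectation_le_ln_exp_moment:
  fixes F :: "'m \<Rightarrow> 'x \<Rightarrow> real"
  assumes p: "finite (set_pmf p)" and M: "finite M" "\<And>x. x \<in> set_pmf p \<Longrightarrow> f x \<in> M"
    and K: "0 < K" "\<And>\<mu>. \<mu> \<in> M \<Longrightarrow> measure_pmf.expectation p (\<lambda>x. exp (F \<mu> x)) \<le> K"
  shows "measure_pmf.expectation p (\<lambda>x. F (f x) x) \<le> ln (real (card M) * K)"
proof -
  have int: "integrable p h" for h :: "'x \<Rightarrow> real" by (rule integrable_measure_pmf_finite[OF p])
  have "M \<noteq> {}" using M(2) set_pmf_not_empty[of p] by blast
  then have N: "0 < real (card M) * K" using M(1) K by (simp add: card_gt_0_iff)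
  define c where "c = ln (real (card M) * K)"
  have c: "exp c = real (card M) * K" using N by (simp add: c_def)
  have "measure_pmf.expectation p (\<lambda>x. exp (F (f x) x)) \<le> measure_pmf.expectation p (\<lambda>x. \<Sum>\<mu>\<in>M. exp (F \<mu> x))"
    using M by (intro integral_mono_AE int AE_pmfI) (auto intro!: member_le_sum)
  also have "\<dots> = (\<Sum>\<mu>\<in>M. measure_pmf.expectation p (\<lambda>x. exp (F \<mu> x)))"
    by (intro Bochner_Integration.integral_sum int)
  also have "\<dots> \<le> (\<Sum>\<mu>\<in>M. K)" by (intro sum_mono K)
  finally have E: "measure_pmf.expectation p (\<lambda>x. exp (F (f x) x)) \<le> exp c" by (simp add: c)
  \<comment> \<open>The tangent to exp at c replaces Jensen's inequality.\<close>
  have "measure_pmf.expectation p (\<lambda>x. F (f x) x - c) \<le> measure_pmf.expectation p (\<lambda>x. exp (- c) * exp (F (f x) x) - 1)"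
  proof (intro integral_mono_AE int AE_pmfI)
    fix x
    show "F (f x) x - c \<le> exp (- c) * exp (F (f x) x) - 1"
      using exp_ge_add_one_self[of "F (f x) x - c"] by (simp add: exp_diff exp_minus divide_inverse mult.commute)
  qed
  also have "\<dots> = exp (- c) * measure_pmf.expectation p (\<lambda>x. exp (F (f x) x)) - 1"
    using int by (simp add: Bochner_Integration.integral_diff)
  also have "\<dots> \<le> exp (- c) * exp c - 1" using E by (intro diff_right_mono mult_left_mono) auto
  also have "\<dots> = 0" by (simp add: exp_minus)
  finally show ?thesis using int by (simp add: c_def Bochner_Integration.integral_diff)
qed

lemma phi_indicator:
  "1 + phi l (\<lambda>i. if Y i then - 1 else 1) U x = 2 ^ l * of_bool (\<forall>i<l. odd (card (set (U ! i) \<inter> x)) = Y i)"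
proof -
  have 1: "1 + (if Y i then - 1 else 1) * chi (set (U ! i)) x = 2 * of_bool (odd (card (set (U ! i) \<inter> x)) = Y i)" for i
    by (auto simp: chi_def)
  have "(\<Prod>i<l. 2 * of_bool (odd (card (set (U ! i) \<inter> x)) = Y i) :: real)
      = 2 ^ l * (\<Prod>i<l. of_bool (odd (card (set (U ! i) \<inter> x)) = Y i))"
    by (simp add: prod.distrib)
  also have "(\<Prod>i<l. of_bool (odd (card (set (U ! i) \<inter> x)) = Y i) :: real)
      = of_bool (\<forall>i<l. odd (card (set (U ! i) \<inter> x)) = Y i)"
    by (auto simp: of_bool_def prod_zero_iff)
  finally show ?thesis by (simp add: phi_def 1)
qed

text \<open>\<open>XX\<close> is the space of codes. The assumption \<open>col_bij\<close> expresses
  that a uniform code has independent columns, each uniform among the subsets of its ground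
  set.\<close>

locale columns =
  fixes t :: nat and I :: "nat \<Rightarrow> 'a set" and r l k :: nat
    and XX :: "'x set" and col :: "'x \<Rightarrow> nat \<Rightarrow> 'a set" and Y :: "nat \<Rightarrow> bool"
  assumes t_pos: "0 < t" and card_col: "\<And>j. j < t \<Longrightarrow> finite (I j) \<and> card (I j) = r"
    and k1: "1 \<le> k" and fit: "k * l \<le> r"
    and col_bij: "bij_betw (\<lambda>X. \<lambda>j\<in>{..<t}. col X j) XX (PiE {..<t} (\<lambda>j. Pow (I j)))"
begin

definition inst :: "nat \<Rightarrow> ('x \<times> 'a list list) set" where
  "inst j = {(X, U). X \<in> XX \<and> U \<in> seqs (I j) l k \<and> (\<forall>i<l. odd (card (set (U ! i) \<inter> col X j)) = Y i)}"

abbreviation sgn_Y :: "nat \<Rightarrow> real" where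
  "sgn_Y \<equiv> \<lambda>i. if Y i then - 1 else 1"

lemma finite_XX: "finite XX" and card_XX: "real (card XX) = (2 ^ r) ^ t"
proof -
  have f: "finite (PiE {..<t} (\<lambda>j. Pow (I j)))" using card_col by (intro finite_PiE) auto
  then show "finite XX" using bij_betw_finite[OF col_bij] by simp
  have "card XX = card (PiE {..<t} (\<lambda>j. Pow (I j)))" by (rule bij_betw_same_card[OF col_bij])
  also have "\<dots> = (\<Prod>j<t. 2 ^ r)" using card_col by (simp add: card_PiE card_Pow)
  finally show "real (card XX) = (2 ^ r) ^ t" by simp
qed

lemma card_XX_pos: "0 < real (card XX)"
  by (simp add: card_XX)

lemma sum_prod_columns:
  "(\<Sum>X\<in>XX. \<Prod>j<t. G j (col X j)) = card XX * (\<Prod>j<t. cube_avg (I j) (G j))"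
proof -
  have "(\<Sum>X\<in>XX. \<Prod>j<t. G j (col X j)) = (\<Sum>X\<in>XX. \<Prod>j<t. G j ((\<lambda>j\<in>{..<t}. col X j) j))"
    by (intro sum.cong prod.cong) auto
  also have "\<dots> = (\<Sum>h\<in>PiE {..<t} (\<lambda>j. Pow (I j)). \<Prod>j<t. G j (h j))"
    by (rule sum.reindex_bij_betw[OF col_bij])
  also have "\<dots> = (\<Prod>j<t. \<Sum>x\<in>Pow (I j). G j x)"
    using card_col by (intro prod_sum_PiE[symmetric]) auto
  also have "\<dots> = (\<Prod>j<t. 2 ^ r * cube_avg (I j) (G j))"
    using card_col by (intro prod.cong) (auto simp: cube_avg_def)
  also have "\<dots> = card XX * (\<Prod>j<t. cube_avg (I j) (G j))"
    by (simp add: prod.distrib card_XX)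
  finally show ?thesis .
qed

lemma sum_column:
  assumes "j < t"
  shows "(\<Sum>X\<in>XX. h (col X j)) = card XX * cube_avg (I j) h"
proof -
  have 1: "(\<Prod>i<t. if i = j then a i else 1) = a j" for a :: "nat \<Rightarrow> real"
    using assms by simp
  have "(\<Sum>X\<in>XX. h (col X j)) = (\<Sum>X\<in>XX. \<Prod>i<t. (if i = j then h else (\<lambda>_. 1)) (col X i))"
    using 1[of "\<lambda>i. h (col _ i)"] by (intro sum.cong refl) (simp add: if_distribR)
  also have "\<dots> = card XX * (\<Prod>i<t. cube_avg (I i) (if i = j then h else (\<lambda>_. 1)))"
    by (rule sum_prod_columns)
  also have "(\<Prod>i<t. cube_avg (I i) (if i = j then h else (\<lambda>_. 1))) = (\<Prod>i<t. if i = j then cube_avg (I i) h else 1)"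
    using card_col by (intro prod.cong) (auto simp: cube_avg_const)
  finally show ?thesis using 1[of "\<lambda>i. cube_avg (I i) h"] by simp
qed

lemma sum_phi_column:
  assumes j: "j < t" and U: "U \<in> seqs (I j) l k"
  shows "(\<Sum>X\<in>XX. phi l y U (col X j)) = 0"
proof -
  have "cube_avg (I j) (phi l y U) = 0"
  proof -
    have "(\<Sum>x\<in>Pow (I j). phi l y U x)
        = (\<Sum>T\<in>Pow {..<l} - {{}}. (\<Prod>i\<in>T. y i) * (\<Sum>x\<in>Pow (I j). chi (block U T) x))"
      unfolding phi_expand[OF U] sum_distrib_left by (rule sum.swap)
    also have "\<dots> = 0"
    proof (intro sum.neutral ballI)
      fix T assume T: "T \<in> Pow {..<l} - {{}}"
      have "finite T" using T finite_subset[of T "{..<l}"] by auto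
      then have "card (block U T) \<noteq> 0" using card_block[OF U, of T] T k1 by auto
      then have "block U T \<noteq> {}" by auto
      then show "(\<Prod>i\<in>T. y i) * (\<Sum>x\<in>Pow (I j). chi (block U T) x) = 0"
        using sum_chi_eq_0[of "I j" "block U T"] block_subset[OF U, of T] T card_col[OF j] by auto
    qed
    finally show ?thesis by (simp add: cube_avg_def)
  qed
  then show ?thesis using sum_column[OF j, of "phi l y U"] by simp
qed

text \<open>A change of measure: conditioning on the parities becomes the weight
  \<open>1 + phi\<close> on unconditioned pairs.\<close>

lemma sum_inst:
  fixes h :: "'x \<Rightarrow> 'a list list \<Rightarrow> real"
  assumes j: "j < t"
  shows "(\<Sum>(X, U)\<in>inst j. h X U)
    = (\<Sum>U\<in>seqs (I j) l k. \<Sum>X\<in>XX. h X U * (1 + phi l sgn_Y U (col X j))) / 2 ^ l"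
proof -
  have fin: "finite (seqs (I j) l k)" using finite_seqs card_col[OF j] by blast
  have "(\<Sum>(X, U)\<in>inst j. h X U) = (\<Sum>(X, U)\<in>XX \<times> seqs (I j) l k.
      h X U * of_bool (\<forall>i<l. odd (card (set (U ! i) \<inter> col X j)) = Y i))"
    using fin finite_XX by (intro sum.mono_neutral_cong_left) (auto simp: inst_def)
  also have "\<dots> = (\<Sum>X\<in>XX. \<Sum>U\<in>seqs (I j) l k.
      h X U * of_bool (\<forall>i<l. odd (card (set (U ! i) \<inter> col X j)) = Y i))"
    by (rule sum.cartesian_product[symmetric])
  also have "\<dots> = (\<Sum>U\<in>seqs (I j) l k. \<Sum>X\<in>XX.
      h X U * of_bool (\<forall>i<l. odd (card (set (U ! i) \<inter> col X j)) = Y i))"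
    by (rule sum.swap)
  also have "\<dots> = (\<Sum>U\<in>seqs (I j) l k. \<Sum>X\<in>XX. h X U * (1 + phi l sgn_Y U (col X j)) / 2 ^ l)"
    unfolding phi_indicator by (intro sum.cong refl) simp
  finally show ?thesis by (simp only: sum_divide_distrib)
qed

lemma finite_inst: "j < t \<Longrightarrow> finite (inst j)"
  using finite_XX finite_seqs[of "I j" l k] card_col[of j]
  by (intro finite_subset[of "inst j" "XX \<times> seqs (I j) l k"]) (auto simp: inst_def)

text \<open>As \<open>phi\<close> has mean 0, every \<open>Y\<close> is met by exactly the fraction
  2^(-l) of all pairs, so the normalisation does not depend on \<open>Y\<close>.\<close>

lemma card_inst:
  assumes j: "j < t"
  shows "real (card (inst j)) = real (card XX) * real (card (seqs (I j) l k)) / 2 ^ l"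
proof -
  have "real (card (inst j)) = (\<Sum>(X, U)\<in>inst j. 1)" by simp
  also have "\<dots> = (\<Sum>U\<in>seqs (I j) l k. \<Sum>X\<in>XX. 1 + phi l sgn_Y U (col X j)) / 2 ^ l"
    using sum_inst[OF j, of "\<lambda>X U. 1"] by simp
  also have "\<dots> = (\<Sum>U\<in>seqs (I j) l k. real (card XX)) / 2 ^ l"
    using sum_phi_column[OF j] by (simp add: sum.distrib)
  finally show ?thesis by (simp add: mult.commute)
qed

lemma card_seqs_pos: "j < t \<Longrightarrow> 0 < card (seqs (I j) l k)"
  using seqs_nonempty[of "I j" k l] finite_seqs[of "I j" l k] card_col[of j] fit
  by (simp add: card_gt_0_iff)

lemma inst_nonempty:
  assumes "j < t"
  shows "inst j \<noteq> {}"
proof -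
  have "0 < real (card (inst j))"
    using card_XX_pos card_seqs_pos[OF assms] by (simp add: card_inst[OF assms])
  then show ?thesis by auto
qed

text \<open>The two averages differ by the mean of the biases of the test at the message
  \<open>f X\<close>. This message depends on all columns, so it is first fixed at the cost of the
  union bound over \<open>M\<close>; the columns are then independent, and the exponential moments
  of their biases multiply. Dividing by \<theta> * t gives the two error terms.\<close>

lemma hiding:
  fixes g :: "'m \<Rightarrow> nat \<Rightarrow> 'a list list \<Rightarrow> real" and \<theta> \<epsilon> :: real
  assumes g: "\<And>\<mu> j U. 0 \<le> g \<mu> j U" "\<And>\<mu> j U. g \<mu> j U \<le> 1"
    and M: "finite M" "\<And>X. X \<in> XX \<Longrightarrow> f X \<in> M" and \<theta>: "0 < \<theta>"
    and moment: "\<And>j w. j < t \<Longrightarrow> random_blocks (I j) l k sgn_Y w \<Longrightarrow>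
      (\<forall>x\<in>Pow (I j). random_blocks.bias (I j) l k sgn_Y w x \<le> 1) \<Longrightarrow>
      cube_avg (I j) (\<lambda>x. exp (\<theta> * random_blocks.bias (I j) l k sgn_Y w x)) \<le> exp (\<theta> * \<epsilon>)"
  shows "(\<Sum>j<t. (\<Sum>(X, U)\<in>inst j. g (f X) j U) / card (inst j)) / t
    \<le> (\<Sum>j<t. (\<Sum>U\<in>seqs (I j) l k. (\<Sum>X\<in>XX. g (f X) j U) / card XX) / card (seqs (I j) l k)) / t
      + \<epsilon> + ln (card M) / (\<theta> * t)"
proof -
  \<comment> \<open>Replacing \<open>g\<close> by \<open>g - 1\<close> is free, as \<open>phi\<close> has mean \<open>0\<close>, and bounds the bias by \<open>1\<close> from above.\<close>
  define w where "w \<mu> j U = g \<mu> j U - 1" for \<mu> j U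
  define bs where "bs \<mu> j = random_blocks.bias (I j) l k sgn_Y (w \<mu> j)" for \<mu> j
  let ?N = "real (card XX)" and ?S = "\<lambda>j. seqs (I j) l k"
  have rb: "random_blocks (I j) l k sgn_Y (w \<mu> j)" if "j < t" for \<mu> j
    using card_col[OF that] fit k1 g[of \<mu> j]
    by unfold_locales (auto simp: w_def abs_le_iff)
  have bs: "bs \<mu> j x = (\<Sum>U\<in>?S j. w \<mu> j U * phi l sgn_Y U x) / card (?S j)" if "j < t" for \<mu> j x
    unfolding bs_def by (rule random_blocks.bias_def[OF rb[OF that]])
  have bs1: "bs \<mu> j x \<le> 1" if "j < t" for \<mu> j x
  proof -
    have "(\<Sum>U\<in>?S j. w \<mu> j U * phi l sgn_Y U x) \<le> (\<Sum>U\<in>?S j. 1)"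
    proof (intro sum_mono)
      fix U
      \<comment> \<open>The ratio \<open>1 + phi\<close> is nonnegative but may reach 2^l, so with
        \<open>w\<close> in [-1, 0] the product is bounded from above only.\<close>
      have "- 1 \<le> phi l sgn_Y U x" using phi_indicator[of l Y U x] by (smt (verit) mult_nonneg_nonneg of_bool_def zero_le_power)
      then have "(- w \<mu> j U) * (- phi l sgn_Y U x) \<le> (- w \<mu> j U) * 1"
        using g[of \<mu> j U] by (intro mult_left_mono) (auto simp: w_def)
      moreover have "(- w \<mu> j U) * 1 \<le> 1" using g[of \<mu> j U] by (simp add: w_def)
      ultimately show "w \<mu> j U * phi l sgn_Y U x \<le> 1" unfolding minus_mult_minus by linarith
    qed
    then show ?thesis unfolding bs[OF that] using card_seqs_pos[OF that] by (simp add: divide_le_eq)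
  qed
  have diff: "(\<Sum>(X, U)\<in>inst j. g (f X) j U) / card (inst j)
      = (\<Sum>U\<in>?S j. (\<Sum>X\<in>XX. g (f X) j U) / ?N) / card (?S j) + (\<Sum>X\<in>XX. bs (f X) j (col X j)) / ?N"
    if j: "j < t" for j
  proof -
    have e: "(\<Sum>X\<in>XX. g (f X) j U * (1 + phi l sgn_Y U (col X j)))
        = (\<Sum>X\<in>XX. g (f X) j U) + (\<Sum>X\<in>XX. w (f X) j U * phi l sgn_Y U (col X j))" if "U \<in> ?S j" for U
      using sum_phi_column[OF j that, of sgn_Y]
      by (simp add: w_def algebra_simps sum.distrib sum_subtractf)
    have "(\<Sum>(X, U)\<in>inst j. g (f X) j U) / card (inst j)
        = (\<Sum>U\<in>?S j. \<Sum>X\<in>XX. g (f X) j U * (1 + phi l sgn_Y U (col X j))) / (?N * card (?S j))"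
      unfolding sum_inst[OF j] card_inst[OF j] by simp
    also have "\<dots> = ((\<Sum>U\<in>?S j. \<Sum>X\<in>XX. g (f X) j U) + (\<Sum>U\<in>?S j. \<Sum>X\<in>XX. w (f X) j U * phi l sgn_Y U (col X j)))
        / (?N * card (?S j))"
      by (simp only: sum.distrib[where A = "?S j", symmetric] e cong: sum.cong)
    also have "(\<Sum>U\<in>?S j. \<Sum>X\<in>XX. w (f X) j U * phi l sgn_Y U (col X j))
        = (\<Sum>X\<in>XX. bs (f X) j (col X j)) * card (?S j)"
    proof -
      have "(\<Sum>U\<in>?S j. w (f X) j U * phi l sgn_Y U (col X j)) = bs (f X) j (col X j) * card (?S j)" for X
        using card_seqs_pos[OF j] by (simp add: bs[OF j])
      then show ?thesis by (subst sum.swap) (simp only: sum_distrib_right)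
    qed
    finally show ?thesis
      using card_seqs_pos[OF j] by (simp add: add_divide_distrib sum_divide_distrib[symmetric])
  qed
  have "measure_pmf.expectation (pmf_of_set XX) (\<lambda>X. \<Sum>j<t. \<theta> * bs (f X) j (col X j))
      \<le> ln (real (card M) * exp (\<theta> * \<epsilon> * t))"
  proof (rule expectation_le_ln_exp_moment[where F = "\<lambda>\<mu> X. \<Sum>j<t. \<theta> * bs \<mu> j (col X j)" and f = f])
    have ne: "XX \<noteq> {}" using card_XX_pos by auto
    then show "finite (set_pmf (pmf_of_set XX))" using finite_XX by simp
    show "finite M" "\<And>x. x \<in> set_pmf (pmf_of_set XX) \<Longrightarrow> f x \<in> M" using M ne finite_XX by auto
    show "0 < exp (\<theta> * \<epsilon> * t)" by simp
    fix \<mu>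
    have "measure_pmf.expectation (pmf_of_set XX) (\<lambda>X. exp (\<Sum>j<t. \<theta> * bs \<mu> j (col X j)))
        = (\<Sum>X\<in>XX. \<Prod>j<t. exp (\<theta> * bs \<mu> j (col X j))) / ?N"
      using ne finite_XX by (simp add: integral_pmf_of_set exp_sum)
    also have "\<dots> = (\<Prod>j<t. cube_avg (I j) (\<lambda>x. exp (\<theta> * bs \<mu> j x)))"
      unfolding sum_prod_columns[of "\<lambda>j x. exp (\<theta> * bs \<mu> j x)"] using card_XX_pos by simp
    also have "\<dots> \<le> (\<Prod>j<t. exp (\<theta> * \<epsilon>))"
    proof (intro prod_mono conjI)
      fix j assume "j \<in> {..<t}"
      then show "cube_avg (I j) (\<lambda>x. exp (\<theta> * bs \<mu> j x)) \<le> exp (\<theta> * \<epsilon>)"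
        unfolding bs_def using moment[OF _ rb, of j \<mu>] bs1[of j \<mu>] by (simp add: bs_def)
      show "0 \<le> cube_avg (I j) (\<lambda>x. exp (\<theta> * bs \<mu> j x))"
        unfolding cube_avg_def by (intro divide_nonneg_nonneg sum_nonneg) auto
    qed
    also have "\<dots> = exp (\<theta> * \<epsilon> * t)" by (simp add: exp_of_nat_mult mult.commute[of _ "real t"])
    finally show "measure_pmf.expectation (pmf_of_set XX) (\<lambda>X. exp (\<Sum>j<t. \<theta> * bs \<mu> j (col X j)))
      \<le> exp (\<theta> * \<epsilon> * t)" .
  qed
  also have "measure_pmf.expectation (pmf_of_set XX) (\<lambda>X. \<Sum>j<t. \<theta> * bs (f X) j (col X j))
      = \<theta> * (\<Sum>j<t. (\<Sum>X\<in>XX. bs (f X) j (col X j)) / ?N)"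
  proof -
    have ne: "XX \<noteq> {}" using card_XX_pos by auto
    have "measure_pmf.expectation (pmf_of_set XX) (\<lambda>X. \<Sum>j<t. \<theta> * bs (f X) j (col X j))
        = (\<Sum>X\<in>XX. \<Sum>j<t. \<theta> * bs (f X) j (col X j)) / ?N"
      using ne finite_XX by (simp add: integral_pmf_of_set)
    also have "(\<Sum>X\<in>XX. \<Sum>j<t. \<theta> * bs (f X) j (col X j)) = \<theta> * (\<Sum>j<t. \<Sum>X\<in>XX. bs (f X) j (col X j))"
      unfolding sum_distrib_left by (rule sum.swap)
    finally show ?thesis by (simp only: sum_divide_distrib[symmetric] times_divide_eq_right)
  qed
  also have "ln (real (card M) * exp (\<theta> * \<epsilon> * t)) = ln (card M) + \<theta> * \<epsilon> * t"
  proof -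
    have "M \<noteq> {}" using M(2) card_XX_pos by fastforce
    then have "0 < real (card M)" using M(1) by (simp add: card_gt_0_iff)
    then show ?thesis by (simp add: ln_mult)
  qed
  finally have *: "\<theta> * (\<Sum>j<t. (\<Sum>X\<in>XX. bs (f X) j (col X j)) / ?N) \<le> ln (card M) + \<theta> * \<epsilon> * t" .
  have "(\<Sum>j<t. (\<Sum>X\<in>XX. bs (f X) j (col X j)) / ?N) \<le> \<epsilon> * t + ln (card M) / \<theta>"
  proof -
    have "\<theta> * (\<epsilon> * t + ln (card M) / \<theta>) = ln (card M) + \<theta> * \<epsilon> * t" using \<theta> by (simp add: distrib_left)
    then have "\<theta> * (\<Sum>j<t. (\<Sum>X\<in>XX. bs (f X) j (col X j)) / ?N) \<le> \<theta> * (\<epsilon> * t + ln (card M) / \<theta>)"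
      using * by (simp only:)
    then show ?thesis using \<theta> by (simp only: mult_le_cancel_left_pos)
  qed
  then have "(\<Sum>j<t. (\<Sum>X\<in>XX. bs (f X) j (col X j)) / ?N) / t \<le> (\<epsilon> * t + ln (card M) / \<theta>) / t"
    by (intro divide_right_mono) auto
  also have "\<dots> = \<epsilon> + ln (card M) / (\<theta> * t)" using t_pos by (simp add: add_divide_distrib)
  finally have fin: "(\<Sum>j<t. (\<Sum>X\<in>XX. bs (f X) j (col X j)) / ?N) / t \<le> \<epsilon> + ln (card M) / (\<theta> * t)" .
  have "(\<Sum>j<t. (\<Sum>(X, U)\<in>inst j. g (f X) j U) / card (inst j))
      = (\<Sum>j<t. (\<Sum>U\<in>?S j. (\<Sum>X\<in>XX. g (f X) j U) / ?N) / card (?S j)) + (\<Sum>j<t. (\<Sum>X\<in>XX. bs (f X) j (col X j)) / ?N)"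
    unfolding sum.distrib[symmetric] by (intro sum.cong refl diff) simp
  then show ?thesis using fin by (simp add: add_divide_distrib)
qed

end

section \<open>Parities along augmenting paths\<close>

text \<open>With a Boolean in place of the two constructors, an edge encoding the bit b acts on
  copies as exclusive or with b.\<close>

definition copy_of :: "bool \<Rightarrow> rs_vertex \<Rightarrow> enc_vertex" where
  "copy_of b v = (if b then BV v else AV v)"

lemma copy_of_eq_iff [simp]: "copy_of b v = copy_of c w \<longleftrightarrow> b = c \<and> v = w"
  by (auto simp: copy_of_def)

abbreviation rs_left :: "rs_graph \<Rightarrow> nat \<Rightarrow> nat set" where
  "rs_left G j \<equiv> fst ` rs_matching G j"

abbreviation rs_codes :: "rs_graph \<Rightarrow> (nat \<times> nat \<Rightarrow> bool) set" where
  "rs_codes G \<equiv> ({..<rs_r G} \<times> {..<rs_t G}) \<rightarrow>\<^sub>E UNIV"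

text \<open>The column is kept as a set of left vertices rather than of edge numbers, so that it
  lives on the same ground set as the sequences.\<close>

definition rs_column :: "rs_graph \<Rightarrow> (nat \<times> nat \<Rightarrow> bool) \<Rightarrow> nat \<Rightarrow> nat set" where
  "rs_column G X j = (\<lambda>i. fst (rs_edge G i j)) ` {i. i < rs_r G \<and> X (i, j)}"

lemma enc_edge_alt: "enc_edge b e = (\<lambda>c. {copy_of c (LV (fst e)), copy_of (c \<noteq> b) (RV (snd e))}) ` UNIV"
  by (auto simp: enc_edge_def copy_of_def UNIV_bool)

lemma valid_seqs_iff: "valid_seqs G j l k U \<longleftrightarrow> U \<in> seqs (rs_left G j) l k"
  by (simp add: valid_seqs_def seqs_def)

lemma seqs_last_inj:
  assumes U: "U \<in> seqs I l k" and k: "1 \<le> k" and ij: "i < l" "i' < l" and eq: "last (U ! i) = last (U ! i')"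
  shows "i = i'"
proof (rule ccontr)
  assume "i \<noteq> i'"
  then have "set (U ! i) \<inter> set (U ! i') = {}" by (rule seqs_disjoint[OF U ij])
  moreover have "last (U ! i) \<in> set (U ! i)" "last (U ! i') \<in> set (U ! i')"
    using seqs_nth(3)[OF U ij(1)] seqs_nth(3)[OF U ij(2)] k by (metis last_in_set list.size(3) not_one_le_zero)+
  ultimately show False using eq by auto
qed

section \<open>Partners, encoded edges and alternating walks within one matching\<close>

locale rs_column_data =
  fixes G :: rs_graph and j :: nat
  assumes rs: "is_rs_graph G" and j: "j < rs_t G"
begin

lemma inj_edge: "inj_on (\<lambda>i. rs_edge G i j) {..<rs_r G}"
  and inj_fst: "inj_on fst (rs_matching G j)" and inj_snd: "inj_on snd (rs_matching G j)"
  using rs j by (auto simp: is_rs_graph_def induced_matching_def bip_matching_def)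

lemma inj_left: "inj_on (\<lambda>i. fst (rs_edge G i j)) {..<rs_r G}"
  using comp_inj_on[OF inj_edge, of fst] inj_fst by (simp add: rs_matching_def comp_def)

lemma finite_left: "finite (rs_left G j)" and card_left: "card (rs_left G j) = rs_r G"
proof -
  have "rs_left G j = (\<lambda>i. fst (rs_edge G i j)) ` {..<rs_r G}"
    by (simp add: rs_matching_def image_image)
  then show "finite (rs_left G j)" "card (rs_left G j) = rs_r G"
    using card_image[OF inj_left] by simp_all
qed

abbreviation mt :: "nat \<Rightarrow> nat" where
  "mt \<equiv> mate (rs_matching G j)"

lemma mate_edge:
  assumes "e \<in> rs_matching G j"
  shows "mt (fst e) = snd e"
  unfolding mate_def
proof (rule the_equality)
  show "(fst e, snd e) \<in> rs_matching G j" using assms by simp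
  fix v assume "(fst e, v) \<in> rs_matching G j"
  then have "(fst e, v) = e" using assms inj_onD[OF inj_fst, of "(fst e, v)" e] by simp
  then show "v = snd e" by (metis snd_conv)
qed

lemma mate_inj: "inj_on mt (rs_left G j)"
proof (rule inj_onI)
  fix u u' assume "u \<in> rs_left G j" "u' \<in> rs_left G j" and eq: "mt u = mt u'"
  then obtain e e' where "e \<in> rs_matching G j" "u = fst e" "e' \<in> rs_matching G j" "u' = fst e'" by blast
  then show "u = u'" using eq mate_edge inj_onD[OF inj_snd, of e e'] by auto
qed

lemma edge_in_matching: "i < rs_r G \<Longrightarrow> rs_edge G i j \<in> rs_matching G j"
  by (simp add: rs_matching_def)

lemma in_column_iff: "i < rs_r G \<Longrightarrow> fst (rs_edge G i j) \<in> rs_column G X j \<longleftrightarrow> X (i, j)"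
  unfolding rs_column_def using inj_onD[OF inj_left] by fastforce

lemma rep_alt: "rep G X j = {{copy_of c (LV u), copy_of (c \<noteq> (u \<in> rs_column G X j)) (RV (mt u))} | c u. u \<in> rs_left G j}"
proof -
  have 1: "enc_edge (X (i, j)) (rs_edge G i j) = (\<lambda>c. {copy_of c (LV u), copy_of (c \<noteq> (u \<in> rs_column G X j)) (RV (mt u))}) ` UNIV"
    if "i < rs_r G" "u = fst (rs_edge G i j)" for i u
    unfolding enc_edge_alt that(2) using in_column_iff[OF that(1), of X] mate_edge[OF edge_in_matching[OF that(1)]]
    by simp
  have "rep G X j = (\<Union>i<rs_r G. (\<lambda>c. {copy_of c (LV (fst (rs_edge G i j))),
      copy_of (c \<noteq> (fst (rs_edge G i j) \<in> rs_column G X j)) (RV (mt (fst (rs_edge G i j))))}) ` UNIV)"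
    unfolding rep_def using 1 by (intro SUP_cong) auto
  then show ?thesis by (auto simp: rs_matching_def)
qed

lemma Union_rep: "\<Union>(rep G X j) = {copy_of c (LV u) | c u. u \<in> rs_left G j} \<union> {copy_of c (RV (mt u)) | c u. u \<in> rs_left G j}"
proof -
  have "copy_of c (RV (mt u)) \<in> \<Union>(rep G X j)" if "u \<in> rs_left G j" for c u
  proof -
    have "{copy_of (c \<noteq> (u \<in> rs_column G X j)) (LV u), copy_of ((c \<noteq> (u \<in> rs_column G X j)) \<noteq> (u \<in> rs_column G X j)) (RV (mt u))} \<in> rep G X j"
      unfolding rep_alt using that by blast
    moreover have "((c \<noteq> (u \<in> rs_column G X j)) \<noteq> (u \<in> rs_column G X j)) = c" by blast
    ultimately have "{copy_of (c \<noteq> (u \<in> rs_column G X j)) (LV u), copy_of c (RV (mt u))} \<in> rep G X j"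
      by (simp only:)
    then show ?thesis by blast
  qed
  moreover have "copy_of c (LV u) \<in> \<Union>(rep G X j)" if "u \<in> rs_left G j" for c u
    unfolding rep_alt using that by blast
  moreover have "\<Union>(rep G X j) \<subseteq> {copy_of c (LV u) | c u. u \<in> rs_left G j} \<union> {copy_of c (RV (mt u)) | c u. u \<in> rs_left G j}"
    unfolding rep_alt by blast
  ultimately show ?thesis by blast
qed

lemma follow_rep:
  assumes u: "u \<in> rs_left G j"
  shows "follow (rep G X j) (copy_of b (LV u)) = copy_of (b \<noteq> (u \<in> rs_column G X j)) (RV (mt u))"
  unfolding follow_def
proof (rule the_equality)
  show "{copy_of b (LV u), copy_of (b \<noteq> (u \<in> rs_column G X j)) (RV (mt u))} \<in> rep G X j"
    unfolding rep_alt using u by blast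
  fix w assume "{copy_of b (LV u), w} \<in> rep G X j"
  then obtain c u' where "{copy_of b (LV u), w} = {copy_of c (LV u'), copy_of (c \<noteq> (u' \<in> rs_column G X j)) (RV (mt u'))}"
    unfolding rep_alt by blast
  then show "w = copy_of (b \<noteq> (u \<in> rs_column G X j)) (RV (mt u))"
    by (auto simp: doubleton_eq_iff)
qed

lemma augmenting_edges_alt:
  "augmenting_edges G j us = {{copy_of c (RV (mt (us ! i))), copy_of c (LV (us ! Suc i))} | c i. Suc i < length us}"
proof -
  have "{..<length us - 1} = {i. Suc i < length us}" by auto
  then have "augmenting_edges G j us = (\<Union>i\<in>{i. Suc i < length us}.
      (\<lambda>c. {copy_of c (RV (mt (us ! i))), copy_of c (LV (us ! Suc i))}) ` UNIV)"
    unfolding augmenting_edges_def by (intro SUP_cong) (auto simp: Let_def copy_of_def UNIV_bool)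
  then show ?thesis by blast
qed

lemma follow_augmenting:
  assumes us: "distinct us" "set us \<subseteq> rs_left G j" and i: "Suc i < length us"
  shows "follow (augmenting_edges G j us) (copy_of b (RV (mt (us ! i)))) = copy_of b (LV (us ! Suc i))"
  unfolding follow_def
proof (rule the_equality)
  show "{copy_of b (RV (mt (us ! i))), copy_of b (LV (us ! Suc i))} \<in> augmenting_edges G j us"
    unfolding augmenting_edges_alt using i by blast
  fix w assume "{copy_of b (RV (mt (us ! i))), w} \<in> augmenting_edges G j us"
  then obtain c i' where i': "Suc i' < length us"
    and eq: "{copy_of b (RV (mt (us ! i))), w} = {copy_of c (RV (mt (us ! i'))), copy_of c (LV (us ! Suc i'))}"
    unfolding augmenting_edges_alt by blast
  from eq have "b = c" "mt (us ! i) = mt (us ! i')" "w = copy_of c (LV (us ! Suc i'))"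
    by (auto simp: doubleton_eq_iff)
  moreover have "i = i'"
  proof -
    have "us ! i \<in> rs_left G j" "us ! i' \<in> rs_left G j" using us(2) i i' by (meson Suc_lessD nth_mem subsetD)+
    then have "us ! i = us ! i'" using inj_onD[OF mate_inj \<open>mt (us ! i) = mt (us ! i')\<close>] by blast
    then show ?thesis using us(1) i i' by (simp add: nth_eq_iff_index_eq)
  qed
  ultimately show "w = copy_of b (LV (us ! Suc i))" by simp
qed

lemma walk_nonempty [simp]: "alternating_walk n M N w \<noteq> []"
  by (cases n) auto

text \<open>An edge of \<open>rep\<close> switches the copy exactly when its bit is 1, and an
  augmenting edge keeps it. The walk has \<open>n + 1\<close> edges of the first kind and
  \<open>n\<close> of the second; the start \<open>i\<close> and the copy \<open>b\<close> are
  general for the sake of the induction.\<close>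

lemma last_walk:
  assumes us: "distinct us" "set us \<subseteq> rs_left G j" and i: "i + Suc n = length us"
  shows "last (alternating_walk (Suc (2 * n)) (rep G X j) (augmenting_edges G j us) (copy_of b (LV (us ! i))))
    = copy_of (b \<noteq> odd (card (set (drop i us) \<inter> rs_column G X j))) (RV (mt (last us)))"
  using i
proof (induction n arbitrary: i b)
  case 0
  then have "us \<noteq> []" "i = length us - 1" by auto
  then have "last us = us ! i" "drop i us = [us ! i]"
    by (auto simp: last_conv_nth Cons_nth_drop_Suc[symmetric])
  moreover have "us ! i \<in> rs_left G j" using us(2) 0 by (intro subsetD[OF us(2)] nth_mem) simp
  ultimately show ?case by (simp add: follow_rep Int_insert_left)
next
  case (Suc n)
  let ?u = "us ! i" and ?C = "rs_column G X j"
  have i: "i < length us" "Suc i < length us" using Suc.prems by auto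
  have u: "?u \<in> rs_left G j" using i by (intro subsetD[OF us(2)] nth_mem)
  have dr: "drop i us = ?u # drop (Suc i) us" using i by (simp add: Cons_nth_drop_Suc)
  have nin: "?u \<notin> set (drop (Suc i) us)" using us(1) distinct_drop[of us i] unfolding dr by simp
  have par: "odd (card (set (drop i us) \<inter> ?C)) \<longleftrightarrow> ((?u \<in> ?C) \<noteq> odd (card (set (drop (Suc i) us) \<inter> ?C)))"
    unfolding dr using nin by (simp add: Int_insert_left)
  have "last (alternating_walk (Suc (2 * Suc n)) (rep G X j) (augmenting_edges G j us) (copy_of b (LV ?u)))
      = last (alternating_walk (Suc (2 * n)) (rep G X j) (augmenting_edges G j us)
          (copy_of (b \<noteq> (?u \<in> ?C)) (LV (us ! Suc i))))"
    by (simp add: follow_rep[OF u] follow_augmenting[OF us i(2)])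
  also have "\<dots> = copy_of ((b \<noteq> (?u \<in> ?C)) \<noteq> odd (card (set (drop (Suc i) us) \<inter> ?C))) (RV (mt (last us)))"
    by (rule Suc.IH) (use Suc.prems in simp)
  also have "((b \<noteq> (?u \<in> ?C)) \<noteq> odd (card (set (drop (Suc i) us) \<inter> ?C))) \<longleftrightarrow> (b \<noteq> odd (card (set (drop i us) \<inter> ?C)))"
    unfolding par by blast
  finally show ?case .
qed

lemma aug_end_eq_target_iff:
  assumes us: "distinct us" "set us \<subseteq> rs_left G j" "us \<noteq> []"
  shows "aug_end G X j us = aug_target G j us \<longleftrightarrow> even (card (set us \<inter> rs_column G X j))"
proof -
  define n where "n = length us - 1"
  have n: "0 + Suc n = length us" "2 * length us - 1 = Suc (2 * n)" using us(3) by (cases us; simp add: n_def)+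
  have "aug_start us = copy_of False (LV (us ! 0))" using us(3) by (simp add: aug_start_def copy_of_def hd_conv_nth)
  then have "aug_end G X j us = copy_of (odd (card (set us \<inter> rs_column G X j))) (RV (mt (last us)))"
    using last_walk[OF us(1,2) n(1), of X False] by (simp only: aug_end_def aug_path_def n(2)) simp
  moreover have "aug_target G j us = copy_of False (RV (mt (last us)))" by (simp add: aug_target_def copy_of_def)
  ultimately show ?thesis by simp
qed

text \<open>This is the form in which the graph-free analysis applies: the condition on targets
  becomes a parity condition on each block.\<close>

lemma aug_instances_eq:
  assumes k: "1 \<le> k"
  shows "aug_instances G Y l k j = {(X, U). X \<in> rs_codes G \<and> U \<in> seqs (rs_left G j) l k \<and>
    (\<forall>i<l. odd (card (set (U ! i) \<inter> rs_column G X j)) = Y i)}"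
proof -
  have "(\<forall>i<l. aug_target G j (U ! i) \<in> (if Y i then aug_bar_set G X j U else aug_set G X j U))
      \<longleftrightarrow> (\<forall>i<l. odd (card (set (U ! i) \<inter> rs_column G X j)) = Y i)" if U: "U \<in> seqs (rs_left G j) l k" for X U
  proof -
    have nth: "distinct (U ! i)" "set (U ! i) \<subseteq> rs_left G j" "U ! i \<noteq> []" if "i < l" for i
      using seqs_nth[OF U that] k by auto
    have len: "length U = l" using U by (simp add: seqs_def)
    \<comment> \<open>Membership in \<open>aug_set\<close> only asks for some sequence with the
      given target. Disjoint sequences have distinct last vertices and partners are injective, so
      that sequence is the i-th one.\<close>
    have uniq: "us = U ! i"
      if i: "i < l" and us: "us \<in> set U" and eq: "aug_target G j us = aug_target G j (U ! i)" for i us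
    proof -
      obtain i' where i': "i' < l" "us = U ! i'" using us len by (metis in_set_conv_nth)
      have "mt (last us) = mt (last (U ! i))" using eq by (simp add: aug_target_def)
      moreover have "last us \<in> rs_left G j" "last (U ! i) \<in> rs_left G j"
        using nth[OF i'(1)] nth[OF i] i'(2) last_in_set[of us] last_in_set[of "U ! i"] by blast+
      ultimately have "last (U ! i') = last (U ! i)" using inj_onD[OF mate_inj] i'(2) by blast
      then show ?thesis using seqs_last_inj[OF U k i'(1) i] i'(2) by simp
    qed
    have mem: "U ! i \<in> set U" if "i < l" for i using that len by simp
    have "aug_target G j (U ! i) \<in> aug_set G X j U \<longleftrightarrow> even (card (set (U ! i) \<inter> rs_column G X j))"
      "aug_target G j (U ! i) \<in> aug_bar_set G X j U \<longleftrightarrow> odd (card (set (U ! i) \<inter> rs_column G X j))" if i: "i < l" for i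
      using uniq[OF i] mem[OF i] aug_end_eq_target_iff[OF nth[OF i], of X]
      unfolding aug_set_def aug_bar_set_def mem_Collect_eq by metis+
    then show ?thesis by auto
  qed
  then show ?thesis unfolding aug_instances_def valid_seqs_iff by blast
qed

text \<open>Whatever the bits, \<open>rep\<close> covers both copies of every vertex of the
  matching, so the vertices matched to \<open>PV\<close> are the same. Hence the second-phase graph
  is a function of the sequences and \<open>j\<close>, as the hiding bound requires of a
  test.\<close>

lemma ag_rest_code_independent: "ag_rest (aug_graph_of G X j U) = ag_rest (aug_graph_of G X' j U)"
  by (simp add: aug_graph_of_def Union_rep)

end

lemma rs_columns_bij:
  assumes rs: "is_rs_graph G"
  shows "bij_betw (\<lambda>X. \<lambda>j\<in>{..<rs_t G}. rs_column G X j) (rs_codes G) (PiE {..<rs_t G} (\<lambda>j. Pow (rs_left G j)))"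
proof (rule bij_betw_byWitness[where f' = "\<lambda>h. \<lambda>(i, j)\<in>{..<rs_r G} \<times> {..<rs_t G}. fst (rs_edge G i j) \<in> h j"])
  have cd: "rs_column_data G j" if "j < rs_t G" for j using rs that by unfold_locales
  show "\<forall>X\<in>rs_codes G. (\<lambda>(i, j)\<in>{..<rs_r G} \<times> {..<rs_t G}. fst (rs_edge G i j) \<in> (\<lambda>j\<in>{..<rs_t G}. rs_column G X j) j) = X"
  proof
    fix X assume X: "X \<in> rs_codes G"
    show "(\<lambda>(i, j)\<in>{..<rs_r G} \<times> {..<rs_t G}. fst (rs_edge G i j) \<in> (\<lambda>j\<in>{..<rs_t G}. rs_column G X j) j) = X"
    proof (rule extensionalityI[of _ "{..<rs_r G} \<times> {..<rs_t G}"])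
      show "X \<in> extensional ({..<rs_r G} \<times> {..<rs_t G})" using X by (simp add: PiE_def)
      fix p assume "p \<in> {..<rs_r G} \<times> {..<rs_t G}"
      then obtain i j where "p = (i, j)" "i < rs_r G" "j < rs_t G" by auto
      then show "(\<lambda>(i, j)\<in>{..<rs_r G} \<times> {..<rs_t G}. fst (rs_edge G i j) \<in> (\<lambda>j\<in>{..<rs_t G}. rs_column G X j) j) p = X p"
        using rs_column_data.in_column_iff[OF cd] by simp
    qed simp
  qed
  show "\<forall>h\<in>PiE {..<rs_t G} (\<lambda>j. Pow (rs_left G j)). (\<lambda>j\<in>{..<rs_t G}. rs_column G
      (\<lambda>(i, j)\<in>{..<rs_r G} \<times> {..<rs_t G}. fst (rs_edge G i j) \<in> h j) j) = h"
  proof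
    fix h assume h: "h \<in> PiE {..<rs_t G} (\<lambda>j. Pow (rs_left G j))"
    show "(\<lambda>j\<in>{..<rs_t G}. rs_column G
      (\<lambda>(i, j)\<in>{..<rs_r G} \<times> {..<rs_t G}. fst (rs_edge G i j) \<in> h j) j) = h"
    proof (rule extensionalityI[of _ "{..<rs_t G}"])
      show "h \<in> extensional {..<rs_t G}" using h by (simp add: PiE_def)
      fix j assume j: "j \<in> {..<rs_t G}"
      have "h j \<subseteq> rs_left G j" using h j by (auto simp: PiE_def Pi_def)
      then show "(\<lambda>j\<in>{..<rs_t G}. rs_column G
        (\<lambda>(i, j)\<in>{..<rs_r G} \<times> {..<rs_t G}. fst (rs_edge G i j) \<in> h j) j) j = h j"
        using j by (auto simp: rs_column_def rs_matching_def)
    qed simp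
  qed
  show "(\<lambda>X. \<lambda>j\<in>{..<rs_t G}. rs_column G X j) ` rs_codes G \<subseteq> PiE {..<rs_t G} (\<lambda>j. Pow (rs_left G j))"
    by (auto simp: rs_column_def rs_matching_def)
  show "(\<lambda>h. \<lambda>(i, j)\<in>{..<rs_r G} \<times> {..<rs_t G}. fst (rs_edge G i j) \<in> h j) ` PiE {..<rs_t G} (\<lambda>j. Pow (rs_left G j)) \<subseteq> rs_codes G"
    by auto
qed

lemma rs_columns:
  assumes "is_rs_graph G" "0 < rs_t G" "1 \<le> k" "k * l \<le> rs_r G"
  shows "columns (rs_t G) (rs_left G) (rs_r G) l k (rs_codes G) (rs_column G)"
proof
  fix j assume "j < rs_t G"
  then interpret rs_column_data G j using assms by unfold_locales
  show "finite (rs_left G j) \<and> card (rs_left G j) = rs_r G" using finite_left card_left by simp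
qed (use assms rs_columns_bij in auto)

section \<open>Expectations under finitely supported distributions\<close>

lemma expectation_bind_finite:
  fixes h :: "'b \<Rightarrow> real"
  assumes "finite (set_pmf p)" "\<And>x. x \<in> set_pmf p \<Longrightarrow> finite (set_pmf (q x))"
  shows "measure_pmf.expectation (bind_pmf p q) h = measure_pmf.expectation p (\<lambda>x. measure_pmf.expectation (q x) h)"
  using assms by (subst pmf_expectation_bind[of "set_pmf p"]) (simp_all add: integral_measure_pmf[of "set_pmf p"])

lemma expectation_swap_finite:
  fixes h :: "'a \<Rightarrow> 'b \<Rightarrow> real"
  assumes "finite (set_pmf p)" "finite (set_pmf q)"
  shows "measure_pmf.expectation p (\<lambda>x. measure_pmf.expectation q (h x))
    = measure_pmf.expectation q (\<lambda>y. measure_pmf.expectation p (\<lambda>x. h x y))"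
  using assms
  by (simp add: integral_measure_pmf[of "set_pmf p"] integral_measure_pmf[of "set_pmf q"]
      sum_distrib_left sum.swap[of _ "set_pmf q" "set_pmf p"] mult.left_commute)

lemma expectation_mono_finite:
  fixes f g :: "'a \<Rightarrow> real"
  assumes "finite (set_pmf p)" "\<And>x. x \<in> set_pmf p \<Longrightarrow> f x \<le> g x"
  shows "measure_pmf.expectation p f \<le> measure_pmf.expectation p g"
  using assms by (intro integral_mono_AE integrable_measure_pmf_finite AE_pmfI) auto

lemma expectation_add_const_finite:
  fixes f :: "'a \<Rightarrow> real"
  assumes "finite (set_pmf p)"
  shows "measure_pmf.expectation p (\<lambda>x. f x + c) = measure_pmf.expectation p f + c"
  using assms by (simp add: integrable_measure_pmf_finite Bochner_Integration.integral_add)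

text \<open>The sampling of \<open>D_aug\<close> without the parity conditions. No \<open>Y\<close>
  occurs, so a graph drawn from it carries no information on the hidden index.\<close>

definition D_free :: "rs_graph \<Rightarrow> nat \<Rightarrow> nat \<Rightarrow> aug_graph pmf" where
  "D_free G l k =
     do {
       j \<leftarrow> pmf_of_set {..<rs_t G};
       U \<leftarrow> pmf_of_set (seqs (rs_left G j) l k);
       X \<leftarrow> pmf_of_set (rs_codes G);
       return_pmf (aug_graph_of G X j U)
     }"

section \<open>Transfer of the hiding bound to augmentation graphs\<close>

locale rs_blocks =
  fixes G :: rs_graph and l k :: nat
  assumes is_rs: "is_rs_graph G" and t_pos: "0 < rs_t G" and k1: "1 \<le> k" and fit: "k * l \<le> rs_r G"
begin

lemma columns: "columns (rs_t G) (rs_left G) (rs_r G) l k (rs_codes G) (rs_column G)"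
  by (intro rs_columns is_rs t_pos k1 fit)

lemma aug_instances_inst:
  assumes "j < rs_t G"
  shows "aug_instances G Y l k j = columns.inst (rs_left G) l k (rs_codes G) (rs_column G) Y j"
proof -
  interpret rs_column_data G j using is_rs assms by unfold_locales
  show ?thesis unfolding aug_instances_eq[OF k1] columns.inst_def[OF columns] by simp
qed

lemma aug_instances_finite_nonempty:
  assumes "j < rs_t G"
  shows "finite (aug_instances G Y l k j)" "aug_instances G Y l k j \<noteq> {}"
  unfolding aug_instances_inst[OF assms]
  using columns.finite_inst[OF columns assms] columns.inst_nonempty[OF columns assms] by auto

lemma lessThan_t: "{..<rs_t G} \<noteq> {}" "finite {..<rs_t G}"
  using t_pos by auto

lemma finite_D_aug: "finite (set_pmf (D_aug G Y l k))"
  unfolding D_aug_def using lessThan_t aug_instances_finite_nonempty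
  by (auto simp: set_pmf_of_set split: prod.split)

lemma seqs_finite_nonempty:
  assumes "j < rs_t G"
  shows "finite (seqs (rs_left G j) l k)" "seqs (rs_left G j) l k \<noteq> {}"
proof -
  interpret rs_column_data G j using is_rs assms by unfold_locales
  show "finite (seqs (rs_left G j) l k)" "seqs (rs_left G j) l k \<noteq> {}"
    using finite_seqs[OF finite_left] seqs_nonempty[OF finite_left] fit card_left by auto
qed

lemma codes_finite_nonempty: "finite (rs_codes G)" "rs_codes G \<noteq> {}"
  by (auto intro!: finite_PiE simp: PiE_eq_empty_iff)

lemma finite_D_free: "finite (set_pmf (D_free G l k))"
  unfolding D_free_def using lessThan_t seqs_finite_nonempty codes_finite_nonempty
  by (auto simp: set_pmf_of_set)

lemma expectation_D_aug:
  fixes h :: "aug_graph \<Rightarrow> real"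
  shows "measure_pmf.expectation (D_aug G Y l k) h
    = (\<Sum>j<rs_t G. (\<Sum>(X, U)\<in>aug_instances G Y l k j. h (aug_graph_of G X j U)) / card (aug_instances G Y l k j)) / rs_t G"
proof -
  have "measure_pmf.expectation (D_aug G Y l k) h
      = measure_pmf.expectation (pmf_of_set {..<rs_t G}) (\<lambda>j. measure_pmf.expectation
          (do { (X, U) \<leftarrow> pmf_of_set (aug_instances G Y l k j); return_pmf (aug_graph_of G X j U) }) h)"
    unfolding D_aug_def using lessThan_t aug_instances_finite_nonempty
    by (intro expectation_bind_finite) (auto simp: set_pmf_of_set split: prod.split)
  also have "\<dots> = (\<Sum>j<rs_t G. measure_pmf.expectation
          (do { (X, U) \<leftarrow> pmf_of_set (aug_instances G Y l k j); return_pmf (aug_graph_of G X j U) }) h) / rs_t G"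
    using lessThan_t by (simp add: integral_pmf_of_set)
  also have "(\<Sum>j<rs_t G. measure_pmf.expectation
          (do { (X, U) \<leftarrow> pmf_of_set (aug_instances G Y l k j); return_pmf (aug_graph_of G X j U) }) h)
      = (\<Sum>j<rs_t G. (\<Sum>(X, U)\<in>aug_instances G Y l k j. h (aug_graph_of G X j U)) / card (aug_instances G Y l k j))"
  proof (intro sum.cong refl)
    fix j assume "j \<in> {..<rs_t G}"
    then have fn: "finite (aug_instances G Y l k j)" "aug_instances G Y l k j \<noteq> {}"
      using aug_instances_finite_nonempty by auto
    then show "measure_pmf.expectation
          (do { (X, U) \<leftarrow> pmf_of_set (aug_instances G Y l k j); return_pmf (aug_graph_of G X j U) }) h
        = (\<Sum>(X, U)\<in>aug_instances G Y l k j. h (aug_graph_of G X j U)) / card (aug_instances G Y l k j)"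
      by (subst expectation_bind_finite) (auto simp: integral_pmf_of_set case_prod_beta split: prod.split)
  qed
  finally show ?thesis .
qed

lemma expectation_D_free:
  fixes h :: "aug_graph \<Rightarrow> real"
  shows "measure_pmf.expectation (D_free G l k) h
    = (\<Sum>j<rs_t G. (\<Sum>U\<in>seqs (rs_left G j) l k. (\<Sum>X\<in>rs_codes G. h (aug_graph_of G X j U)) / card (rs_codes G))
        / card (seqs (rs_left G j) l k)) / rs_t G"
proof -
  have X: "measure_pmf.expectation (do { X \<leftarrow> pmf_of_set (rs_codes G); return_pmf (aug_graph_of G X j U) }) h
      = (\<Sum>X\<in>rs_codes G. h (aug_graph_of G X j U)) / card (rs_codes G)" for j U
    using codes_finite_nonempty by (subst expectation_bind_finite) (simp_all add: integral_pmf_of_set)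
  have "measure_pmf.expectation (D_free G l k) h
      = measure_pmf.expectation (pmf_of_set {..<rs_t G}) (\<lambda>j. measure_pmf.expectation
          (do { U \<leftarrow> pmf_of_set (seqs (rs_left G j) l k); X \<leftarrow> pmf_of_set (rs_codes G); return_pmf (aug_graph_of G X j U) }) h)"
    unfolding D_free_def using lessThan_t seqs_finite_nonempty codes_finite_nonempty
    by (intro expectation_bind_finite) (auto simp: set_pmf_of_set)
  also have "\<dots> = (\<Sum>j<rs_t G. measure_pmf.expectation
          (do { U \<leftarrow> pmf_of_set (seqs (rs_left G j) l k); X \<leftarrow> pmf_of_set (rs_codes G); return_pmf (aug_graph_of G X j U) }) h) / rs_t G"
    using lessThan_t by (simp add: integral_pmf_of_set)
  also have "(\<Sum>j<rs_t G. measure_pmf.expectation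
          (do { U \<leftarrow> pmf_of_set (seqs (rs_left G j) l k); X \<leftarrow> pmf_of_set (rs_codes G); return_pmf (aug_graph_of G X j U) }) h)
      = (\<Sum>j<rs_t G. (\<Sum>U\<in>seqs (rs_left G j) l k. (\<Sum>X\<in>rs_codes G. h (aug_graph_of G X j U)) / card (rs_codes G))
        / card (seqs (rs_left G j) l k))"
  proof (intro sum.cong refl)
    fix j assume "j \<in> {..<rs_t G}"
    then have fn: "finite (seqs (rs_left G j) l k)" "seqs (rs_left G j) l k \<noteq> {}"
      using seqs_finite_nonempty by auto
    have "measure_pmf.expectation
          (do { U \<leftarrow> pmf_of_set (seqs (rs_left G j) l k); X \<leftarrow> pmf_of_set (rs_codes G); return_pmf (aug_graph_of G X j U) }) h
        = measure_pmf.expectation (pmf_of_set (seqs (rs_left G j) l k)) (\<lambda>U. measure_pmf.expectation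
          (do { X \<leftarrow> pmf_of_set (rs_codes G); return_pmf (aug_graph_of G X j U) }) h)"
      using fn codes_finite_nonempty by (intro expectation_bind_finite) (auto simp: set_pmf_of_set)
    then show "measure_pmf.expectation
          (do { U \<leftarrow> pmf_of_set (seqs (rs_left G j) l k); X \<leftarrow> pmf_of_set (rs_codes G); return_pmf (aug_graph_of G X j U) }) h
        = (\<Sum>U\<in>seqs (rs_left G j) l k. (\<Sum>X\<in>rs_codes G. h (aug_graph_of G X j U)) / card (rs_codes G))
        / card (seqs (rs_left G j) l k)"
      unfolding X integral_pmf_of_set[OF fn(2,1)] .
  qed
  finally show ?thesis .
qed

text \<open>The shape of the test is what matters: \<open>g\<close> may read the remaining edges and
  the targets in full, but the encoded edges only through the message \<open>f\<close>.\<close>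

lemma hiding_D_aug:
  fixes g :: "'m \<Rightarrow> aug_vertex set set \<Rightarrow> aug_vertex list \<Rightarrow> real" and \<theta> \<epsilon> :: real
  assumes g: "\<And>\<mu> E T. 0 \<le> g \<mu> E T" "\<And>\<mu> E T. g \<mu> E T \<le> 1"
    and M: "finite M" "\<And>H. f H \<in> M" and \<theta>: "0 < \<theta>"
    and moment: "\<And>(I :: nat set) y w. random_blocks I l k y w \<Longrightarrow> card I = rs_r G \<Longrightarrow>
      (\<forall>x\<in>Pow I. random_blocks.bias I l k y w x \<le> 1) \<Longrightarrow>
      cube_avg I (\<lambda>x. exp (\<theta> * random_blocks.bias I l k y w x)) \<le> exp (\<theta> * \<epsilon>)"
  shows "measure_pmf.expectation (D_aug G Y l k) (\<lambda>A. g (f (ag_enc A)) (ag_rest A) (ag_targets A))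
    \<le> measure_pmf.expectation (D_free G l k) (\<lambda>A. g (f (ag_enc A)) (ag_rest A) (ag_targets A))
      + \<epsilon> + ln (card M) / (\<theta> * rs_t G)"
proof -
  define ff where "ff X = f ((`) HV ` encoded_rs G X)" for X
  \<comment> \<open>The constant code is a placeholder, as neither the remaining edges nor the
    targets depend on the code.\<close>
  define gg where "gg \<mu> j U = g \<mu> (ag_rest (aug_graph_of G (\<lambda>_. False) j U)) (ag_targets (aug_graph_of G (\<lambda>_. False) j U))"
    for \<mu> j U
  have eq: "g (f (ag_enc (aug_graph_of G X j U))) (ag_rest (aug_graph_of G X j U)) (ag_targets (aug_graph_of G X j U))
      = gg (ff X) j U" if "j < rs_t G" for X j U
  proof -
    interpret rs_column_data G j using is_rs that by unfold_locales
    have "ag_targets (aug_graph_of G X j U) = ag_targets (aug_graph_of G (\<lambda>_. False) j U)"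
      "ag_enc (aug_graph_of G X j U) = (`) HV ` encoded_rs G X"
      by (simp_all add: aug_graph_of_def)
    then show ?thesis
      using ag_rest_code_independent[of X U "\<lambda>_. False"] by (simp add: gg_def ff_def)
  qed
  have card_left: "card (rs_left G j) = rs_r G" if "j < rs_t G" for j
    using columns that by (simp add: columns_def)
  have "(\<Sum>j<rs_t G. (\<Sum>(X, U)\<in>columns.inst (rs_left G) l k (rs_codes G) (rs_column G) Y j. gg (ff X) j U)
        / card (columns.inst (rs_left G) l k (rs_codes G) (rs_column G) Y j)) / rs_t G
    \<le> (\<Sum>j<rs_t G. (\<Sum>U\<in>seqs (rs_left G j) l k. (\<Sum>X\<in>rs_codes G. gg (ff X) j U) / card (rs_codes G))
        / card (seqs (rs_left G j) l k)) / rs_t G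
      + \<epsilon> + ln (card M) / (\<theta> * rs_t G)"
    using g M \<theta> moment card_left
    by (intro columns.hiding[OF columns]) (auto simp: gg_def ff_def)
  then show ?thesis
    unfolding expectation_D_aug expectation_D_free
    by (simp add: eq aug_instances_inst cong: sum.cong_simp)
qed

end

section \<open>Certified edges of the subsampled graph\<close>

lemma finite_lists_le: "finite {xs :: bool list. length xs \<le> C}"
  using finite_lists_length_le[of "UNIV :: bool set" C] by simp

text \<open>The exact number is 2^(C+1) - 1; the cruder 4^C has a logarithm proportional to C and is
  valid at C = 0 too.\<close>

lemma card_lists_le: "card {xs :: bool list. length xs \<le> C} \<le> 4 ^ C"
proof (induction C)
  case 0
  have "{xs :: bool list. length xs \<le> 0} = {[]}" by auto
  then show ?case by simp
next
  case (Suc C)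
  have "{xs :: bool list. length xs \<le> Suc C} = {xs. length xs \<le> C} \<union> {xs. length xs = Suc C}" by auto
  then have "card {xs :: bool list. length xs \<le> Suc C} \<le> card {xs :: bool list. length xs \<le> C} + card {xs :: bool list. length xs = Suc C}"
    by (metis card_Un_le)
  also have "card {xs :: bool list. length xs = Suc C} = 2 ^ Suc C"
    using card_lists_length_eq[of "UNIV :: bool set" "Suc C"] by simp
  also have "card {xs :: bool list. length xs \<le> C} + 2 ^ Suc C \<le> 4 ^ C + 2 * 4 ^ C"
    using Suc.IH power_mono[of 2 "4 :: nat" C] by simp
  finally show ?case by simp
qed

lemma finite_rs_edges: "finite (rs_edges G)"
  by (simp add: rs_edges_def rs_matching_def)

lemma finite_subsampled: "finite (set_pmf (subsampled_graph \<delta> G))"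
proof (rule finite_subset)
  show "set_pmf (subsampled_graph \<delta> G) \<subseteq> Pow (rs_edges G)"
    by (auto simp: subsampled_graph_def)
  show "finite (Pow (rs_edges G))" using finite_rs_edges by simp
qed

lemma prob_subset_subsampled:
  assumes \<delta>: "0 \<le> \<delta>" "\<delta> \<le> 1" and S: "S \<subseteq> rs_edges G"
  shows "measure_pmf.expectation (subsampled_graph \<delta> G) (\<lambda>A. of_bool (S \<subseteq> A)) = (1 - \<delta>) ^ card S"
proof -
  let ?P = "Pi_pmf (rs_edges G) False (\<lambda>_. bernoulli_pmf (1 - \<delta>))"
  let ?B = "\<lambda>e. if e \<in> S then {True} else UNIV"
  have "measure_pmf.expectation (subsampled_graph \<delta> G) (\<lambda>A. of_bool (S \<subseteq> A))
      = measure_pmf.expectation ?P (\<lambda>kp. indicator (Pi (rs_edges G) ?B) kp :: real)"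
    unfolding subsampled_graph_def integral_map_pmf
    using S by (intro Bochner_Integration.integral_cong refl) (auto simp: indicator_def Pi_def)
  also have "\<dots> = measure_pmf.prob ?P (Pi (rs_edges G) ?B)" by simp
  also have "\<dots> = (\<Prod>e\<in>rs_edges G. measure_pmf.prob (bernoulli_pmf (1 - \<delta>)) (?B e))"
    by (rule measure_Pi_pmf_Pi[OF finite_rs_edges])
  also have "\<dots> = (\<Prod>e\<in>rs_edges G. if e \<in> S then 1 - \<delta> else 1)"
    using \<delta> by (intro prod.cong refl) (simp add: measure_pmf_single)
  also have "\<dots> = (1 - \<delta>) ^ card S"
    using S finite_rs_edges[of G] by (simp add: prod.If_cases Int_absorb1)
  finally show ?thesis .
qed

text \<open>The matchings are edge-disjoint, hence the events that \<open>Q j\<close> survives are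
  independent. The exponential of an indicator is affine in it, so the product expands over the sets
  \<open>J\<close> of surviving indices.\<close>

lemma exp_moment_certified:
  fixes \<theta> \<delta> q :: real and Q :: "nat \<Rightarrow> (nat \<times> nat) set"
  assumes G: "is_rs_graph G" and \<delta>: "0 \<le> \<delta>" "\<delta> \<le> 1" and \<theta>: "0 \<le> \<theta>"
    and Q: "\<And>j. j < rs_t G \<Longrightarrow> Q j \<subseteq> rs_matching G j"
    and q: "\<And>j. j < rs_t G \<Longrightarrow> (1 - \<delta>) ^ card (Q j) \<le> q"
  shows "measure_pmf.expectation (subsampled_graph \<delta> G) (\<lambda>A. exp (\<Sum>j<rs_t G. \<theta> * of_bool (Q j \<subseteq> A)))
    \<le> exp (rs_t G * (exp \<theta> * q))"
proof -
  let ?p = "subsampled_graph \<delta> G" and ?c = "exp \<theta> - 1"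
  have c0: "0 \<le> ?c" using \<theta> by simp
  have Osub: "Q j \<subseteq> rs_edges G" if "j < rs_t G" for j using Q[OF that] that by (auto simp: rs_edges_def)
  have finO: "finite (Q j)" if "j < rs_t G" for j using Osub[OF that] finite_rs_edges finite_subset by blast
  have disj: "Q i \<inter> Q j = {}" if "i < rs_t G" "j < rs_t G" "i \<noteq> j" for i j
    using G Q[OF that(1)] Q[OF that(2)] that unfolding is_rs_graph_def by blast
  have pt: "exp (\<Sum>j<rs_t G. \<theta> * of_bool (Q j \<subseteq> A)) = (\<Sum>J\<in>Pow {..<rs_t G}. ?c ^ card J * of_bool (\<Union>(Q ` J) \<subseteq> A))" for A
  proof -
    have "exp (\<Sum>j<rs_t G. \<theta> * of_bool (Q j \<subseteq> A)) = (\<Prod>j<rs_t G. ?c * of_bool (Q j \<subseteq> A) + 1)"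
      unfolding exp_sum[OF finite_lessThan] by (intro prod.cong) auto
    also have "\<dots> = (\<Sum>J\<in>Pow {..<rs_t G}. \<Prod>j\<in>J. ?c * of_bool (Q j \<subseteq> A))"
      by (subst prod_add) simp_all
    also have "\<dots> = (\<Sum>J\<in>Pow {..<rs_t G}. ?c ^ card J * of_bool (\<Union>(Q ` J) \<subseteq> A))"
    proof (intro sum.cong refl)
      fix J assume "J \<in> Pow {..<rs_t G}"
      then have "finite J" using finite_subset by auto
      then have "(\<Prod>j\<in>J. of_bool (Q j \<subseteq> A) :: real) = of_bool (\<forall>j\<in>J. Q j \<subseteq> A)"
        by (induction J) auto
      then show "(\<Prod>j\<in>J. ?c * of_bool (Q j \<subseteq> A)) = ?c ^ card J * of_bool (\<Union>(Q ` J) \<subseteq> A)"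
        by (simp add: prod.distrib UN_subset_iff)
    qed
    finally show ?thesis .
  qed
  have int: "integrable ?p h" for h :: "_ \<Rightarrow> real" by (rule integrable_measure_pmf_finite[OF finite_subsampled])
  have "measure_pmf.expectation ?p (\<lambda>A. exp (\<Sum>j<rs_t G. \<theta> * of_bool (Q j \<subseteq> A)))
      = (\<Sum>J\<in>Pow {..<rs_t G}. ?c ^ card J * measure_pmf.expectation ?p (\<lambda>A. of_bool (\<Union>(Q ` J) \<subseteq> A)))"
    unfolding pt by (subst Bochner_Integration.integral_sum) (simp_all add: int)
  also have "\<dots> = (\<Sum>J\<in>Pow {..<rs_t G}. \<Prod>j\<in>J. ?c * (1 - \<delta>) ^ card (Q j))"
  proof (intro sum.cong refl)
    fix J assume J: "J \<in> Pow {..<rs_t G}"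
    have "measure_pmf.expectation ?p (\<lambda>A. of_bool (\<Union>(Q ` J) \<subseteq> A)) = (1 - \<delta>) ^ card (\<Union>(Q ` J))"
      using J Osub by (intro prob_subset_subsampled \<delta>) auto
    also have "card (\<Union>(Q ` J)) = (\<Sum>j\<in>J. card (Q j))"
      using J finO disj finite_subset[of J "{..<rs_t G}"] by (intro card_UN_disjoint) (auto simp: subset_eq)
    finally show "?c ^ card J * measure_pmf.expectation ?p (\<lambda>A. of_bool (\<Union>(Q ` J) \<subseteq> A)) = (\<Prod>j\<in>J. ?c * (1 - \<delta>) ^ card (Q j))"
      by (simp add: prod.distrib power_sum)
  qed
  also have "\<dots> = (\<Prod>j<rs_t G. ?c * (1 - \<delta>) ^ card (Q j) + 1)"
    by (subst prod_add) simp_all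
  also have "\<dots> \<le> (\<Prod>j<rs_t G. exp (exp \<theta> * q))"
  proof (intro prod_mono conjI)
    fix j assume "j \<in> {..<rs_t G}"
    then have qj: "0 \<le> (1 - \<delta>) ^ card (Q j)" "(1 - \<delta>) ^ card (Q j) \<le> q" using q \<delta> by auto
    have "?c * (1 - \<delta>) ^ card (Q j) \<le> exp \<theta> * q" using qj c0 by (intro mult_mono) auto
    then show "?c * (1 - \<delta>) ^ card (Q j) + 1 \<le> exp (exp \<theta> * q)"
      using exp_ge_add_one_self[of "exp \<theta> * q"] by linarith
    show "0 \<le> ?c * (1 - \<delta>) ^ card (Q j) + 1" using qj c0 by (intro add_nonneg_nonneg mult_nonneg_nonneg) auto
  qed
  also have "\<dots> = exp (rs_t G * (exp \<theta> * q))" by (simp add: exp_of_nat_mult)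
  finally show ?thesis .
qed

text \<open>A union bound over the values of \<open>f\<close>, for sets that depend on the subgraph
  only through \<open>f\<close>. When \<theta> is proportional to the exponent of decay of q, the
  first term becomes communication divided by the total number of edges.\<close>

lemma certified_edges_bound:
  fixes \<theta> \<delta> q :: real and Q :: "'m \<Rightarrow> nat \<Rightarrow> (nat \<times> nat) set"
  assumes G: "is_rs_graph G" "0 < rs_t G" and \<delta>: "0 \<le> \<delta>" "\<delta> \<le> 1" and \<theta>: "0 < \<theta>"
    and M: "finite M" "\<And>A. f A \<in> M"
    and Q: "\<And>\<mu> j. j < rs_t G \<Longrightarrow> Q \<mu> j \<subseteq> rs_matching G j"
    and q: "\<And>\<mu> j. j < rs_t G \<Longrightarrow> (1 - \<delta>) ^ card (Q \<mu> j) \<le> q"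
  shows "measure_pmf.expectation (subsampled_graph \<delta> G) (\<lambda>A. (\<Sum>j<rs_t G. of_bool (Q (f A) j \<subseteq> A)) / rs_t G)
    \<le> ln (card M) / (\<theta> * rs_t G) + exp \<theta> * q / \<theta>"
proof -
  let ?p = "subsampled_graph \<delta> G" and ?t = "real (rs_t G)"
  define E where "E = measure_pmf.expectation ?p (\<lambda>A. (\<Sum>j<rs_t G. of_bool (Q (f A) j \<subseteq> A)) / ?t)"
  have t: "0 < ?t" using G by simp
  have "measure_pmf.expectation ?p (\<lambda>A. \<Sum>j<rs_t G. \<theta> * of_bool (Q (f A) j \<subseteq> A))
      \<le> ln (real (card M) * exp (?t * (exp \<theta> * q)))"
    using \<theta> M by (intro expectation_le_ln_exp_moment[where F = "\<lambda>\<mu> A. \<Sum>j<rs_t G. \<theta> * of_bool (Q \<mu> j \<subseteq> A)"]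
        finite_subsampled exp_moment_certified G \<delta> Q q) auto
  also have "measure_pmf.expectation ?p (\<lambda>A. \<Sum>j<rs_t G. \<theta> * of_bool (Q (f A) j \<subseteq> A)) = \<theta> * ?t * E"
    unfolding E_def using t by (simp add: sum_distrib_left[symmetric])
  also have "ln (real (card M) * exp (?t * (exp \<theta> * q))) = ln (card M) + ?t * (exp \<theta> * q)"
  proof -
    have "M \<noteq> {}" using M(2) by blast
    then show ?thesis using M(1) by (simp add: ln_mult card_gt_0_iff)
  qed
  finally have "E \<le> (ln (card M) + ?t * (exp \<theta> * q)) / (\<theta> * ?t)"
    using \<theta> t by (simp add: pos_le_divide_eq mult.commute)
  also have "\<dots> = ln (card M) / (\<theta> * ?t) + exp \<theta> * q / \<theta>"
    using t by (simp add: add_divide_distrib)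
  finally show ?thesis by (simp add: E_def)
qed

text \<open>
  Given the messages, Bob's output is a fixed set, so it can be replaced by the set most likely to
  survive among the graphs compatible with the messages. Unlike Bob's output, that set depends
  only on the messages and the public data, and not on the encoded graphs.
\<close>

lemma best_certificate:
  fixes p :: "'g set pmf" and a1 :: "'g set \<Rightarrow> 'm" and b1 :: "'m \<Rightarrow> 'n" and a2 :: "'g set \<Rightarrow> 'n \<Rightarrow> 'o"
    and cand :: "'g set set" and out :: "'m \<Rightarrow> 'o \<Rightarrow> 'g set"
  assumes p: "finite (set_pmf p)"
    and best: "\<And>m1 m2 m3 Q. Q \<in> cand \<Longrightarrow>
      measure_pmf.expectation p (\<lambda>A. (of_bool :: bool \<Rightarrow> real) (a1 A = m1 \<and> a2 A m2 = m3 \<and> Q \<subseteq> A))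
      \<le> measure_pmf.expectation p (\<lambda>A. (of_bool :: bool \<Rightarrow> real) (a1 A = m1 \<and> a2 A m2 = m3 \<and> Ob m1 m2 m3 \<subseteq> A))"
  shows "measure_pmf.expectation p (\<lambda>A. (of_bool :: bool \<Rightarrow> real) (out (a1 A) (a2 A (b1 (a1 A))) \<in> cand \<and> out (a1 A) (a2 A (b1 (a1 A))) \<subseteq> A))
    \<le> measure_pmf.expectation p (\<lambda>A. (of_bool :: bool \<Rightarrow> real) (Ob (a1 A) (b1 (a1 A)) (a2 A (b1 (a1 A))) \<subseteq> A))"
proof -
  define ind :: "bool \<Rightarrow> real" where "ind = of_bool"
  \<comment> \<open>Bob's message is a function of Alice's first one, so these two messages
    determine all three. On each of their level sets both \<open>out\<close> and \<open>Ob\<close>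
    are constant.\<close>
  define tr where "tr A = (a1 A, a2 A (b1 (a1 A)))" for A
  define T where "T = tr ` set_pmf p"
  have finT: "finite T" using p by (simp add: T_def)
  have int: "integrable p h" for h :: "_ \<Rightarrow> real" by (rule integrable_measure_pmf_finite[OF p])
  have split: "measure_pmf.expectation p h = (\<Sum>\<tau>\<in>T. measure_pmf.expectation p (\<lambda>A. ind (tr A = \<tau>) * h A))"
    for h :: "_ \<Rightarrow> real"
  proof -
    have "measure_pmf.expectation p h = measure_pmf.expectation p (\<lambda>A. \<Sum>\<tau>\<in>T. ind (tr A = \<tau>) * h A)"
    proof (intro integral_cong_AE AE_pmfI)
      fix A assume "A \<in> set_pmf p"
      then have "tr A \<in> T" by (simp add: T_def)
      then show "h A = (\<Sum>\<tau>\<in>T. ind (tr A = \<tau>) * h A)"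
        using finT by (simp add: sum_distrib_right[symmetric] ind_def of_bool_def)
    qed auto
    also have "\<dots> = (\<Sum>\<tau>\<in>T. measure_pmf.expectation p (\<lambda>A. ind (tr A = \<tau>) * h A))"
      by (intro Bochner_Integration.integral_sum int)
    finally show ?thesis .
  qed
  show ?thesis
    unfolding ind_def[symmetric]
  proof (subst (1 2) split, intro sum_mono)
    fix \<tau> assume "\<tau> \<in> T"
    obtain m1 m3 where \<tau>: "\<tau> = (m1, m3)" by (cases \<tau>)
    have tr: "tr A = \<tau> \<longleftrightarrow> a1 A = m1 \<and> a2 A (b1 m1) = m3" for A by (auto simp: tr_def \<tau>)
    have r: "measure_pmf.expectation p (\<lambda>A. ind (tr A = \<tau>) * ind (Ob (a1 A) (b1 (a1 A)) (a2 A (b1 (a1 A))) \<subseteq> A))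
        = measure_pmf.expectation p (\<lambda>A. ind (a1 A = m1 \<and> a2 A (b1 m1) = m3 \<and> Ob m1 (b1 m1) m3 \<subseteq> A))"
      by (intro Bochner_Integration.integral_cong refl) (auto simp: tr ind_def)
    show "measure_pmf.expectation p (\<lambda>A. ind (tr A = \<tau>) *
          ind (out (a1 A) (a2 A (b1 (a1 A))) \<in> cand \<and> out (a1 A) (a2 A (b1 (a1 A))) \<subseteq> A))
        \<le> measure_pmf.expectation p (\<lambda>A. ind (tr A = \<tau>) * ind (Ob (a1 A) (b1 (a1 A)) (a2 A (b1 (a1 A))) \<subseteq> A))"
    proof (cases "out m1 m3 \<in> cand")
      case True
      have "measure_pmf.expectation p (\<lambda>A. ind (tr A = \<tau>) *
          ind (out (a1 A) (a2 A (b1 (a1 A))) \<in> cand \<and> out (a1 A) (a2 A (b1 (a1 A))) \<subseteq> A))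
        = measure_pmf.expectation p (\<lambda>A. ind (a1 A = m1 \<and> a2 A (b1 m1) = m3 \<and> out m1 m3 \<subseteq> A))"
        using True by (intro Bochner_Integration.integral_cong refl) (auto simp: tr ind_def)
      then show ?thesis unfolding r using best[OF True, folded ind_def] by simp
    next
      case False
      then have "measure_pmf.expectation p (\<lambda>A. ind (tr A = \<tau>) *
          ind (out (a1 A) (a2 A (b1 (a1 A))) \<in> cand \<and> out (a1 A) (a2 A (b1 (a1 A))) \<subseteq> A)) = measure_pmf.expectation p (\<lambda>A. 0 :: real)"
        by (intro Bochner_Integration.integral_cong refl) (auto simp: tr ind_def)
      then show ?thesis by (auto simp: ind_def intro!: Bochner_Integration.integral_nonneg)
    qed
  qed
qed

section \<open>The value of a protocol\<close>

definition enc_union :: "aug_vertex set set \<Rightarrow> aug_vertex set set \<Rightarrow> game_vertex set set" where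
  "enc_union HL HR = (`) GL ` HL \<union> (`) GR ` HR"

definition phase2_graph ::
  "aug_vertex set set \<Rightarrow> aug_vertex list \<Rightarrow> aug_vertex set set \<Rightarrow> aug_vertex list \<Rightarrow> game_vertex set set" where
  "phase2_graph EL TL ER TR =
     {{GL (TL ! i), XV i} | i. i < length TL} \<union> {{GR (TR ! i), YV i} | i. i < length TR}
     \<union> (`) GL ` EL \<union> (`) GR ` ER"

abbreviation pair_B :: "aug_graph \<Rightarrow> aug_graph \<Rightarrow> game_vertex set set" where
  "pair_B KL KR \<equiv> enc_union (ag_enc KL) (ag_enc KR)"

abbreviation pair_2 :: "aug_graph \<Rightarrow> aug_graph \<Rightarrow> game_vertex set set" where
  "pair_2 KL KR \<equiv> phase2_graph (ag_rest KL) (ag_targets KL) (ag_rest KR) (ag_targets KR)"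

lemma graph_B_eq: "graph_B I = pair_B (in_L I) (in_R I)"
  by (simp add: graph_B_def enc_union_def)

lemma graph_2_eq: "graph_2 I = pair_2 (in_L I) (in_R I)"
  by (simp add: graph_2_def phase2_graph_def)

text \<open>A protocol with its seeds fixed. The lengths are bounded at all arguments, also outside
  the support of the input, because the comparison with \<open>D_free\<close> evaluates the messages
  there.\<close>

locale bounded_game =
  fixes \<delta> :: real and k :: nat and G1 G2 :: rs_graph and C :: nat
    and a1 :: "(nat \<times> nat) set \<Rightarrow> bool list"
    and b1 :: "game_vertex set set \<Rightarrow> bool list \<Rightarrow> bool list"
    and a2 :: "(nat \<times> nat) set \<Rightarrow> bool list \<Rightarrow> game_vertex set set \<Rightarrow> bool list"
    and bout :: "game_vertex set set \<Rightarrow> bool list \<Rightarrow> bool list \<Rightarrow> game_vertex set set \<Rightarrow> nat \<Rightarrow> (nat \<times> nat) set"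
  assumes params: "hm_params \<delta> k G1 G2"
    and len: "length (a1 A) \<le> C" "length (b1 H m) \<le> C" "length (a2 A m E) \<le> C"
begin

abbreviation "n1 \<equiv> rs_n G1"
abbreviation "r1 \<equiv> rs_r G1"
abbreviation "t1 \<equiv> rs_t G1"
abbreviation "P \<equiv> subsampled_graph \<delta> G1"
abbreviation "DL j \<equiv> D_aug G2 (\<lambda>i. i \<in> fst ` rs_matching G1 j) n1 k"
abbreviation "DR j \<equiv> D_aug G2 (\<lambda>i. i \<in> snd ` rs_matching G1 j) n1 k"
abbreviation "DF \<equiv> D_free G2 n1 k"

definition game_out :: "(nat \<times> nat) set \<Rightarrow> nat \<Rightarrow> aug_graph \<Rightarrow> aug_graph \<Rightarrow> (nat \<times> nat) set" where
  "game_out A j KL KR =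
     (let Q = bout (pair_B KL KR) (a1 A) (a2 A (b1 (pair_B KL KR) (a1 A)) (pair_2 KL KR)) (pair_2 KL KR) j
      in if Q \<subseteq> A then Q \<inter> rs_matching G1 j else {})"

sublocale G2: rs_blocks G2 n1 k
proof
  show "is_rs_graph G2" "0 < rs_t G2" "1 \<le> k" using params by (auto simp: hm_params_def)
  have "real (rs_r G2) = (real k + \<delta>) * real n1" "0 < \<delta>" using params by (auto simp: hm_params_def)
  then have "real (k * n1) \<le> real (rs_r G2)" by (simp add: algebra_simps)
  then show "k * n1 \<le> rs_r G2" by linarith
qed

lemma G1: "is_rs_graph G1" "0 < t1" and \<delta>: "0 < \<delta>" "\<delta> < 1"
  using params by (auto simp: hm_params_def)

lemma finP: "finite (set_pmf P)"
  by (rule finite_subsampled)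

lemma finJ: "finite (set_pmf (pmf_of_set {..<t1}))"
  using G1 by (simp add: set_pmf_of_set lessThan_empty_iff)

lemma finite_matching: "finite (rs_matching G1 j)"
  by (simp add: rs_matching_def)

lemma card_matching: "card (rs_matching G1 j) \<le> r1"
  unfolding rs_matching_def using card_image_le[of "{..<r1}"] by simp

lemma card_matching_eq: "j < t1 \<Longrightarrow> card (rs_matching G1 j) = r1"
  using G1(1) unfolding rs_matching_def is_rs_graph_def by (simp add: card_image)

text \<open>The part of the input that is independent of Alice's graph.\<close>

definition W :: "(nat \<times> aug_graph \<times> aug_graph) pmf" where
  "W = do { j \<leftarrow> pmf_of_set {..<t1}; KL \<leftarrow> DL j; KR \<leftarrow> DR j; return_pmf (j, KL, KR) }"

lemma finW: "finite (set_pmf W)"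
  unfolding W_def using finJ G2.finite_D_aug by auto

lemma set_W: "(j, KL, KR) \<in> set_pmf W \<Longrightarrow> j < t1"
  unfolding W_def using G1 by (auto simp: set_pmf_of_set lessThan_empty_iff)

lemma expectation_W:
  fixes h :: "nat \<times> aug_graph \<times> aug_graph \<Rightarrow> real"
  shows "measure_pmf.expectation W h = (\<Sum>j<t1. measure_pmf.expectation (DL j)
    (\<lambda>KL. measure_pmf.expectation (DR j) (\<lambda>KR. h (j, KL, KR)))) / t1"
proof -
  have "measure_pmf.expectation W h = measure_pmf.expectation (pmf_of_set {..<t1})
      (\<lambda>j. measure_pmf.expectation (do { KL \<leftarrow> DL j; KR \<leftarrow> DR j; return_pmf (j, KL, KR) }) h)"
    unfolding W_def using finJ G2.finite_D_aug by (intro expectation_bind_finite) auto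
  also have "\<dots> = (\<Sum>j<t1. measure_pmf.expectation (do { KL \<leftarrow> DL j; KR \<leftarrow> DR j; return_pmf (j, KL, KR) }) h) / t1"
    using G1 by (simp add: integral_pmf_of_set lessThan_empty_iff)
  finally show ?thesis
    using G2.finite_D_aug by (simp add: expectation_bind_finite)
qed

lemma expectation_hm_dist:
  fixes h :: "hm_input \<Rightarrow> real"
  shows "measure_pmf.expectation (hm_dist \<delta> k G1 G2) h = measure_pmf.expectation W
    (\<lambda>(j, KL, KR). measure_pmf.expectation P (\<lambda>A. h \<lparr> in_A = A, in_j = j, in_L = KL, in_R = KR \<rparr>))"
proof -
  have "hm_dist \<delta> k G1 G2 = do { A \<leftarrow> P; map_pmf (\<lambda>(j, KL, KR). \<lparr> in_A = A, in_j = j, in_L = KL, in_R = KR \<rparr>) W }"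
    by (simp add: hm_dist_def W_def map_bind_pmf)
  then have "measure_pmf.expectation (hm_dist \<delta> k G1 G2) h = measure_pmf.expectation P (\<lambda>A.
      measure_pmf.expectation W (\<lambda>(j, KL, KR). h \<lparr> in_A = A, in_j = j, in_L = KL, in_R = KR \<rparr>))"
    using finP finW by (simp add: expectation_bind_finite case_prod_unfold)
  also have "\<dots> = measure_pmf.expectation W (\<lambda>w. measure_pmf.expectation P
      (\<lambda>A. (\<lambda>(j, KL, KR). h \<lparr> in_A = A, in_j = j, in_L = KL, in_R = KR \<rparr>) w))"
    by (rule expectation_swap_finite[OF finP finW])
  finally show ?thesis by (simp add: case_prod_unfold)
qed

section \<open>The value bound with free parameters\<close>

context
  fixes \<gamma> \<theta> \<epsilon> \<theta>1 :: real
  assumes \<gamma>: "0 < \<gamma>" "\<gamma> \<le> 1" and \<theta>: "0 < \<theta>" and \<theta>1: "0 < \<theta>1"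
    and moment: "\<And>(I :: nat set) y w. random_blocks I n1 k y w \<Longrightarrow> card I = rs_r G2 \<Longrightarrow>
      (\<forall>x\<in>Pow I. random_blocks.bias I n1 k y w x \<le> 1) \<Longrightarrow>
      cube_avg I (\<lambda>x. exp (\<theta> * random_blocks.bias I n1 k y w x)) \<le> exp (\<theta> * \<epsilon>)"
begin

text \<open>Outputs with fewer than \<gamma> * r1 correct edges may be ignored, as they add at most
  \<gamma> * r1 to the value; a larger set survives the deletions only with exponentially small
  probability.\<close>

definition cand :: "nat \<Rightarrow> (nat \<times> nat) set set" where
  "cand j = {Q. Q \<subseteq> rs_matching G1 j \<and> \<gamma> * r1 \<le> card Q}"

definition survival :: "game_vertex set set \<Rightarrow> bool list \<Rightarrow> bool list \<Rightarrow> bool list \<Rightarrow> (nat \<times> nat) set \<Rightarrow> real" where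
  "survival E m1 m2 m3 Q = measure_pmf.expectation P (\<lambda>A. of_bool (a1 A = m1 \<and> a2 A m2 E = m3 \<and> Q \<subseteq> A))"

text \<open>Bob's encoded graphs enter only through his message \<open>m2\<close>, which is what
  makes the survival of this set a test covered by \<open>hide\<close>.\<close>

definition best :: "game_vertex set set \<Rightarrow> nat \<Rightarrow> bool list \<Rightarrow> bool list \<Rightarrow> bool list \<Rightarrow> (nat \<times> nat) set" where
  "best E j m1 m2 m3 = (SOME Q. Q \<in> cand j \<and> (\<forall>Q'\<in>cand j. survival E m1 m2 m3 Q' \<le> survival E m1 m2 m3 Q))"

lemma best:
  assumes j: "j < t1"
  shows "best E j m1 m2 m3 \<in> cand j" "Q \<in> cand j \<Longrightarrow> survival E m1 m2 m3 Q \<le> survival E m1 m2 m3 (best E j m1 m2 m3)"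
proof -
  let ?s = "survival E m1 m2 m3"
  have "finite (cand j)"
    using finite_matching[of j] by (auto simp: cand_def)
  moreover have "rs_matching G1 j \<in> cand j"
    using \<gamma> card_matching_eq[OF j] by (simp add: cand_def mult_left_le_one_le)
  ultimately have "Max (?s ` cand j) \<in> ?s ` cand j" and mx: "\<And>Q'. Q' \<in> cand j \<Longrightarrow> ?s Q' \<le> Max (?s ` cand j)"
    by (auto intro!: Max_in)
  then obtain Q0 where "Max (?s ` cand j) = ?s Q0" "Q0 \<in> cand j" by blast
  then have "\<exists>Q. Q \<in> cand j \<and> (\<forall>Q'\<in>cand j. ?s Q' \<le> ?s Q)" using mx by auto
  from someI_ex[OF this, folded best_def]
  show "best E j m1 m2 m3 \<in> cand j" "Q \<in> cand j \<Longrightarrow> ?s Q \<le> ?s (best E j m1 m2 m3)" by auto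
qed

definition certified :: "(nat \<times> nat) set \<Rightarrow> nat \<Rightarrow> bool list \<Rightarrow> game_vertex set set \<Rightarrow> real" where
  "certified A j m2 E = of_bool (best E j (a1 A) m2 (a2 A m2 E) \<subseteq> A)"

lemma certified_bounds: "0 \<le> certified A j m2 E" "certified A j m2 E \<le> 1"
  by (simp_all add: certified_def)

abbreviation "cert A j KL KR \<equiv> certified A j (b1 (pair_B KL KR) (a1 A)) (pair_2 KL KR)"

lemma output_le_certified:
  assumes j: "j < t1"
  shows "measure_pmf.expectation P (\<lambda>A. real (card (game_out A j KL KR)))
    \<le> \<gamma> * r1 + r1 * measure_pmf.expectation P (\<lambda>A. cert A j KL KR)"
proof -
  let ?B = "pair_B KL KR" and ?E = "pair_2 KL KR"
  define Q where "Q m1 m3 = bout ?B m1 m3 ?E j \<inter> rs_matching G1 j" for m1 m3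
  let ?Q = "\<lambda>A. Q (a1 A) (a2 A (b1 ?B (a1 A)) ?E)"
  have int: "integrable P h" for h :: "_ \<Rightarrow> real" by (rule integrable_measure_pmf_finite[OF finP])
  have "measure_pmf.expectation P (\<lambda>A. real (card (game_out A j KL KR)))
      \<le> measure_pmf.expectation P (\<lambda>A. \<gamma> * r1 + r1 * of_bool (?Q A \<in> cand j \<and> ?Q A \<subseteq> A))"
  proof (intro expectation_mono_finite finP)
    fix A
    show "real (card (game_out A j KL KR)) \<le> \<gamma> * r1 + r1 * of_bool (?Q A \<in> cand j \<and> ?Q A \<subseteq> A)"
    \<comment> \<open>Nonemptiness matters when \<gamma> * r1 is 0: an empty result passes the
      threshold then, yet does not imply that Bob's output lies in \<open>A\<close>.\<close>
    proof (cases "\<gamma> * r1 \<le> card (game_out A j KL KR) \<and> game_out A j KL KR \<noteq> {}")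
      case True
      then have eq: "game_out A j KL KR = ?Q A" and sub: "?Q A \<subseteq> A"
        unfolding game_out_def Q_def Let_def by (auto split: if_splits)
      have "?Q A \<in> cand j" using True eq by (auto simp: cand_def Q_def)
      moreover have "card (?Q A) \<le> r1"
        using card_mono[OF finite_matching, of "?Q A" j] card_matching[of j] by (simp add: Q_def)
      moreover have "0 \<le> \<gamma> * r1" using \<gamma> by simp
      ultimately show ?thesis using eq sub by simp
    next
      case False
      then have "real (card (game_out A j KL KR)) \<le> \<gamma> * r1" using \<gamma> by fastforce
      moreover have "0 \<le> real r1 * of_bool (?Q A \<in> cand j \<and> ?Q A \<subseteq> A)" by simp
      ultimately show ?thesis by linarith
    qed
  qed
  also have "\<dots> = \<gamma> * r1 + r1 * measure_pmf.expectation P (\<lambda>A. of_bool (?Q A \<in> cand j \<and> ?Q A \<subseteq> A))"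
    using int by (subst Bochner_Integration.integral_add) simp_all
  also have "\<dots> \<le> \<gamma> * r1 + r1 * measure_pmf.expectation P (\<lambda>A. cert A j KL KR)"
  proof (intro add_left_mono mult_left_mono)
    show "measure_pmf.expectation P (\<lambda>A. of_bool (?Q A \<in> cand j \<and> ?Q A \<subseteq> A))
        \<le> measure_pmf.expectation P (\<lambda>A. cert A j KL KR)"
      unfolding certified_def
      using best(2)[OF j, of _ ?E]
      by (intro best_certificate[where cand = "cand j" and out = Q and ?a2.0 = "\<lambda>A m. a2 A m ?E" and ?b1.0 = "b1 ?B"] finP)
        (simp add: survival_def)
  qed simp
  finally show ?thesis .
qed

abbreviation "msgs \<equiv> {xs :: bool list. length xs \<le> C}"

lemma ln_card_msgs: "ln (card msgs) \<le> C * ln 4"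
proof -
  have "[] \<in> msgs" by simp
  then have "0 < card msgs" using finite_lists_le[of C] card_gt_0_iff by blast
  moreover have "real (card msgs) \<le> real (4 ^ C)" using card_lists_le[of C] by (simp only: of_nat_le_iff)
  ultimately have "ln (card msgs) \<le> ln (4 ^ C)" by simp
  then show ?thesis by (simp add: ln_realpow)
qed

lemma hide:
  assumes g: "\<And>\<mu> E T. 0 \<le> g \<mu> E T" "\<And>\<mu> E T. g \<mu> E T \<le> 1" and f: "\<And>H. f H \<in> msgs"
  shows "measure_pmf.expectation (D_aug G2 Y n1 k) (\<lambda>A. g (f (ag_enc A)) (ag_rest A) (ag_targets A))
    \<le> measure_pmf.expectation DF (\<lambda>A. g (f (ag_enc A)) (ag_rest A) (ag_targets A)) + (\<epsilon> + C * ln 4 / (\<theta> * rs_t G2))"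
proof -
  have "ln (card msgs) / (\<theta> * rs_t G2) \<le> C * ln 4 / (\<theta> * rs_t G2)"
    using ln_card_msgs \<theta> by (intro divide_right_mono) auto
  moreover have "measure_pmf.expectation (D_aug G2 Y n1 k) (\<lambda>A. g (f (ag_enc A)) (ag_rest A) (ag_targets A))
    \<le> measure_pmf.expectation DF (\<lambda>A. g (f (ag_enc A)) (ag_rest A) (ag_targets A)) + \<epsilon> + ln (card msgs) / (\<theta> * rs_t G2)"
    by (rule G2.hiding_D_aug[OF _ _ finite_lists_le _ \<theta>]) (assumption | rule g f moment)+
  ultimately show ?thesis by linarith
qed

text \<open>The right graph is replaced while the left one is held fixed, then the left one while
  the right one is free; each exchange costs one hiding error. Afterwards the law no longer depends
  on \<open>j\<close>, and the average over \<open>j\<close> moves inside.\<close>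

lemma certified_hidden:
  "measure_pmf.expectation W (\<lambda>(j, KL, KR). cert A j KL KR)
    \<le> measure_pmf.expectation DF (\<lambda>KL. measure_pmf.expectation DF (\<lambda>KR. (\<Sum>j<t1. cert A j KL KR) / t1))
      + 2 * (\<epsilon> + C * ln 4 / (\<theta> * rs_t G2))"
proof -
  define \<eta> where "\<eta> = \<epsilon> + C * ln 4 / (\<theta> * rs_t G2)"
  note fin = G2.finite_D_aug G2.finite_D_free
  have int: "integrable DF h" for h :: "_ \<Rightarrow> real" by (rule integrable_measure_pmf_finite[OF G2.finite_D_free])
  have R: "measure_pmf.expectation (DR j) (\<lambda>KR. cert A j KL KR) \<le> measure_pmf.expectation DF (\<lambda>KR. cert A j KL KR) + \<eta>" for j KL
    unfolding \<eta>_def using certified_bounds len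
    by (intro hide[where g = "\<lambda>\<mu> E T. certified A j \<mu> (phase2_graph (ag_rest KL) (ag_targets KL) E T)"
          and f = "\<lambda>H. b1 (enc_union (ag_enc KL) H) (a1 A)"]) auto
  have L: "measure_pmf.expectation (DL j) (\<lambda>KL. cert A j KL KR) \<le> measure_pmf.expectation DF (\<lambda>KL. cert A j KL KR) + \<eta>" for j KR
    unfolding \<eta>_def using certified_bounds len
    by (intro hide[where g = "\<lambda>\<mu> E T. certified A j \<mu> (phase2_graph E T (ag_rest KR) (ag_targets KR))"
          and f = "\<lambda>H. b1 (enc_union H (ag_enc KR)) (a1 A)"]) auto
  have LR: "measure_pmf.expectation (DL j) (\<lambda>KL. measure_pmf.expectation (DR j) (\<lambda>KR. cert A j KL KR))
      \<le> measure_pmf.expectation DF (\<lambda>KL. measure_pmf.expectation DF (\<lambda>KR. cert A j KL KR)) + 2 * \<eta>" for j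
  proof -
    have "measure_pmf.expectation (DL j) (\<lambda>KL. measure_pmf.expectation (DR j) (\<lambda>KR. cert A j KL KR))
        \<le> measure_pmf.expectation (DL j) (\<lambda>KL. measure_pmf.expectation DF (\<lambda>KR. cert A j KL KR) + \<eta>)"
      by (intro expectation_mono_finite fin R)
    also have "\<dots> = measure_pmf.expectation DF (\<lambda>KR. measure_pmf.expectation (DL j) (\<lambda>KL. cert A j KL KR)) + \<eta>"
      by (subst expectation_add_const_finite) (simp_all only: fin expectation_swap_finite[OF fin])
    also have "\<dots> \<le> measure_pmf.expectation DF (\<lambda>KR. measure_pmf.expectation DF (\<lambda>KL. cert A j KL KR) + \<eta>) + \<eta>"
      by (intro add_right_mono expectation_mono_finite fin L)
    also have "\<dots> = measure_pmf.expectation DF (\<lambda>KL. measure_pmf.expectation DF (\<lambda>KR. cert A j KL KR)) + 2 * \<eta>"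
      by (subst expectation_add_const_finite[OF fin(2)], subst expectation_swap_finite[OF fin(2) fin(2)]) simp
    finally show ?thesis .
  qed
  have "measure_pmf.expectation W (\<lambda>(j, KL, KR). cert A j KL KR)
      = (\<Sum>j<t1. measure_pmf.expectation (DL j) (\<lambda>KL. measure_pmf.expectation (DR j) (\<lambda>KR. cert A j KL KR))) / t1"
    by (simp add: expectation_W)
  also have "\<dots> \<le> (\<Sum>j<t1. measure_pmf.expectation DF (\<lambda>KL. measure_pmf.expectation DF (\<lambda>KR. cert A j KL KR)) + 2 * \<eta>) / t1"
    by (intro divide_right_mono sum_mono LR) simp
  also have "\<dots> = (\<Sum>j<t1. measure_pmf.expectation DF (\<lambda>KL. measure_pmf.expectation DF (\<lambda>KR. cert A j KL KR))) / t1 + 2 * \<eta>"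
    using G1(2) by (simp add: sum.distrib add_divide_distrib)
  also have "(\<Sum>j<t1. measure_pmf.expectation DF (\<lambda>KL. measure_pmf.expectation DF (\<lambda>KR. cert A j KL KR))) / t1
      = measure_pmf.expectation DF (\<lambda>KL. measure_pmf.expectation DF (\<lambda>KR. (\<Sum>j<t1. cert A j KL KR) / t1))"
    using int by (simp add: Bochner_Integration.integral_sum)
  finally show ?thesis by (simp add: \<eta>_def)
qed

text \<open>With both augmentation graphs fixed independently of \<open>j\<close>, one triple of
  messages determines the certificates for all matchings, so the union bound over triples is paid
  once against \<open>t1\<close> independent events.\<close>

lemma certified_free:
  "measure_pmf.expectation P (\<lambda>A. (\<Sum>j<t1. cert A j KL KR) / t1)
    \<le> 3 * real C * ln 4 / (\<theta>1 * t1) + exp \<theta>1 * (1 - \<delta>) powr (\<gamma> * r1) / \<theta>1"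
proof -
  let ?B = "pair_B KL KR" and ?E = "pair_2 KL KR" and ?M = "msgs \<times> msgs \<times> msgs"
  have sub: "best ?E j m1 m2 m3 \<subseteq> rs_matching G1 j" if "j < t1" for j m1 m2 m3
    using best(1)[OF that, of ?E m1 m2 m3] by (simp add: cand_def)
  have q: "(1 - \<delta>) ^ card (best ?E j m1 m2 m3) \<le> (1 - \<delta>) powr (\<gamma> * r1)" if "j < t1" for j m1 m2 m3
  proof -
    have "\<gamma> * r1 \<le> card (best ?E j m1 m2 m3)" using best(1)[OF that, of ?E m1 m2 m3] by (simp add: cand_def)
    then have "(1 - \<delta>) powr card (best ?E j m1 m2 m3) \<le> (1 - \<delta>) powr (\<gamma> * r1)"
      using \<delta> by (intro powr_mono') auto
    then show ?thesis using \<delta> by (simp add: powr_realpow)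
  qed
  have "measure_pmf.expectation P (\<lambda>A. (\<Sum>j<t1. of_bool ((\<lambda>(m1, m2, m3). best ?E j m1 m2 m3)
        ((\<lambda>A. (a1 A, b1 ?B (a1 A), a2 A (b1 ?B (a1 A)) ?E)) A) \<subseteq> A)) / t1)
      \<le> ln (card ?M) / (\<theta>1 * t1) + exp \<theta>1 * (1 - \<delta>) powr (\<gamma> * r1) / \<theta>1"
    using G1 \<delta> \<theta>1 sub q finite_lists_le len
    by (intro certified_edges_bound) (auto split: prod.split)
  moreover have "ln (card ?M) / (\<theta>1 * t1) \<le> 3 * real C * ln 4 / (\<theta>1 * t1)"
  proof (intro divide_right_mono)
    have "[] \<in> msgs" by simp
    then have "0 < card msgs" using finite_lists_le[of C] card_gt_0_iff by blast
    then have "ln (card ?M) = 3 * ln (card msgs)" by (simp add: card_cartesian_product ln_mult)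
    then show "ln (card ?M) \<le> 3 * real C * ln 4" using ln_card_msgs by simp
  qed (use \<theta>1 in simp)
  ultimately show ?thesis by (simp add: certified_def)
qed

text \<open>Expectations are exchanged twice: hiding needs Alice's graph fixed, whereas the bound on
  certificates needs the augmentation graphs fixed and Alice's graph random.\<close>

lemma value_bound:
  "measure_pmf.expectation (hm_dist \<delta> k G1 G2) (\<lambda>I. real (card (game_out (in_A I) (in_j I) (in_L I) (in_R I))))
    \<le> r1 * (\<gamma> + 2 * (\<epsilon> + C * ln 4 / (\<theta> * rs_t G2)) + 3 * real C * ln 4 / (\<theta>1 * t1)
        + exp \<theta>1 * (1 - \<delta>) powr (\<gamma> * r1) / \<theta>1)"
proof -
  define \<eta> where "\<eta> = \<epsilon> + C * ln 4 / (\<theta> * rs_t G2)"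
  define \<zeta> where "\<zeta> = 3 * real C * ln 4 / (\<theta>1 * t1) + exp \<theta>1 * (1 - \<delta>) powr (\<gamma> * r1) / \<theta>1"
  define X where "X = measure_pmf.expectation W (\<lambda>w. measure_pmf.expectation P (\<lambda>A. (\<lambda>(j, KL, KR). cert A j KL KR) w))"
  have "measure_pmf.expectation (hm_dist \<delta> k G1 G2) (\<lambda>I. real (card (game_out (in_A I) (in_j I) (in_L I) (in_R I))))
      = measure_pmf.expectation W (\<lambda>(j, KL, KR). measure_pmf.expectation P (\<lambda>A. real (card (game_out A j KL KR))))"
    by (simp add: expectation_hm_dist)
  also have "\<dots> \<le> measure_pmf.expectation W (\<lambda>w. r1 * measure_pmf.expectation P (\<lambda>A. (\<lambda>(j, KL, KR). cert A j KL KR) w) + \<gamma> * r1)"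
    using output_le_certified set_W by (intro expectation_mono_finite finW) (auto simp: add.commute)
  also have "\<dots> = r1 * X + \<gamma> * r1"
    by (simp add: expectation_add_const_finite[OF finW] X_def)
  finally have le: "measure_pmf.expectation (hm_dist \<delta> k G1 G2) (\<lambda>I. real (card (game_out (in_A I) (in_j I) (in_L I) (in_R I))))
      \<le> r1 * X + \<gamma> * r1" .
  have "X = measure_pmf.expectation P (\<lambda>A. measure_pmf.expectation W (\<lambda>(j, KL, KR). cert A j KL KR))"
    unfolding X_def by (rule expectation_swap_finite[OF finW finP])
  also have "\<dots> \<le> measure_pmf.expectation P (\<lambda>A. measure_pmf.expectation DF (\<lambda>KL. measure_pmf.expectation DF
      (\<lambda>KR. (\<Sum>j<t1. cert A j KL KR) / t1)) + 2 * \<eta>)"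
    unfolding \<eta>_def by (intro expectation_mono_finite finP certified_hidden)
  also have "\<dots> = measure_pmf.expectation DF (\<lambda>KL. measure_pmf.expectation DF (\<lambda>KR.
      measure_pmf.expectation P (\<lambda>A. (\<Sum>j<t1. cert A j KL KR) / t1))) + 2 * \<eta>"
    by (simp only: expectation_add_const_finite[OF finP] expectation_swap_finite[OF finP G2.finite_D_free])
  also have "\<dots> \<le> measure_pmf.expectation DF (\<lambda>KL. measure_pmf.expectation DF (\<lambda>KR. \<zeta>)) + 2 * \<eta>"
    unfolding \<zeta>_def by (intro add_right_mono expectation_mono_finite G2.finite_D_free certified_free)
  also have "\<dots> = \<zeta> + 2 * \<eta>" by simp
  finally have "r1 * X \<le> r1 * (\<zeta> + 2 * \<eta>)" by (intro mult_left_mono) auto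
  then have "r1 * X + \<gamma> * r1 \<le> r1 * (\<gamma> + 2 * \<eta> + \<zeta>)" by (simp add: algebra_simps)
  then show ?thesis using le unfolding \<eta>_def \<zeta>_def by (simp only: add.assoc)
qed

end

end

text \<open>For each choice of seeds the game is deterministic and obeys \<open>value_bound\<close>
  with a right side free of the seeds, so the average over seeds obeys it too.\<close>

lemma hm_val_le:
  fixes \<pi> :: "('p, 'a, 'b) protocol" and \<gamma> \<theta> \<theta>1 \<epsilon> :: real
  assumes params: "hm_params \<delta> k G1 G2" and cost: "comm_cost \<delta> k G1 G2 \<pi> = enat C"
    and \<gamma>: "0 < \<gamma>" "\<gamma> \<le> 1" and \<theta>: "0 < \<theta>" and \<theta>1: "0 < \<theta>1"
    and moment: "\<And>(I :: nat set) y w. random_blocks I (rs_n G1) k y w \<Longrightarrow> card I = rs_r G2 \<Longrightarrow>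
      (\<forall>x\<in>Pow I. random_blocks.bias I (rs_n G1) k y w x \<le> 1) \<Longrightarrow>
      cube_avg I (\<lambda>x. exp (\<theta> * random_blocks.bias I (rs_n G1) k y w x)) \<le> exp (\<theta> * \<epsilon>)"
  shows "hm_val \<delta> k G1 G2 \<pi> \<le> rs_r G1 * (\<gamma> + 2 * (\<epsilon> + C * ln 4 / (\<theta> * rs_t G2)) + 3 * real C * ln 4 / (\<theta>1 * rs_t G1)
        + exp \<theta>1 * (1 - \<delta>) powr (\<gamma> * rs_r G1) / \<theta>1)" (is "_ \<le> ?B")
proof -
  let ?D = "hm_dist \<delta> k G1 G2"
  define f where "f s I = real (card (hm_out G1 \<pi> s I))" for s I
  have f0: "0 \<le> f s I" for s I by (simp add: f_def)
  have fr: "f s I \<le> rs_r G1" for s I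
  proof -
    have "card (hm_out G1 \<pi> s I) \<le> card (rs_matching G1 (in_j I))"
      by (intro card_mono) (auto simp: hm_out_def rs_matching_def)
    also have "\<dots> \<le> rs_r G1" unfolding rs_matching_def using card_image_le[of "{..<rs_r G1}"] by simp
    finally show ?thesis by (simp add: f_def)
  qed
  have seed: "measure_pmf.expectation ?D (f s) \<le> ?B" if s: "s \<in> set_pmf (seeds \<pi>)" for s
  proof -
    obtain p a b where sp: "s = (p, a, b)" by (cases s)
    \<comment> \<open>The cost bounds messages only on the support of the inputs; \<open>D_free\<close> leaves it, hence the truncation.\<close>
    let ?a1 = "\<lambda>A. take C (p_alice1 \<pi> p a A)" and ?b1 = "\<lambda>H m. take C (p_bob1 \<pi> p b H m)"
      and ?a2 = "\<lambda>A m E. take C (p_alice2 \<pi> p a A m E)"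
    interpret g: bounded_game \<delta> k G1 G2 C ?a1 ?b1 ?a2 "p_bob2 \<pi> p b"
      using params by unfold_locales auto
    have "hm_out G1 \<pi> s I = g.game_out (in_A I) (in_j I) (in_L I) (in_R I)" if I: "I \<in> set_pmf ?D" for I
    proof -
      have "enat (bits (transcript \<pi> s I)) \<le> comm_cost \<delta> k G1 G2 \<pi>"
        unfolding comm_cost_def using s I by (intro SUP_upper2[of "(s, I)"]) auto
      then have "bits (transcript \<pi> s I) \<le> C" unfolding cost by simp
      then have "length (p_alice1 \<pi> p a (in_A I)) \<le> C"
        "length (p_bob1 \<pi> p b (graph_B I) (p_alice1 \<pi> p a (in_A I))) \<le> C"
        "length (p_alice2 \<pi> p a (in_A I) (p_bob1 \<pi> p b (graph_B I) (p_alice1 \<pi> p a (in_A I))) (graph_2 I)) \<le> C"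
        by (auto simp: bits_def transcript_def sp Let_def)
      then show ?thesis
        by (simp add: hm_out_def bob_output_def transcript_def sp Let_def g.game_out_def
            graph_B_eq[symmetric] graph_2_eq[symmetric])
    qed
    then have "measure_pmf.expectation ?D (f s)
        = measure_pmf.expectation ?D (\<lambda>I. real (card (g.game_out (in_A I) (in_j I) (in_L I) (in_R I))))"
      by (intro integral_cong_AE AE_pmfI) (auto simp: f_def)
    also have "\<dots> \<le> ?B"
      by (rule g.value_bound[OF \<gamma> \<theta> \<theta>1]) (rule moment)
    finally show ?thesis .
  qed
  have intI: "integrable ?D (f s)" for s
    using f0 fr by (intro measure_pmf.integrable_const_bound[where B = "rs_r G1"]) auto
  obtain s0 where "s0 \<in> set_pmf (seeds \<pi>)" using set_pmf_not_empty[of "seeds \<pi>"] by blast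
  then have B0: "0 \<le> ?B"
    using seed[of s0] Bochner_Integration.integral_nonneg[of ?D "f s0"] f0 by fastforce
  \<comment> \<open>Seeds may have infinite support, so the iterated expectation is obtained from
    the nonnegative integral.\<close>
  have "ennreal (hm_val \<delta> k G1 G2 \<pi>) = (\<integral>\<^sup>+x. ennreal (f (fst x) (snd x)) \<partial>pair_pmf (seeds \<pi>) ?D)"
    unfolding hm_val_def case_prod_unfold f_def[symmetric] using f0 fr
    by (intro nn_integral_eq_integral[symmetric] measure_pmf.integrable_const_bound[where B = "rs_r G1"]) auto
  also have "\<dots> = (\<integral>\<^sup>+s. \<integral>\<^sup>+I. ennreal (f s I) \<partial>?D \<partial>seeds \<pi>)"
    by (simp add: nn_integral_pair_pmf')
  also have "\<dots> = (\<integral>\<^sup>+s. ennreal (measure_pmf.expectation ?D (f s)) \<partial>seeds \<pi>)"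
    using intI f0 by (intro nn_integral_cong nn_integral_eq_integral) auto
  also have "\<dots> \<le> (\<integral>\<^sup>+s. ennreal ?B \<partial>seeds \<pi>)"
    by (intro nn_integral_mono_AE AE_pmfI ennreal_leI seed)
  also have "\<dots> = ennreal ?B" by simp
  finally show ?thesis using B0 by (simp only: ennreal_le_iff)
qed

text \<open>This lets a large r1 force a large n1, and thereby a large r2, where the uniform moment
  bound applies.\<close>

lemma rs_r_le_rs_n:
  assumes "is_rs_graph G" "0 < rs_t G"
  shows "rs_r G \<le> rs_n G"
proof -
  interpret rs_column_data G 0 using assms by unfold_locales
  have "rs_left G 0 \<subseteq> {..<rs_n G}"
    using assms unfolding is_rs_graph_def rs_edges_def by fastforce
  then show ?thesis using card_mono[of "{..<rs_n G}" "rs_left G 0"] card_left by simp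
qed

text \<open>The asymptotics are read along a sequence of games with r1 tending to infinity: \<delta>
  is fixed, while \<open>k\<close>, both graphs and the protocol may vary. The two little-o
  assumptions together express the minimum.\<close>

theorem theorem4p1:
  fixes \<delta> :: real
    and k :: "nat \<Rightarrow> nat"
    and G1 G2 :: "nat \<Rightarrow> rs_graph"
    and \<pi> :: "nat \<Rightarrow> ('p, 'a, 'b) protocol"
    and C :: "nat \<Rightarrow> nat"
  assumes params: "\<And>m. hm_params \<delta> (k m) (G1 m) (G2 m)"
    and r1_limit: "filterlim (\<lambda>m. rs_r (G1 m)) at_top sequentially"
    and cost: "\<And>m. comm_cost \<delta> (k m) (G1 m) (G2 m) (\<pi> m) = enat (C m)"
    and cost_small_2: "(\<lambda>m. real (C m)) \<in>
      o(\<lambda>m. real (rs_t (G2 m)) * real (rs_r (G2 m)) powr (1 - 2 / real (k m)))"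
    and cost_small_1: "(\<lambda>m. real (C m)) \<in> o(\<lambda>m. real (rs_t (G1 m)) * real (rs_r (G1 m)))"
  shows "(\<lambda>m. hm_val \<delta> (k m) (G1 m) (G2 m) (\<pi> m)) \<in> o(\<lambda>m. real (rs_r (G1 m)))"
proof (rule landau_o.smallI)
  fix c :: real assume c: "0 < c"
  have \<delta>: "0 < \<delta>" "\<delta> < 1" using params[of 0] by (auto simp: hm_params_def)
  define \<gamma> where "\<gamma> = min 1 (c / 4)"
  have \<gamma>: "0 < \<gamma>" "\<gamma> \<le> 1" "\<gamma> \<le> c / 4" using c by (auto simp: \<gamma>_def)
  \<comment> \<open>Then (1 - \<delta>)^(\<gamma> * r1) = exp (-2 * \<beta> * r1). Spending half of
    this decay on \<theta>1 = \<beta> * r1 leaves exp (-\<theta>1).\<close>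
  define \<beta> where "\<beta> = - \<gamma> * ln (1 - \<delta>) / 2"
  have \<beta>: "0 < \<beta>" using \<gamma> \<delta> by (simp add: \<beta>_def mult_pos_neg)
  have c16: "0 < c / 16" using c by simp
  obtain a :: real and R :: nat where a: "0 < a" and
    unif: "\<And>k l r. 2 \<le> k \<Longrightarrow> real r = (real k + \<delta>) * real l \<Longrightarrow> R \<le> r \<Longrightarrow>
      \<exists>\<theta>>0. a * real r powr (1 - 2 / real k) \<le> \<theta> \<and>
        (\<forall>(I :: nat set) y w. random_blocks I l k y w \<longrightarrow> card I = r \<longrightarrow>
          (\<forall>x\<in>Pow I. random_blocks.bias I l k y w x \<le> 1) \<longrightarrow>
          cube_avg I (\<lambda>x. exp (\<theta> * random_blocks.bias I l k y w x)) \<le> exp (\<theta> * (c / 16)))"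
    using exp_moment_bias_uniform[OF \<delta>(1) c16, where 'a = nat] by blast
  have ln4: "0 < ln (4 :: real)" by simp
  have "eventually (\<lambda>m. real (C m) \<le> a * c / (16 * ln 4) * \<bar>real (rs_t (G2 m)) * real (rs_r (G2 m)) powr (1 - 2 / real (k m))\<bar>) sequentially"
    using landau_o.smallD[OF cost_small_2, of "a * c / (16 * ln 4)"] a c by simp
  moreover have "eventually (\<lambda>m. real (C m) \<le> \<beta> * c / (12 * ln 4) * \<bar>real (rs_t (G1 m)) * real (rs_r (G1 m))\<bar>) sequentially"
    using landau_o.smallD[OF cost_small_1, of "\<beta> * c / (12 * ln 4)"] \<beta> c by simp
  \<comment> \<open>\<open>Suc R\<close> makes the moment bound applicable and r1 positive; the
    second entry makes 1 / \<theta>1 at most c/4.\<close>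
  moreover have "eventually (\<lambda>m. max (Suc R) (nat \<lceil>4 / (c * \<beta>)\<rceil>) \<le> rs_r (G1 m)) sequentially"
    using r1_limit unfolding filterlim_at_top by blast
  ultimately show "eventually (\<lambda>m. norm (hm_val \<delta> (k m) (G1 m) (G2 m) (\<pi> m)) \<le> c * norm (real (rs_r (G1 m)))) sequentially"
  proof eventually_elim
    case (elim m)
    define K r1 t1 r2 t2 where "K = k m" and "r1 = real (rs_r (G1 m))" and "t1 = real (rs_t (G1 m))"
      and "r2 = real (rs_r (G2 m))" and "t2 = real (rs_t (G2 m))"
    have K: "2 \<le> K" and t: "0 < t1" "0 < t2" and r2: "r2 = (real K + \<delta>) * real (rs_n (G1 m))"
      and rs1: "is_rs_graph (G1 m)" "0 < rs_t (G1 m)"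
      using params[of m] by (auto simp: hm_params_def K_def t1_def t2_def r2_def)
    have r1: "Suc R \<le> rs_r (G1 m)" "4 / (c * \<beta>) \<le> r1" using elim(3) unfolding r1_def by linarith+
    have r1pos: "0 < r1" using r1(1) by (simp add: r1_def)
    have n: "rs_r (G1 m) \<le> rs_n (G1 m)" by (rule rs_r_le_rs_n[OF rs1])
    have "real (rs_n (G1 m)) \<le> r2"
      unfolding r2 using K \<delta> by (intro mult_right_mono[of 1 _ "real (rs_n (G1 m))", simplified]) auto
    then have R2: "R \<le> rs_r (G2 m)" "0 < r2" using n r1(1) unfolding r2_def by linarith+
    obtain \<theta> where \<theta>: "0 < \<theta>" "a * r2 powr (1 - 2 / real K) \<le> \<theta>" and
      mom: "\<And>(I :: nat set) y w. random_blocks I (rs_n (G1 m)) K y w \<Longrightarrow> card I = rs_r (G2 m) \<Longrightarrow>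
        (\<forall>x\<in>Pow I. random_blocks.bias I (rs_n (G1 m)) K y w x \<le> 1) \<Longrightarrow>
        cube_avg I (\<lambda>x. exp (\<theta> * random_blocks.bias I (rs_n (G1 m)) K y w x)) \<le> exp (\<theta> * (c / 16))"
      using unif[OF K r2[unfolded r2_def] R2(1)] unfolding r2_def by blast
    define \<theta>1 where "\<theta>1 = \<beta> * r1"
    have \<theta>1: "0 < \<theta>1" using \<beta> r1pos by (simp add: \<theta>1_def)
    have "hm_val \<delta> K (G1 m) (G2 m) (\<pi> m) \<le> r1 * (\<gamma> + 2 * (c / 16 + C m * ln 4 / (\<theta> * t2)) + 3 * real (C m) * ln 4 / (\<theta>1 * t1)
        + exp \<theta>1 * (1 - \<delta>) powr (\<gamma> * r1) / \<theta>1)"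
      unfolding r1_def t1_def t2_def K_def
      by (rule hm_val_le[OF params cost \<gamma>(1,2) \<theta>(1) \<theta>1]) (rule mom[unfolded K_def])
    \<comment> \<open>Four quarters of c: outputs that are too small, hiding on the two sides, the
      union bound over Alice's graph, and the chance survival of a large set.\<close>
    also have "\<dots> \<le> r1 * (c / 4 + 2 * (c / 16 + c / 16) + c / 4 + c / 4)"
    proof (intro mult_left_mono add_mono order.refl)
      show "\<gamma> \<le> c / 4" by (rule \<gamma>)
      have "C m * ln 4 \<le> (a * c / (16 * ln 4) * (t2 * r2 powr (1 - 2 / real K))) * ln 4"
      proof (intro mult_right_mono)
        show "real (C m) \<le> a * c / (16 * ln 4) * (t2 * r2 powr (1 - 2 / real K))"
          using elim(1) unfolding t2_def r2_def K_def by (simp only: abs_mult abs_of_nat abs_of_nonneg[OF powr_ge_zero])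
      qed (use ln4 in auto)
      also have "\<dots> = c / 16 * (a * r2 powr (1 - 2 / real K) * t2)" using ln4 by simp
      also have "\<dots> \<le> c / 16 * (\<theta> * t2)" using \<theta> c t by (intro mult_left_mono mult_right_mono) auto
      finally show "C m * ln 4 / (\<theta> * t2) \<le> c / 16" using \<theta> t by (simp add: pos_divide_le_eq)
      have "3 * real (C m) * ln 4 \<le> 3 * (\<beta> * c / (12 * ln 4) * (t1 * r1)) * ln 4"
      proof (intro mult_right_mono mult_left_mono)
        show "real (C m) \<le> \<beta> * c / (12 * ln 4) * (t1 * r1)"
          using elim(2) unfolding t1_def r1_def by (simp only: abs_mult abs_of_nat)
      qed (use ln4 in auto)
      also have "\<dots> = c / 4 * (\<theta>1 * t1)" using ln4 by (simp add: \<theta>1_def)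
      finally show "3 * real (C m) * ln 4 / (\<theta>1 * t1) \<le> c / 4" using \<theta>1 t by (simp add: pos_divide_le_eq)
      have "exp \<theta>1 * (1 - \<delta>) powr (\<gamma> * r1) = exp (- \<theta>1)"
        using \<delta> by (simp add: powr_def exp_add[symmetric] \<theta>1_def \<beta>_def)
      also have "\<dots> \<le> 1" using \<theta>1 by simp
      finally have "exp \<theta>1 * (1 - \<delta>) powr (\<gamma> * r1) / \<theta>1 \<le> 1 / \<theta>1" using \<theta>1 by (intro divide_right_mono) auto
      also have "\<dots> \<le> c / 4" using r1(2) \<beta> c r1pos unfolding \<theta>1_def by (simp add: field_simps)
      finally show "exp \<theta>1 * (1 - \<delta>) powr (\<gamma> * r1) / \<theta>1 \<le> c / 4" .
    qed (use r1pos in auto)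
    also have "\<dots> = c * r1" by simp
    finally have "hm_val \<delta> K (G1 m) (G2 m) (\<pi> m) \<le> c * r1" .
    moreover have "0 \<le> hm_val \<delta> K (G1 m) (G2 m) (\<pi> m)"
      unfolding hm_val_def by (intro Bochner_Integration.integral_nonneg) auto
    ultimately show ?case by (simp add: K_def r1_def)
  qed
qed

end
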